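(* Let $p$ be a prime number, let $\Gamma$ be a finite simplicial graph without central vertices and let $\mathcal{G} = \{G_v \mid v \in V\Gamma\}$ be a family of non-trivial finitely generated residually $p$-finite groups. Then the graph product $\Gamma\mathcal{G}$ is $p$-IAS, $\operatorname{Out}_p(\Gamma\mathcal{G})$ is residually $p$-finite and $\operatorname{Out}(\Gamma\mathcal{G})$ is virtually residually $p$-finite.
   Context: Graphs are simplicial: $V\Gamma$ is a set and $E\Gamma \subseteq \binom{V\Gamma}{2}$. The graph product $\Gamma\mathcal{G}$ of a family of groups $\mathcal{G} = \{G_v \mid v\in V\Gamma\}$ is the quotient of the free product $\ast_{v \in V\Gamma} G_v$ by the relations $g_u g_v = g_v g_u$ for all $g_u \in G_u$, $g_v \in G_v$ whenever $\{u,v\}\in E\Gamma$. A vertex $v \in V\Gamma$ is central in $\Gamma$ if $\{u,v\}\in E\Gamma$ for all $u \in V\Gamma\setminus\{v\}$. A group $G$ is residually $p$-finite if for every $g \in G\setminus\{1\}$ there is $N \unlhd G$ with $G/N$ a finite $p$-group and $g\notin N$. A group is virtually residually $p$-finite if it has a finite-index subgroup that is residually $p$-finite. A group $G$ is $p$-inner automorphism separable ($p$-IAS) if for every $\phi \in \operatorname{Aut}(G)\setminus\operatorname{Inn}(G)$ there is a characteristic subgroup $K$ of $G$ with $G/K$ a finite $p$-group such that $\tilde{\kappa}(\phi)\notin \operatorname{Inn}(G/K)$, where $\tilde{\kappa}\colon\operatorname{Aut}(G)\to\operatorname{Aut}(G/K)$ is given by $\tilde{\kappa}(\psi)(gK)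 = \psi(g)K$. For a group $G$, let $K_p = [G,G]G_p$, where $G_p$ is the subgroup generated by all $g^p$, $g \in G$. Then $\operatorname{Aut}_p(G)$ is the kernel of the natural homomorphism $\operatorname{Aut}(G)\to\operatorname{Aut}(G/K_p)$; it contains $\operatorname{Inn}(G)$, and $\operatorname{Out}_p(G) = \operatorname{Aut}_p(G)/\operatorname{Inn}(G) \leq \operatorname{Out}(G)= \operatorname{Aut}(G)/\operatorname{Inn}(G)$. *)

theory Defs
  imports "HOL-Algebra.Algebra" "HOL-Computational_Algebra.Primes"
begin

section \<open>Finite \<open>p\<close>-groups and residual properties\<close>

definition finite_p_group :: "nat \<Rightarrow> ('a, 'b) monoid_scheme \<Rightarrow> bool"
  where "finite_p_group p G \<longleftrightarrow> group G \<and> finite (carrier G) \<and> (\<exists>n. order G = p ^ n)"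

definition residually_p_finite :: "nat \<Rightarrow> ('a, 'b) monoid_scheme \<Rightarrow> bool"
  where "residually_p_finite p G \<longleftrightarrow>
    (\<forall>g \<in> carrier G - {\<one>\<^bsub>G\<^esub>}. \<exists>N. N \<lhd> G \<and> finite_p_group p (G Mod N) \<and> g \<notin> N)"

definition virtually_residually_p_finite :: "nat \<Rightarrow> ('a, 'b) monoid_scheme \<Rightarrow> bool"
  where "virtually_residually_p_finite p G \<longleftrightarrow>
    (\<exists>H. subgroup H G \<and> finite (rcosets\<^bsub>G\<^esub> H) \<and> residually_p_finite p (G\<lparr>carrier := H\<rparr>))"

definition finitely_generated_group :: "('a, 'b) monoid_scheme \<Rightarrow> bool"
  where "finitely_generated_group G \<longleftrightarrow>
    (\<exists>S. finite S \<and> S \<subseteq> carrier G \<and> generate G S = carrier G)"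


section \<open>Inner automorphisms and induced automorphisms\<close>

definition inner_autos :: "('a, 'b) monoid_scheme \<Rightarrow> ('a \<Rightarrow> 'a) set"
  where "inner_autos G =
    (\<lambda>g. \<lambda>x \<in> carrier G. g \<otimes>\<^bsub>G\<^esub> x \<otimes>\<^bsub>G\<^esub> inv\<^bsub>G\<^esub> g) ` carrier G"

definition OutGroup :: "('a, 'b) monoid_scheme \<Rightarrow> ('a \<Rightarrow> 'a) set monoid"
  where "OutGroup G = AutoGroup G Mod inner_autos G"

definition characteristic_subgroup :: "'a set \<Rightarrow> ('a, 'b) monoid_scheme \<Rightarrow> bool"
  where "characteristic_subgroup K G \<longleftrightarrow> subgroup K G \<and> (\<forall>\<phi> \<in> auto G. \<phi> ` K = K)"

text \<open>The map \<open>Aut(G) \<rightarrow> Aut(G/K)\<close>. For characteristic \<open>K\<close> the image of the coset of \<open>g\<close>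
  under \<open>\<phi>\<close> is the coset of \<open>\<phi> g\<close>, see \<open>induced_auto_rcoset\<close> below.\<close>

definition induced_auto :: "('a, 'b) monoid_scheme \<Rightarrow> 'a set \<Rightarrow> ('a \<Rightarrow> 'a) \<Rightarrow> 'a set \<Rightarrow> 'a set"
  where "induced_auto G K \<phi> = (\<lambda>C \<in> carrier (G Mod K). \<phi> ` C)"

lemma induced_auto_rcoset:
  assumes "characteristic_subgroup K G" "\<phi> \<in> auto G" "g \<in> carrier G"
  shows "induced_auto G K \<phi> (K #>\<^bsub>G\<^esub> g) = K #>\<^bsub>G\<^esub> \<phi> g"
proof -
  have K: "K \<subseteq> carrier G" "\<phi> ` K = K"
    using assms by (auto simp: characteristic_subgroup_def subgroup_def)
  have mult: "\<phi> (k \<otimes>\<^bsub>G\<^esub> g) = \<phi> k \<otimes>\<^bsub>G\<^esub> \<phi> g" if "k \<in> K" for k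
    using that K assms by (auto simp: auto_def hom_def)
  have "\<phi> ` (K #>\<^bsub>G\<^esub> g) = \<phi> ` K #>\<^bsub>G\<^esub> \<phi> g"
    using mult by (fastforce simp: r_coset_def image_iff)
  then show ?thesis
    using assms K by (simp add: induced_auto_def carrier_FactGroup)
qed

definition p_inner_automorphism_separable :: "nat \<Rightarrow> ('a, 'b) monoid_scheme \<Rightarrow> bool"
  where "p_inner_automorphism_separable p G \<longleftrightarrow>
    (\<forall>\<phi> \<in> auto G - inner_autos G. \<exists>K. characteristic_subgroup K G \<and>
        finite_p_group p (G Mod K) \<and> induced_auto G K \<phi> \<notin> inner_autos (G Mod K))"


section \<open>\<open>Aut\<^sub>p\<close> and \<open>Out\<^sub>p\<close>\<close>

definition K_subgroup :: "nat \<Rightarrow> ('a, 'b) monoid_scheme \<Rightarrow> 'a set"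
  where "K_subgroup p G =
    derived G (carrier G) <#>\<^bsub>G\<^esub> generate G {g [^]\<^bsub>G\<^esub> p | g. g \<in> carrier G}"

definition auto_p :: "nat \<Rightarrow> ('a, 'b) monoid_scheme \<Rightarrow> ('a \<Rightarrow> 'a) set"
  where "auto_p p G =
    kernel (AutoGroup G) (AutoGroup (G Mod K_subgroup p G)) (induced_auto G (K_subgroup p G))"

definition OutpGroup :: "nat \<Rightarrow> ('a, 'b) monoid_scheme \<Rightarrow> ('a \<Rightarrow> 'a) set monoid"
  where "OutpGroup p G = (AutoGroup G)\<lparr>carrier := auto_p p G\<rparr> Mod inner_autos G"


section \<open>Free products\<close>

text \<open>Elements of the free product of the groups \<open>G i\<close>, \<open>i \<in> I\<close>, are classes of words in the
  disjoint union of the carriers; two words are identified if one can be turned into the other by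
  inserting or deleting identity letters and by merging or splitting letters from the same group.\<close>

definition fp_words :: "'i set \<Rightarrow> ('i \<Rightarrow> ('a, 'b) monoid_scheme) \<Rightarrow> ('i \<times> 'a) list set"
  where "fp_words I G = lists (SIGMA i:I. carrier (G i))"

inductive_set fp_rel ::
    "'i set \<Rightarrow> ('i \<Rightarrow> ('a, 'b) monoid_scheme) \<Rightarrow> (('i \<times> 'a) list \<times> ('i \<times> 'a) list) set"
  for I and G where
  refl: "w \<in> fp_words I G \<Longrightarrow> (w, w) \<in> fp_rel I G"
| sym: "(w, w') \<in> fp_rel I G \<Longrightarrow> (w', w) \<in> fp_rel I G"
| trans: "(w, w') \<in> fp_rel I G \<Longrightarrow> (w', w'') \<in> fp_rel I G \<Longrightarrow> (w, w'') \<in> fp_rel I G"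
| unit: "us \<in> fp_words I G \<Longrightarrow> vs \<in> fp_words I G \<Longrightarrow> i \<in> I \<Longrightarrow>
    (us @ [(i, \<one>\<^bsub>G i\<^esub>)] @ vs, us @ vs) \<in> fp_rel I G"
| merge: "us \<in> fp_words I G \<Longrightarrow> vs \<in> fp_words I G \<Longrightarrow> i \<in> I \<Longrightarrow>
    x \<in> carrier (G i) \<Longrightarrow> y \<in> carrier (G i) \<Longrightarrow>
    (us @ [(i, x), (i, y)] @ vs, us @ [(i, x \<otimes>\<^bsub>G i\<^esub> y)] @ vs) \<in> fp_rel I G"

definition free_product ::
    "'i set \<Rightarrow> ('i \<Rightarrow> ('a, 'b) monoid_scheme) \<Rightarrow> ('i \<times> 'a) list set monoid"
  where "free_product I G =
    \<lparr>carrier = fp_words I G // fp_rel I G,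
     monoid.mult = (\<lambda>A B. \<Union>u \<in> A. \<Union>v \<in> B. fp_rel I G `` {u @ v}),
     one = fp_rel I G `` {[]}\<rparr>"

definition fp_incl ::
    "'i set \<Rightarrow> ('i \<Rightarrow> ('a, 'b) monoid_scheme) \<Rightarrow> 'i \<Rightarrow> 'a \<Rightarrow> ('i \<times> 'a) list set"
  where "fp_incl I G i x = fp_rel I G `` {[(i, x)]}"

lemma fp_words_append [simp]:
  "u @ v \<in> fp_words I G \<longleftrightarrow> u \<in> fp_words I G \<and> v \<in> fp_words I G"
  by (simp add: fp_words_def)

lemma fp_words_Nil [simp]: "[] \<in> fp_words I G"
  by (simp add: fp_words_def)

lemma fp_words_Cons [simp]:
  "(i, x) # w \<in> fp_words I G \<longleftrightarrow> i \<in> I \<and> x \<in> carrier (G i) \<and> w \<in> fp_words I G"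
  by (auto simp: fp_words_def)

context
  fixes I :: "'i set" and G :: "'i \<Rightarrow> ('a, 'b) monoid_scheme"
  assumes groups: "\<And>i. i \<in> I \<Longrightarrow> group (G i)"
begin

lemma fp_rel_words: "(u, v) \<in> fp_rel I G \<Longrightarrow> u \<in> fp_words I G \<and> v \<in> fp_words I G"
proof (induction rule: fp_rel.induct)
  case (unit us vs i)
  then interpret group "G i" using groups by blast
  show ?case using unit by simp
next
  case (merge us vs i x y)
  then interpret group "G i" using groups by blast
  show ?case using merge by simp
qed simp_all

lemma fp_rel_equiv: "equiv (fp_words I G) (fp_rel I G)"
proof (rule equivI)
  show "fp_rel I G \<subseteq> fp_words I G \<times> fp_words I G"
    using fp_rel_words by auto
  show "refl_on (fp_words I G) (fp_rel I G)"
    by (rule refl_onI) (rule fp_rel.refl)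
  show "sym (fp_rel I G)" by (rule symI) (rule fp_rel.sym)
  show "trans (fp_rel I G)" by (rule transI) (rule fp_rel.trans)
qed

lemma fp_rel_context:
  assumes "(u, v) \<in> fp_rel I G" "l \<in> fp_words I G" "r \<in> fp_words I G"
  shows "(l @ u @ r, l @ v @ r) \<in> fp_rel I G"
  using assms(1)
proof (induction rule: fp_rel.induct)
  case (refl w)
  then show ?case using assms by (intro fp_rel.refl) simp
next
  case (sym w w')
  from sym.IH show ?case by (rule fp_rel.sym)
next
  case (trans w w' w'')
  from trans.IH show ?case by (rule fp_rel.trans)
next
  case (unit us vs i)
  then show ?case using fp_rel.unit[of "l @ us" I G "vs @ r" i] assms by simp
next
  case (merge us vs i x y)
  then show ?case using fp_rel.merge[of "l @ us" I G "vs @ r" i x y] assms by simp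
qed

lemma fp_rel_append:
  assumes "(u, u') \<in> fp_rel I G" "(v, v') \<in> fp_rel I G"
  shows "(u @ v, u' @ v') \<in> fp_rel I G"
proof -
  have "(u @ v, u' @ v) \<in> fp_rel I G"
    using fp_rel_context[OF assms(1), of "[]" v] fp_rel_words[OF assms(2)] by simp
  moreover have "(u' @ v, u' @ v') \<in> fp_rel I G"
    using fp_rel_context[OF assms(2), of u' "[]"] fp_rel_words[OF assms(1)] by simp
  ultimately show ?thesis by (rule fp_rel.trans)
qed

lemma free_product_mult:
  assumes "u \<in> fp_words I G" "v \<in> fp_words I G"
  shows "fp_rel I G `` {u} \<otimes>\<^bsub>free_product I G\<^esub> fp_rel I G `` {v} = fp_rel I G `` {u @ v}"
proof -
  have *: "fp_rel I G `` {u' @ v'} = fp_rel I G `` {u @ v}"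
    if "(u, u') \<in> fp_rel I G" "(v, v') \<in> fp_rel I G" for u' v'
    using equiv_class_eq[OF fp_rel_equiv fp_rel_append[OF that]] by simp
  have "(u, u) \<in> fp_rel I G" "(v, v) \<in> fp_rel I G"
    using assms by (auto intro: fp_rel.refl)
  then show ?thesis
    unfolding free_product_def monoid.simps using * by blast
qed

lemma fp_rel_inverse:
  assumes "w \<in> fp_words I G"
  shows "\<exists>w' \<in> fp_words I G. (w' @ w, []) \<in> fp_rel I G"
  using assms
proof (induction w)
  case Nil
  then show ?case by (auto intro!: bexI[of _ "[]"] fp_rel.refl)
next
  case (Cons a w)
  obtain i x where a: "a = (i, x)" by force
  with Cons have i: "i \<in> I" "x \<in> carrier (G i)" "w \<in> fp_words I G" by auto
  interpret group "G i" using groups i by blast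
  obtain w' where w': "w' \<in> fp_words I G" "(w' @ w, []) \<in> fp_rel I G"
    using Cons.IH i by blast
  have "(w' @ [(i, inv\<^bsub>G i\<^esub> x), (i, x)] @ w, w' @ [(i, \<one>\<^bsub>G i\<^esub>)] @ w) \<in> fp_rel I G"
    using fp_rel.merge[of w' I G w i "inv\<^bsub>G i\<^esub> x" x] i w' by simp
  also have "(w' @ [(i, \<one>\<^bsub>G i\<^esub>)] @ w, w' @ w) \<in> fp_rel I G"
    using i w' by (intro fp_rel.unit)
  finally (fp_rel.trans) have "(w' @ [(i, inv\<^bsub>G i\<^esub> x), (i, x)] @ w, []) \<in> fp_rel I G"
    using w'(2) by (rule fp_rel.trans)
  then show ?case
    using i w' a by (intro bexI[of _ "w' @ [(i, inv\<^bsub>G i\<^esub> x)]"]) auto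
qed

lemma group_free_product: "group (free_product I G)"
proof (rule groupI)
  let ?F = "free_product I G" and ?R = "fp_rel I G" and ?W = "fp_words I G"
  have carr: "carrier ?F = ?W // ?R" and one: "\<one>\<^bsub>?F\<^esub> = ?R `` {[]}"
    by (simp_all add: free_product_def)
  have reps: "\<exists>w \<in> ?W. A = ?R `` {w}" if "A \<in> carrier ?F" for A
    using that carr by (auto elim: quotientE)
  show "\<one>\<^bsub>?F\<^esub> \<in> carrier ?F"
    by (auto simp: carr one intro: quotientI)
  show "A \<otimes>\<^bsub>?F\<^esub> B \<in> carrier ?F" if AB: "A \<in> carrier ?F" "B \<in> carrier ?F" for A B
  proof -
    obtain u v where "u \<in> ?W" "A = ?R `` {u}" "v \<in> ?W" "B = ?R `` {v}"
      using reps[OF AB(1)] reps[OF AB(2)] by blast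
    then show ?thesis by (simp add: free_product_mult carr quotientI)
  qed
  show "A \<otimes>\<^bsub>?F\<^esub> B \<otimes>\<^bsub>?F\<^esub> C = A \<otimes>\<^bsub>?F\<^esub> (B \<otimes>\<^bsub>?F\<^esub> C)"
    if ABC: "A \<in> carrier ?F" "B \<in> carrier ?F" "C \<in> carrier ?F" for A B C
  proof -
    obtain u v w where "u \<in> ?W" "A = ?R `` {u}" "v \<in> ?W" "B = ?R `` {v}" "w \<in> ?W" "C = ?R `` {w}"
      using reps[OF ABC(1)] reps[OF ABC(2)] reps[OF ABC(3)] by blast
    then show ?thesis by (simp add: free_product_mult)
  qed
  show "\<one>\<^bsub>?F\<^esub> \<otimes>\<^bsub>?F\<^esub> A = A" if "A \<in> carrier ?F" for A
  proof -
    obtain u where "u \<in> ?W" "A = ?R `` {u}"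
      using reps[OF \<open>A \<in> carrier ?F\<close>] by blast
    then show ?thesis by (simp add: free_product_mult one)
  qed
  show "\<exists>B \<in> carrier ?F. B \<otimes>\<^bsub>?F\<^esub> A = \<one>\<^bsub>?F\<^esub>" if A: "A \<in> carrier ?F" for A
  proof -
    obtain w where w: "w \<in> ?W" "A = ?R `` {w}" using reps[OF A] by blast
    obtain w' where w': "w' \<in> ?W" "(w' @ w, []) \<in> ?R" using fp_rel_inverse[OF w(1)] by blast
    have "?R `` {w'} \<otimes>\<^bsub>?F\<^esub> A = \<one>\<^bsub>?F\<^esub>"
      using w w' equiv_class_eq[OF fp_rel_equiv w'(2)] by (simp add: free_product_mult one)
    then show ?thesis using w' carr by (auto intro: quotientI)
  qed
qed

lemma fp_incl_hom: "i \<in> I \<Longrightarrow> fp_incl I G i \<in> hom (G i) (free_product I G)"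
proof (rule homI)
  fix x y assume i: "i \<in> I" and xy: "x \<in> carrier (G i)" "y \<in> carrier (G i)"
  show "fp_incl I G i x \<in> carrier (free_product I G)"
    using i xy by (auto simp: fp_incl_def free_product_def intro: quotientI)
  show "fp_incl I G i (x \<otimes>\<^bsub>G i\<^esub> y)
      = fp_incl I G i x \<otimes>\<^bsub>free_product I G\<^esub> fp_incl I G i y"
    using fp_rel.merge[of "[]" I G "[]" i x y] i xy equiv_class_eq[OF fp_rel_equiv]
    by (auto simp: fp_incl_def free_product_mult)
qed

end


section \<open>Graph products\<close>

definition simplicial_graph :: "'v set \<Rightarrow> 'v set set \<Rightarrow> bool"
  where "simplicial_graph V E \<longleftrightarrow> E \<subseteq> {e. e \<subseteq> V \<and> card e = 2}"

definition central_vertex :: "'v set \<Rightarrow> 'v set set \<Rightarrow> 'v \<Rightarrow> bool"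
  where "central_vertex V E v \<longleftrightarrow> v \<in> V \<and> (\<forall>u \<in> V - {v}. {u, v} \<in> E)"

definition normal_closure :: "('a, 'b) monoid_scheme \<Rightarrow> 'a set \<Rightarrow> 'a set"
  where "normal_closure G S =
    generate G {g \<otimes>\<^bsub>G\<^esub> s \<otimes>\<^bsub>G\<^esub> inv\<^bsub>G\<^esub> g | g s. g \<in> carrier G \<and> s \<in> S}"

text \<open>The relation \<open>a b = b a\<close> is imposed by killing the relator \<open>a b a\<^sup>-\<^sup>1 b\<^sup>-\<^sup>1\<close>.\<close>

definition commutation_relators ::
    "'v set \<Rightarrow> 'v set set \<Rightarrow> ('v \<Rightarrow> ('a, 'b) monoid_scheme) \<Rightarrow> ('v \<times> 'a) list set set"
  where "commutation_relators V E G =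
    {a \<otimes>\<^bsub>free_product V G\<^esub> b \<otimes>\<^bsub>free_product V G\<^esub>
        inv\<^bsub>free_product V G\<^esub> a \<otimes>\<^bsub>free_product V G\<^esub> inv\<^bsub>free_product V G\<^esub> b | a b.
      \<exists>u \<in> V. \<exists>v \<in> V. {u, v} \<in> E \<and>
        a \<in> fp_incl V G u ` carrier (G u) \<and> b \<in> fp_incl V G v ` carrier (G v)}"

definition graph_product ::
    "'v set \<Rightarrow> 'v set set \<Rightarrow> ('v \<Rightarrow> ('a, 'b) monoid_scheme) \<Rightarrow> ('v \<times> 'a) list set set monoid"
  where "graph_product V E G =
    free_product V G Mod normal_closure (free_product V G) (commutation_relators V E G)"

lemma (in group) normal_closure_normal:
  assumes "S \<subseteq> carrier G"
  shows "normal_closure G S \<lhd> G"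
  unfolding normal_closure_def
proof (rule normal_generateI)
  show "{g \<otimes> s \<otimes> inv g | g s. g \<in> carrier G \<and> s \<in> S} \<subseteq> carrier G"
    using assms by auto
next
  fix h g
  assume "h \<in> {g \<otimes> s \<otimes> inv g | g s. g \<in> carrier G \<and> s \<in> S}" and g: "g \<in> carrier G"
  then obtain k s where k: "k \<in> carrier G" "s \<in> S" "h = k \<otimes> s \<otimes> inv k" by auto
  then have "g \<otimes> h \<otimes> inv g = (g \<otimes> k) \<otimes> s \<otimes> inv (g \<otimes> k)"
    using g assms by (simp add: m_assoc inv_mult_group subset_iff)
  then show "g \<otimes> h \<otimes> inv g \<in> {g \<otimes> s \<otimes> inv g | g s. g \<in> carrier G \<and> s \<in> S}"
    using k g by blast
qed

lemma group_graph_product: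
  assumes "\<And>v. v \<in> V \<Longrightarrow> group (G v)"
  shows "group (graph_product V E G)"
proof -
  interpret F: group "free_product V G"
    using assms by (rule group_free_product)
  have "fp_incl V G u ` carrier (G u) \<subseteq> carrier (free_product V G)" if "u \<in> V" for u
    using fp_incl_hom[of V G u] assms that by (auto simp: hom_def Pi_iff)
  then have "commutation_relators V E G \<subseteq> carrier (free_product V G)"
    unfolding commutation_relators_def by (blast intro: F.m_closed F.inv_closed)
  then show ?thesis
    unfolding graph_product_def
    by (intro normal.factorgroup_is_group F.normal_closure_normal)
qed

end

theory Submission
  imports Defs "HOL-Number_Theory.Cong"
begin

text \<open>
  Let \<open>W\<close> be the graph product and let \<open>\<phi>\<close> be an automorphism that becomes inner in every finite
  \<open>p\<close>-quotient of \<open>W\<close>. For a vertex \<open>v\<close> and a finite \<open>p\<close>-quotient \<open>Q\<close>, conjugating only the copy of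
  \<open>G v\<close> by the indicator function of the image of the link subgroup of \<open>v\<close> defines a twisted
  homomorphism from \<open>W\<close> to the wreath product of a cyclic group of order \<open>p\<close> with \<open>Q\<close>, that is, a
  cocycle that counts modulo \<open>p\<close> the edges of the Bass-Serre tree of the splitting of \<open>W\<close> at \<open>v\<close>.
  These finite quotients show that \<open>W\<close> is residually \<open>p\<close>-finite, and that an element which conjugates
  \<open>x \<in> G v - {1}\<close> into the star subgroup of \<open>v\<close> in the twisted quotient lies in the star subgroup
  modulo the kernel of \<open>W \<rightarrow> Q\<close>. A torsion argument shows that \<open>\<phi> x\<close> is conjugate in \<open>W\<close> to an
  element of the star subgroup of \<open>v\<close>, so the elements that implement \<open>\<phi>\<close> in the quotients lie in
  fixed cosets of all star subgroups. As parabolic subgroups are retracts and no vertex lies in all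
  stars, these cosets meet in a single element of \<open>W\<close>, and \<open>\<phi>\<close> is conjugation by that element.
  The statements on outer automorphism groups follow since by Hall's theorem the kernel of
  \<open>Aut P \<rightarrow> Aut (P / K\<^sub>p)\<close> is a \<open>p\<close>-group for every finite \<open>p\<close>-group \<open>P\<close>.
\<close>

text \<open>The element that implements \<phi> in W / N changes with N, so a priori these elements
  define a point of the pro-p completion only, and the whole effort goes into replacing it by an
  element of W. The wreath product appears for the following reason. An indicator function on W / N
  is not invariant under W, but if it is invariant under the link of v, then its coboundary may be
  prescribed on the vertex group at v and zero on all others without violating a commutation
  relation. The resulting cocycle is a coboundary on every vertex group but need not be one on W,
  and this is what detects information about words. A wreath product of a cyclic group of order p
  with a finite p-group is again a finite p-group, so the counting never leaves the allowed
  quotients. No normal form theorem is presupposed: reduced words are produced by rewriting, and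
  their nontriviality comes from the cocycle by induction on the length. The locale
  \<open>twistable_product\<close> isolates what these arguments take from a graph product.\<close>

lemma (in group) inv_cancel_left [simp]:
  "x \<in> carrier G \<Longrightarrow> y \<in> carrier G \<Longrightarrow> inv x \<otimes> (x \<otimes> y) = y"
  "x \<in> carrier G \<Longrightarrow> y \<in> carrier G \<Longrightarrow> x \<otimes> (inv x \<otimes> y) = y"
  by (simp_all flip: m_assoc)

section \<open>Normal subgroups of finite \<open>p\<close>-power index\<close>

text \<open>These subgroups form a basis of neighbourhoods of 1 in the pro-p topology. The
  separation statements below say that some element or set avoids a neighbourhood of this
  kind.\<close>

definition p_normal :: "nat \<Rightarrow> 'a set \<Rightarrow> ('a, 'b) monoid_scheme \<Rightarrow> bool"
  where "p_normal p N G \<longleftrightarrow> N \<lhd> G \<and> finite_p_group p (G Mod N)"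

lemma p_normal_imp_normal: "p_normal p N G \<Longrightarrow> N \<lhd> G"
  and p_normal_imp_finite_p_group: "p_normal p N G \<Longrightarrow> finite_p_group p (G Mod N)"
  by (simp_all add: p_normal_def)

lemma finite_p_group_subgroup:
  assumes "Factorial_Ring.prime p" "finite_p_group p G" "subgroup H G"
  shows "finite_p_group p (G\<lparr>carrier := H\<rparr>)"
proof -
  interpret group G using assms by (simp add: finite_p_group_def)
  obtain n where n: "order G = p ^ n" "finite (carrier G)"
    using assms by (auto simp: finite_p_group_def)
  have "card H dvd p ^ n"
    using lagrange[OF assms(3)] n by (metis dvd_triv_right)
  then have "\<exists>i. card H = p ^ i"
    using assms(1) by (meson divides_primepow_nat)
  moreover have "finite H"
    using n assms(3) subgroup.subset finite_subset by blast
  ultimately show ?thesis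
    using subgroup.subgroup_is_group[OF assms(3)] by (simp add: finite_p_group_def order_def is_group)
qed

lemma finite_p_group_iso:
  assumes "G \<cong> H" "group G" "finite_p_group p H"
  shows "finite_p_group p G"
proof -
  obtain h where "bij_betw h (carrier G) (carrier H)"
    using assms(1) by (auto simp: is_iso_def iso_def)
  then show ?thesis
    using assms by (auto simp: finite_p_group_def order_def bij_betw_finite bij_betw_same_card)
qed

lemma p_normal_kernel:
  assumes "Factorial_Ring.prime p" "group G" "finite_p_group p H" "h \<in> hom G H"
  shows "p_normal p (kernel G H h) G"
proof -
  have H: "group H" using assms by (simp add: finite_p_group_def)
  interpret h: group_hom G H h
    using assms H by (simp add: group_hom_def group_hom_axioms_def)
  let ?I = "H\<lparr>carrier := h ` carrier G\<rparr>"
  have "finite_p_group p ?I"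
    by (rule finite_p_group_subgroup) (use assms h.img_is_subgroup in auto)
  moreover have "group_hom G ?I h"
    using h.img_is_subgroup h.group_axioms assms calculation
    by (auto simp: group_hom_def group_hom_axioms_def finite_p_group_def hom_def)
  then have "G Mod kernel G ?I h \<cong> ?I"
    by (rule group_hom.FactGroup_iso) simp
  moreover have "kernel G ?I h = kernel G H h"
    by (simp add: kernel_def)
  ultimately show ?thesis
    using h.normal_kernel finite_p_group_iso normal.factorgroup_is_group
    by (metis p_normal_def)
qed

lemma p_normal_vimage:
  assumes "Factorial_Ring.prime p" "group G" "p_normal p N H" "h \<in> hom G H"
  shows "p_normal p {g \<in> carrier G. h g \<in> N} G"
proof -
  interpret N: normal N H using assms by (simp add: p_normal_def)
  have "(\<lambda>g. N #>\<^bsub>H\<^esub> h g) \<in> hom G (H Mod N)"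
    using hom_compose[OF assms(4) N.r_coset_hom_Mod] by (simp add: o_def)
  then have "p_normal p (kernel G (H Mod N) (\<lambda>g. N #>\<^bsub>H\<^esub> h g)) G"
    using assms p_normal_kernel[of p G "H Mod N"] by (simp add: p_normal_def)
  moreover have "N #>\<^bsub>H\<^esub> h g = N \<longleftrightarrow> h g \<in> N" if "g \<in> carrier G" for g
    using that assms(4) N.coset_join2 N.rcos_self N.subgroup_axioms
    by (metis hom_in_carrier)
  then have "kernel G (H Mod N) (\<lambda>g. N #>\<^bsub>H\<^esub> h g) = {g \<in> carrier G. h g \<in> N}"
    by (auto simp: kernel_def)
  ultimately show ?thesis by simp
qed

lemma finite_p_group_DirProd:
  assumes "finite_p_group p G" "finite_p_group p H"
  shows "finite_p_group p (G \<times>\<times> H)"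
proof -
  obtain m n where "order G = p ^ m" "order H = p ^ n"
    using assms by (auto simp: finite_p_group_def)
  then have "order (G \<times>\<times> H) = p ^ (m + n)"
    by (simp add: order_def DirProd_def card_cartesian_product power_add)
  then show ?thesis
    using assms by (auto simp: finite_p_group_def DirProd_group)
qed

lemma p_normal_Int:
  assumes "Factorial_Ring.prime p" "p_normal p M G" "p_normal p N G"
  shows "p_normal p (M \<inter> N) G"
proof -
  interpret M: normal M G using assms by (simp add: p_normal_def)
  interpret N: normal N G using assms by (simp add: p_normal_def)
  let ?h = "\<lambda>g. (M #>\<^bsub>G\<^esub> g, N #>\<^bsub>G\<^esub> g)"
  have "?h \<in> hom G ((G Mod M) \<times>\<times> (G Mod N))"
    using M.r_coset_hom_Mod N.r_coset_hom_Mod by (auto simp: hom_def)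
  then have "p_normal p (kernel G ((G Mod M) \<times>\<times> (G Mod N)) ?h) G"
    using assms by (intro p_normal_kernel finite_p_group_DirProd)
      (simp_all add: p_normal_def M.is_group)
  moreover have "M #>\<^bsub>G\<^esub> g = M \<longleftrightarrow> g \<in> M" "N #>\<^bsub>G\<^esub> g = N \<longleftrightarrow> g \<in> N" if "g \<in> carrier G" for g
    using that M.coset_join2 M.rcos_self M.subgroup_axioms N.subgroup_axioms by metis+
  then have "kernel G ((G Mod M) \<times>\<times> (G Mod N)) ?h = M \<inter> N"
    using M.subset by (auto simp: kernel_def)
  ultimately show ?thesis by simp
qed

lemma p_normal_carrier:
  assumes "Factorial_Ring.prime p" "group G"
  shows "p_normal p (carrier G) G"
proof -
  interpret group G by fact
  interpret N: normal "carrier G" G by (rule normal_self)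
  have "carrier (G Mod carrier G) = {carrier G}"
    using coset_join2[OF _ subgroup_self] by (auto simp: carrier_FactGroup)
  then have "order (G Mod carrier G) = p ^ 0" "finite (carrier (G Mod carrier G))"
    by (simp_all add: order_def)
  then show ?thesis
    unfolding p_normal_def finite_p_group_def using N.factorgroup_is_group N.normal_axioms by blast
qed

text \<open>The factor \<open>carrier G\<close> gives the intersection its intended value when I is
  empty.\<close>

lemma p_normal_INT:
  assumes "Factorial_Ring.prime p" "group G" "finite I" "\<And>i. i \<in> I \<Longrightarrow> p_normal p (N i) G"
  shows "p_normal p (carrier G \<inter> (\<Inter>i\<in>I. N i)) G"
  using assms(3,4)
proof (induction I)
  case empty
  then show ?case using assms by (simp add: p_normal_carrier)
next
  case (insert i I)
  then have "p_normal p (N i \<inter> (carrier G \<inter> (\<Inter>i\<in>I. N i))) G"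
    using assms(1) by (auto intro: p_normal_Int[OF assms(1), of "N i"])
  moreover have "N i \<inter> (carrier G \<inter> (\<Inter>i\<in>I. N i)) = carrier G \<inter> (\<Inter>i\<in>insert i I. N i)"
    by auto
  ultimately show ?case by simp
qed

lemma p_normal_avoid_finite:
  assumes "Factorial_Ring.prime p" "group G" "finite S" "\<And>x. x \<in> S \<Longrightarrow> \<exists>N. p_normal p N G \<and> x \<notin> N"
  shows "\<exists>N. p_normal p N G \<and> S \<inter> N = {}"
proof -
  obtain N where "\<And>x. x \<in> S \<Longrightarrow> p_normal p (N x) G \<and> x \<notin> N x"
    using assms(4) by metis
  then show ?thesis
    using p_normal_INT[OF assms(1-3), of N] by (intro exI[of _ "carrier G \<inter> (\<Inter>x\<in>S. N x)"]) auto
qed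

text \<open>The property that left multiplication by x preserves P is itself closed under products,
  which is what the product case of \<open>generate\<close> needs; P x is recovered by applying it
  to \<open>\<one>\<close>.\<close>

lemma (in group) generate_induct_left [consumes 2, case_names one mult mult_inv]:
  assumes "x \<in> generate G S" "S \<subseteq> carrier G"
    and "P \<one>"
    and "\<And>s y. s \<in> S \<Longrightarrow> y \<in> generate G S \<Longrightarrow> P y \<Longrightarrow> P (s \<otimes> y)"
    and "\<And>s y. s \<in> S \<Longrightarrow> y \<in> generate G S \<Longrightarrow> P y \<Longrightarrow> P (inv s \<otimes> y)"
  shows "P x"
proof -
  have "\<forall>y \<in> generate G S. P y \<longrightarrow> P (x \<otimes> y)"
    using assms(1)
  proof induction
    case one
    then show ?case using generate_in_carrier[OF assms(2)] by auto
  next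
    case (eng a b)
    have "P (a \<otimes> (b \<otimes> y))" if "y \<in> generate G S" "P y" for y
      using that eng by (simp add: generate.eng)
    then show ?case
      using eng.hyps generate_in_carrier[OF assms(2)] by (metis m_assoc)
  qed (use assms in auto)
  moreover have "x \<in> carrier G"
    using assms generate_in_carrier by blast
  ultimately show ?thesis
    using assms(3) generate.one[of G S] by force
qed

lemma (in group) hom_eq_on_generate:
  assumes "group K" "f \<in> hom G K" "g \<in> hom G K" "S \<subseteq> carrier G" "\<And>s. s \<in> S \<Longrightarrow> f s = g s"
    and "x \<in> generate G S"
  shows "f x = g x"
proof -
  interpret f: group_hom G K f
    using assms is_group by (simp add: group_hom_def group_hom_axioms_def)
  interpret g: group_hom G K g
    using assms is_group by (simp add: group_hom_def group_hom_axioms_def)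
  show ?thesis
    using assms(6)
  proof induction
    case (inv h)
    then have "h \<in> carrier G" "f h = g h" using assms(4,5) by auto
    then show ?case by simp
  next
    case (eng a b)
    then show ?case using generate_in_carrier[OF assms(4)] by simp
  qed (use assms in simp_all)
qed

section \<open>Finite \<open>p\<close>-groups acting on finite sets\<close>

text \<open>Elements of \<open>BijGroup S\<close> are extensional, so a plain function
  \<open>act\<close> becomes a \<open>group_action\<close> only after restriction to S. This lemma
  keeps the restriction out of the statements of the two counting lemmas.\<close>

lemma group_action_restrict:
  fixes G (structure)
  assumes "group G" and closed: "\<And>g x. g \<in> carrier G \<Longrightarrow> x \<in> S \<Longrightarrow> act g x \<in> S"
    and one: "\<And>x. x \<in> S \<Longrightarrow> act \<one>\<^bsub>G\<^esub> x = x"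
    and mult: "\<And>g h x. g \<in> carrier G \<Longrightarrow> h \<in> carrier G \<Longrightarrow> x \<in> S \<Longrightarrow>
      act (g \<otimes>\<^bsub>G\<^esub> h) x = act g (act h x)"
  shows "group_action G S (\<lambda>g. \<lambda>x\<in>S. act g x)"
proof -
  interpret group G by fact
  have Bij: "(\<lambda>x\<in>S. act g x) \<in> Bij S" if g: "g \<in> carrier G" for g
  proof -
    have "bij_betw (act g) S S"
      by (rule bij_betw_byWitness[where f' = "act (inv g)"])
        (use g closed one in \<open>auto simp flip: mult\<close>)
    then show ?thesis by (simp add: Bij_def cong: bij_betw_cong)
  qed
  moreover have "(\<lambda>x\<in>S. act (g \<otimes> h) x) = compose S (\<lambda>x\<in>S. act g x) (\<lambda>x\<in>S. act h x)"
    if "g \<in> carrier G" "h \<in> carrier G" for g h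
    using that mult closed by (auto simp: compose_def fun_eq_iff)
  ultimately show ?thesis
    using group_BijGroup[of S] is_group
    by (intro group_action.intro group_hom.intro group_hom_axioms.intro homI) (auto simp: BijGroup_def)
qed

text \<open>Orbits of moved points have p-power length greater than 1. Modulo p, the number of fixed
  points therefore equals that of all points; central elements and elements of a normalizer are
  found as such fixed points.\<close>

lemma card_non_fixed_dvd:
  fixes G (structure)
  assumes p: "Factorial_Ring.prime p" and G: "finite_p_group p G" and S: "finite S"
    and closed: "\<And>g x. g \<in> carrier G \<Longrightarrow> x \<in> S \<Longrightarrow> act g x \<in> S"
    and one: "\<And>x. x \<in> S \<Longrightarrow> act \<one>\<^bsub>G\<^esub> x = x"
    and mult: "\<And>g h x. g \<in> carrier G \<Longrightarrow> h \<in> carrier G \<Longrightarrow> x \<in> S \<Longrightarrow>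
      act (g \<otimes>\<^bsub>G\<^esub> h) x = act g (act h x)"
  shows "p dvd card {x \<in> S. \<exists>g\<in>carrier G. act g x \<noteq> x}"
proof -
  interpret group G using G by (simp add: finite_p_group_def)
  let ?\<phi> = "\<lambda>g. \<lambda>x\<in>S. act g x"
  interpret A: group_action G S ?\<phi>
    by (rule group_action_restrict) (use closed one mult is_group in auto)
  \<comment> \<open>Being moved is constant on each orbit, so this indicator contributes either 0 or
    the orbit length to the sum over an orbit.\<close>
  let ?f = "\<lambda>x. of_bool (\<exists>g\<in>carrier G. act g x \<noteq> x) :: nat"
  have "p dvd (\<Sum>x\<in>orb. ?f x)" if "orb \<in> orbits G S ?\<phi>" for orb
  proof -
    obtain x where x: "x \<in> S" "orb = orbit G ?\<phi> x" using \<open>orb \<in> _\<close> by (auto simp: orbits_def)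
    have orb: "orb = (\<lambda>g. act g x) ` carrier G" using x by (auto simp: orbit_def)
    have fixed: "(\<exists>g\<in>carrier G. act g y \<noteq> y) \<longleftrightarrow> (\<exists>g\<in>carrier G. act g x \<noteq> x)" if y: "y \<in> orb" for y
    proof -
      obtain h where h: "h \<in> carrier G" "y = act h x" using y orb by auto
      have *: "act (inv h) y = x" using h x one mult[of "inv h" h x] by simp
      show ?thesis
      proof
        assume "\<exists>g\<in>carrier G. act g y \<noteq> y"
        then show "\<exists>g\<in>carrier G. act g x \<noteq> x" using h by metis
      next
        assume "\<exists>g\<in>carrier G. act g x \<noteq> x"
        then show "\<exists>g\<in>carrier G. act g y \<noteq> y" using h * by (metis inv_closed)
      qed
    qed
    show ?thesis
    proof (cases "\<exists>g\<in>carrier G. act g x \<noteq> x")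
      case True
      have "card orb * card (stabilizer G ?\<phi> x) = order G"
        using A.orbit_stabilizer_theorem[OF x(1)] x(2) by (simp add: mult.commute)
      moreover obtain n where "order G = p ^ n" using G by (auto simp: finite_p_group_def)
      ultimately obtain k where k: "card orb = p ^ k"
        using p by (metis divides_primepow_nat dvd_triv_left)
      have "x \<in> orb" using orb one[OF x(1)] by force
      obtain g where g: "g \<in> carrier G" "act g x \<noteq> x" using True by blast
      have "{x, act g x} \<subseteq> orb" using \<open>x \<in> orb\<close> g orb by auto
      moreover have "finite orb" using orb G by (simp add: finite_p_group_def)
      ultimately have "2 \<le> card orb" using g card_mono[of orb "{x, act g x}"] by auto
      then have "p dvd card orb" using k by (cases k) auto
      moreover have "(\<Sum>x\<in>orb. ?f x) = (\<Sum>x\<in>orb. 1)"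
        using fixed True by (intro sum.cong) auto
      ultimately show ?thesis by simp
    next
      case False
      then have "(\<Sum>x\<in>orb. ?f x) = 0" using fixed by (intro sum.neutral) auto
      then show ?thesis by simp
    qed
  qed
  then have "p dvd (\<Sum>orb\<in>orbits G S ?\<phi>. \<Sum>x\<in>orb. ?f x)" by (rule dvd_sum)
  also have "\<dots> = (\<Sum>x\<in>S. ?f x)" by (rule A.disjoint_sum[OF S])
  also have "\<dots> = card {x \<in> S. \<exists>g\<in>carrier G. act g x \<noteq> x}"
    using S by (simp add: of_bool_def sum.If_cases Int_def)
  finally show ?thesis .
qed

text \<open>With trivial stabilizers every orbit has length \<open>order G\<close>. This is the
  counting step of Hall's theorem.\<close>

lemma free_action_order_dvd:
  fixes G (structure)
  assumes "group G" and S: "finite S"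
    and closed: "\<And>g x. g \<in> carrier G \<Longrightarrow> x \<in> S \<Longrightarrow> act g x \<in> S"
    and one: "\<And>x. x \<in> S \<Longrightarrow> act \<one>\<^bsub>G\<^esub> x = x"
    and mult: "\<And>g h x. g \<in> carrier G \<Longrightarrow> h \<in> carrier G \<Longrightarrow> x \<in> S \<Longrightarrow>
      act (g \<otimes>\<^bsub>G\<^esub> h) x = act g (act h x)"
    and free: "\<And>g x. g \<in> carrier G \<Longrightarrow> x \<in> S \<Longrightarrow> act g x = x \<Longrightarrow> g = \<one>\<^bsub>G\<^esub>"
  shows "order G dvd card S"
proof -
  interpret group G by fact
  let ?\<phi> = "\<lambda>g. \<lambda>x\<in>S. act g x"
  interpret A: group_action G S ?\<phi>
    by (rule group_action_restrict) (use closed one mult is_group in auto)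
  have "card orb = order G" if orb: "orb \<in> orbits G S ?\<phi>" for orb
  proof -
    obtain x where x: "x \<in> S" "orb = orbit G ?\<phi> x" using orb by (auto simp: orbits_def)
    have "stabilizer G ?\<phi> x = {\<one>}" using x free one by (auto simp: stabilizer_def)
    then show ?thesis using A.orbit_stabilizer_theorem[OF x(1)] x(2) by simp
  qed
  then have "order G dvd (\<Sum>x\<in>orb. 1)" if "orb \<in> orbits G S ?\<phi>" for orb
    using that by simp
  then have "order G dvd (\<Sum>orb\<in>orbits G S ?\<phi>. \<Sum>x\<in>orb. 1)" by (rule dvd_sum)
  also have "\<dots> = card S" using A.disjoint_sum[OF S, of "\<lambda>_. 1 :: nat"] by simp
  finally show ?thesis .
qed

lemma finite_p_group_dvd_order:
  fixes G (structure)
  assumes "finite_p_group p G" "carrier G \<noteq> {\<one>\<^bsub>G\<^esub>}"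
  shows "p dvd order G"
proof -
  interpret group G using assms by (simp add: finite_p_group_def)
  obtain n where n: "order G = p ^ n" using assms by (auto simp: finite_p_group_def)
  have "n \<noteq> 0"
  proof
    assume "n = 0"
    then obtain a where "carrier G = {a}" using n by (auto simp: order_def card_1_singleton_iff)
    then show False using assms(2) one_closed by auto
  qed
  then show ?thesis using n by simp
qed

text \<open>Class equation: the fixed points of conjugation are the central elements, their number
  is divisible by p, and \<open>\<one>\<close> is one of them.\<close>

lemma finite_p_group_center:
  fixes G (structure)
  assumes p: "Factorial_Ring.prime p" and G: "finite_p_group p G" and "carrier G \<noteq> {\<one>}"
  obtains z where "z \<in> carrier G" "z \<noteq> \<one>" "\<And>g. g \<in> carrier G \<Longrightarrow> g \<otimes> z = z \<otimes> g"
proof -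
  interpret group G using G by (simp add: finite_p_group_def)
  have fin: "finite (carrier G)" using G by (simp add: finite_p_group_def)
  let ?N = "{x \<in> carrier G. \<exists>g\<in>carrier G. g \<otimes> x \<otimes> inv g \<noteq> x}"
  have "p dvd card ?N"
    by (rule card_non_fixed_dvd[OF p G fin, of "\<lambda>g x. g \<otimes> x \<otimes> inv g"])
      (auto simp: m_assoc inv_mult_group)
  moreover have "p dvd card (carrier G)"
    using finite_p_group_dvd_order[OF G assms(3)] by (simp add: order_def)
  ultimately have "p dvd card (carrier G - ?N)"
    using fin by (simp add: card_Diff_subset dvd_diff_nat)
  moreover have "\<one> \<in> carrier G - ?N" by auto
  then have "card (carrier G - ?N) \<noteq> 0" using fin by (auto simp: card_eq_0_iff)
  ultimately have "card (carrier G - ?N) \<noteq> 1" using p by (auto simp: prime_gt_1_nat dest: dvd_imp_le)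
  then have "carrier G - ?N \<noteq> {\<one>}" by auto
  then obtain z where z: "z \<in> carrier G" "z \<notin> ?N" "z \<noteq> \<one>" using \<open>\<one> \<in> carrier G - ?N\<close> by blast
  have "g \<otimes> z = z \<otimes> g" if g: "g \<in> carrier G" for g
  proof -
    have "g \<otimes> z \<otimes> inv g = z" using z g by auto
    then have "g \<otimes> z \<otimes> inv g \<otimes> g = z \<otimes> g" by simp
    then show ?thesis using g z by (simp add: m_assoc)
  qed
  then show thesis using that z by blast
qed

text \<open>A nontrivial central element z has p-power order, and its last nontrivial power of the
  form z^(p^j) has order p.\<close>

lemma finite_p_group_central_order_p:
  fixes G (structure)
  assumes p: "Factorial_Ring.prime p" and G: "finite_p_group p G" and "carrier G \<noteq> {\<one>}"
  obtains z where "z \<in> carrier G" "z \<noteq> \<one>" "z [^] p = \<one>" "\<And>g. g \<in> carrier G \<Longrightarrow> g \<otimes> z = z \<otimes> g"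
proof -
  interpret group G using G by (simp add: finite_p_group_def)
  obtain z where z: "z \<in> carrier G" "z \<noteq> \<one>" "\<And>g. g \<in> carrier G \<Longrightarrow> g \<otimes> z = z \<otimes> g"
    using finite_p_group_center[OF assms] by blast
  obtain n where n: "order G = p ^ n" using G by (auto simp: finite_p_group_def)
  have ex: "z [^] (p ^ n) = \<one>" using pow_order_eq_1[OF z(1)] n by simp
  define k where "k = (LEAST k. z [^] (p ^ k) = \<one>)"
  have k: "z [^] (p ^ k) = \<one>" unfolding k_def by (rule LeastI[of _ n]) (rule ex)
  have "k \<noteq> 0" using k z by (cases k) auto
  then obtain j where j: "k = Suc j" by (cases k) auto
  have "z [^] (p ^ j) \<noteq> \<one>"
    using not_less_Least[of j "\<lambda>k. z [^] (p ^ k) = \<one>"] j unfolding k_def by auto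
  moreover have "(z [^] (p ^ j)) [^] p = \<one>"
    using k j z by (simp add: nat_pow_pow mult.commute)
  moreover have "g \<otimes> z [^] i = z [^] i \<otimes> g" if g: "g \<in> carrier G" for g and i :: nat
  proof (induction i)
    case (Suc i)
    have "g \<otimes> (z [^] i \<otimes> z) = (g \<otimes> z [^] i) \<otimes> z" using g z(1) by (simp add: m_assoc)
    also have "\<dots> = z [^] i \<otimes> (g \<otimes> z)" unfolding Suc using g z(1) by (simp add: m_assoc)
    also have "g \<otimes> z = z \<otimes> g" by (rule z(3)[OF g])
    finally show ?case using g z(1) by (simp add: m_assoc)
  qed (use g in simp)
  ultimately show thesis using that[of "z [^] (p ^ j)"] z(1) by blast
qed

text \<open>Modulo p the function is constant on the right cosets of the subgroup generated by x,
  and the common size of these cosets is a p-power greater than 1.\<close>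

lemma finite_p_group_invariant_sum:
  fixes Q (structure)
  assumes p: "Factorial_Ring.prime p" and Q: "finite_p_group p Q" and x: "x \<in> carrier Q" "x \<noteq> \<one>"
    and f: "\<And>c. c \<in> carrier Q \<Longrightarrow> [f (x \<otimes> c) = f c] (mod int p)"
  shows "[(\<Sum>c\<in>carrier Q. f c) = 0] (mod int p)"
proof -
  interpret group Q using Q by (simp add: finite_p_group_def)
  have fin: "finite (carrier Q)" using Q by (simp add: finite_p_group_def)
  define K where "K = generate Q {x}"
  have K: "subgroup K Q" unfolding K_def using x by (intro generate_is_subgroup) auto
  have finK: "finite K" using K fin subgroup.subset finite_subset by blast
  have "finite_p_group p (Q\<lparr>carrier := K\<rparr>)" by (rule finite_p_group_subgroup[OF p Q K])
  then obtain k where k: "card K = p ^ k" by (auto simp: finite_p_group_def order_def)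
  have "{\<one>, x} \<subseteq> K" unfolding K_def by (auto intro: generate.intros)
  then have "card {\<one>, x} \<le> card K" using finK by (rule card_mono[rotated])
  then have "k \<noteq> 0" using k x by (intro notI) simp
  then have dvd: "p dvd card K" using k by (simp add: dvd_power)
  have x_sub: "{x} \<subseteq> carrier Q" using x by simp
  have inv: "[f (a \<otimes> c) = f c] (mod int p)" if "a \<in> K" "c \<in> carrier Q" for a c
    using that(1) x_sub unfolding K_def
  proof (induction rule: generate_induct_left)
    case (mult s y)
    then have "y \<in> carrier Q" using x generate_in_carrier[of "{x}"] by auto
    then have "[f (x \<otimes> (y \<otimes> c)) = f (y \<otimes> c)] (mod int p)" using f that by simp
    then show ?case using mult x \<open>y \<in> carrier Q\<close> that by (auto simp: m_assoc intro: cong_trans)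
  next
    case (mult_inv s y)
    then have y: "y \<in> carrier Q" using x generate_in_carrier[of "{x}"] by auto
    have "[f (y \<otimes> c) = f (inv x \<otimes> y \<otimes> c)] (mod int p)"
      using f[of "inv x \<otimes> (y \<otimes> c)"] y that x by (simp add: m_assoc)
    then show ?case using mult_inv cong_trans[OF cong_sym] by auto
  qed (use x that in auto)
  have "[sum f R = 0] (mod int p)" if "R \<in> rcosets K" for R
  proof -
    obtain a where a: "a \<in> carrier Q" "R = K #> a" using \<open>R \<in> rcosets K\<close> by (auto simp: RCOSETS_def)
    have "[sum f R = (\<Sum>_\<in>R. f a)] (mod int p)"
      using inv a by (intro cong_sum) (auto simp: r_coset_def)
    moreover have "card R = card K" using card_rcosets_equal[OF that subgroup.subset[OF K]] by simp
    moreover have "[int (card K) * f a = 0] (mod int p)"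
      using dvd by (simp add: cong_0_iff)
    ultimately show ?thesis by (auto intro: cong_trans)
  qed
  then have "[(\<Sum>R\<in>rcosets K. sum f R) = (\<Sum>R\<in>rcosets K. 0)] (mod int p)"
    by (intro cong_sum)
  moreover have "sum f (\<Union> (rcosets K)) = (\<Sum>R\<in>rcosets K. sum f R)"
  proof (subst sum.Union_disjoint)
    show "\<forall>A\<in>rcosets K. finite A"
      using cosets_finite[OF _ subgroup.subset[OF K] fin] by blast
    show "\<forall>A\<in>rcosets K. \<forall>B\<in>rcosets K. A \<noteq> B \<longrightarrow> A \<inter> B = {}"
      using rcos_disjoint[OF K] by (auto simp: pairwise_def disjnt_def)
  qed simp
  ultimately show ?thesis using rcosets_part_G[OF K] by simp
qed

section \<open>The \<open>p\<close>-Frattini subgroup\<close>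

context group
begin

lemma derived_carrier_normal: "derived G (carrier G) \<lhd> G"
  by (rule derived_self_is_normal)

lemma powers_generate_subgroup: "subgroup (generate G {g [^] (p :: nat) | g. g \<in> carrier G}) G"
  by (intro generate_is_subgroup) auto

lemma subgroup_K_subgroup: "subgroup (K_subgroup p G) G"
  unfolding K_subgroup_def
  using mult_norm_subgroup[OF derived_carrier_normal powers_generate_subgroup] .

lemma power_in_K_subgroup:
  assumes "g \<in> carrier G"
  shows "g [^] p \<in> K_subgroup p G"
proof -
  have "g [^] p \<in> generate G {g [^] p | g. g \<in> carrier G}"
    using assms by (intro generate.incl) auto
  moreover have "\<one> \<in> derived G (carrier G)"
    using subgroup.one_closed[OF normal_imp_subgroup[OF derived_carrier_normal]] .
  moreover have "g [^] p = \<one> \<otimes> g [^] p" using assms by simp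
  ultimately show ?thesis unfolding K_subgroup_def set_mult_def by blast
qed

lemma commutator_in_K_subgroup:
  assumes "a \<in> carrier G" "b \<in> carrier G"
  shows "a \<otimes> b \<otimes> inv a \<otimes> inv b \<in> K_subgroup p G"
proof -
  have "a \<otimes> b \<otimes> inv a \<otimes> inv b \<in> derived G (carrier G)"
    using assms unfolding derived_def by (intro generate.incl) auto
  moreover have "\<one> \<in> generate G {g [^] p | g. g \<in> carrier G}" by (rule generate.one)
  moreover have "a \<otimes> b \<otimes> inv a \<otimes> inv b = (a \<otimes> b \<otimes> inv a \<otimes> inv b) \<otimes> \<one>" using assms by simp
  ultimately show ?thesis unfolding K_subgroup_def set_mult_def by blast
qed

lemma K_subgroup_least:
  assumes M: "subgroup M G" and pow: "\<And>g. g \<in> carrier G \<Longrightarrow> g [^] p \<in> M"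
    and comm: "\<And>a b. a \<in> carrier G \<Longrightarrow> b \<in> carrier G \<Longrightarrow> a \<otimes> b \<otimes> inv a \<otimes> inv b \<in> M"
  shows "K_subgroup p G \<subseteq> M"
proof -
  have "derived G (carrier G) \<subseteq> M"
    unfolding derived_def by (rule generate_subgroup_incl[OF _ M]) (use comm in auto)
  moreover have "generate G {g [^] p | g. g \<in> carrier G} \<subseteq> M"
    by (rule generate_subgroup_incl[OF _ M]) (use pow in auto)
  ultimately show ?thesis
    unfolding K_subgroup_def set_mult_def using subgroup.m_closed[OF M] by blast
qed

end

text \<open>\<open>K_subgroup\<close> is a verbal subgroup, so every homomorphism respects it. This
  yields its invariance under automorphisms as well as its compatibility with quotients.\<close>

lemma (in group_hom) K_subgroup_hom:
  assumes "x \<in> K_subgroup p G"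
  shows "h x \<in> K_subgroup p H"
proof -
  have "subgroup {x \<in> carrier G. h x \<in> K_subgroup p H} G"
    using subgroup.one_closed[OF H.subgroup_K_subgroup[of p]]
      subgroup.m_closed[OF H.subgroup_K_subgroup[of p]]
      subgroup.m_inv_closed[OF H.subgroup_K_subgroup[of p]]
    by (intro G.subgroupI) auto
  then have "K_subgroup p G \<subseteq> {x \<in> carrier G. h x \<in> K_subgroup p H}"
    using H.power_in_K_subgroup H.commutator_in_K_subgroup
    by (intro G.K_subgroup_least) (auto simp: hom_nat_pow)
  then show ?thesis using assms by blast
qed

text \<open>The Burnside basis theorem: \<open>M\<close> below is a maximal subgroup containing \<open>A\<close>. Fixed points
  of \<open>M\<close> on its own cosets show that \<open>M\<close> is properly contained in its normalizer, hence normal,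
  and then the quotient by \<open>M\<close> is generated by a central element of order \<open>p\<close>.\<close>

lemma K_subgroup_nongenerator:
  fixes G (structure)
  assumes p: "Factorial_Ring.prime p" and G: "finite_p_group p G" and A: "subgroup A G"
    and gen: "A <#> K_subgroup p G = carrier G"
  shows "A = carrier G"
proof (rule ccontr)
  assume "A \<noteq> carrier G"
  interpret group G using G by (simp add: finite_p_group_def)
  have fin: "finite (carrier G)" using G by (simp add: finite_p_group_def)
  define P where "P M \<longleftrightarrow> subgroup M G \<and> A \<subseteq> M \<and> M \<noteq> carrier G" for M
  have "finite {M. P M}"
    by (rule finite_subset[of _ "Pow (carrier G)"]) (use fin in \<open>auto simp: P_def dest: subgroup.subset\<close>)
  moreover have "{M. P M} \<noteq> {}" using A \<open>A \<noteq> carrier G\<close> by (auto simp: P_def)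
  ultimately obtain M where "P M" and max: "\<And>M'. P M' \<Longrightarrow> M \<subseteq> M' \<Longrightarrow> M = M'"
    using finite_has_maximal[of "{M. P M}"] by auto
  then have M: "subgroup M G" "A \<subseteq> M" "M \<noteq> carrier G" by (auto simp: P_def)
  have maximal: "M' = carrier G" if "subgroup M' G" "M \<subseteq> M'" "M' \<noteq> M" for M'
    using max[of M'] that M by (auto simp: P_def)
  interpret M: subgroup M G by (rule M(1))
  let ?GM = "G\<lparr>carrier := M\<rparr>"
  have GM: "finite_p_group p ?GM" by (rule finite_p_group_subgroup[OF p G M(1)])
  let ?X = "rcosets M"
  have finX: "finite ?X" using rcosets_finite fin by (simp add: RCOSETS_def)
  \<comment> \<open>Translating by \<open>inv g\<close> instead of g makes right translation of
    cosets a left action of M.\<close>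
  let ?N = "{C \<in> ?X. \<exists>g\<in>carrier ?GM. C #> inv g \<noteq> C}"
  have X_sub: "C \<subseteq> carrier G" if "C \<in> ?X" for C using that M.rcosets_carrier is_group by auto
  have "p dvd card ?N"
  proof (rule card_non_fixed_dvd[OF p GM finX])
    show "C #> inv g \<in> ?X" if g: "g \<in> carrier ?GM" and C: "C \<in> ?X" for g C
    proof -
      obtain a where "a \<in> carrier G" "C = M #> a" using C by (auto simp: RCOSETS_def)
      then show ?thesis using g by (auto simp: RCOSETS_def coset_mult_assoc M.subset)
    qed
    show "C #> inv \<one>\<^bsub>?GM\<^esub> = C" if "C \<in> ?X" for C using X_sub[OF that] by simp
    show "C #> inv (g \<otimes>\<^bsub>?GM\<^esub> h) = C #> inv h #> inv g"
      if "g \<in> carrier ?GM" "h \<in> carrier ?GM" "C \<in> ?X" for g h C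
      using that X_sub[OF that(3)] by (simp add: coset_mult_assoc inv_mult_group)
  qed
  moreover have "p dvd card ?X"
  proof -
    obtain n where n: "order G = p ^ n" using G by (auto simp: finite_p_group_def)
    have lag: "card ?X * card M = p ^ n" using lagrange[OF M(1)] n by simp
    then obtain i where i: "card ?X = p ^ i" using p by (metis divides_primepow_nat dvd_triv_left)
    have "i \<noteq> 0"
    proof
      assume "i = 0"
      then have "card M = card (carrier G)" using lag i n by (simp add: order_def)
      then show False using M(3) card_subset_eq[OF fin M.subset] by simp
    qed
    then show ?thesis using i by simp
  qed
  ultimately have "p dvd card (?X - ?N)" using finX by (simp add: card_Diff_subset dvd_diff_nat)
  \<comment> \<open>The coset M is one fixed point, so divisibility by p yields a second one, M a.
    Being fixed means that a normalizes M.\<close>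
  moreover have "M \<in> ?X - ?N"
    using M.subgroup_in_rcosets[OF is_group] coset_join2[OF _ M(1)] by auto
  then have "card (?X - ?N) \<noteq> 0" using finX by (auto simp: card_eq_0_iff)
  ultimately have "card (?X - ?N) \<noteq> 1" using p by (auto simp: prime_gt_1_nat dest: dvd_imp_le)
  then have "?X - ?N \<noteq> {M}" by auto
  then obtain C where C: "C \<in> ?X" "C \<notin> ?N" "C \<noteq> M" using \<open>M \<in> ?X - ?N\<close> by blast
  obtain a where a: "a \<in> carrier G" "C = M #> a" using C(1) by (auto simp: RCOSETS_def)
  have a_M: "a \<notin> M" using C(3) a coset_join2[OF _ M(1)] by auto
  have a_norm: "a \<otimes> g \<otimes> inv a \<in> M" if g: "g \<in> M" for g
  proof -
    have "\<forall>h\<in>M. C #> inv h = C" using C(1,2) by simp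
    then have "C #> inv (inv g) = C" using M.m_inv_closed[OF g] by (rule bspec)
    then have "M #> (a \<otimes> g) = M #> a" using a g by (simp add: coset_mult_assoc M.subset)
    then have "a \<otimes> g \<in> M #> a" using a g rcos_self[of "a \<otimes> g" M] M(1) by auto
    then show ?thesis using M.rcos_module_imp[OF is_group a(1)] by simp
  qed
  \<comment> \<open>The normalizer is defined by an equality of sets so that it is closed under
    inverses. Finiteness of M reduces this equality to an inclusion in \<open>L_iff\<close>.\<close>
  define L where "L = {b \<in> carrier G. (\<lambda>g. b \<otimes> g \<otimes> inv b) ` M = M}"
  have L_iff: "b \<in> L" if b: "b \<in> carrier G" "\<And>g. g \<in> M \<Longrightarrow> b \<otimes> g \<otimes> inv b \<in> M" for b
  proof -
    have "inj_on (\<lambda>g. b \<otimes> g \<otimes> inv b) M" using b by (intro inj_onI) simp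
    moreover have "(\<lambda>g. b \<otimes> g \<otimes> inv b) ` M \<subseteq> M" using b by auto
    ultimately have "(\<lambda>g. b \<otimes> g \<otimes> inv b) ` M = M"
      using endo_inj_surj finite_subset[OF M.subset fin] by blast
    then show ?thesis using b by (simp add: L_def)
  qed
  have L_D: "b \<otimes> g \<otimes> inv b \<in> M" "b \<in> carrier G" if "b \<in> L" "g \<in> M" for b g
    using that by (auto simp: L_def)
  have "subgroup L G"
  proof (rule subgroupI)
    show "L \<subseteq> carrier G" by (auto simp: L_def)
    show "L \<noteq> {}" using L_iff[of \<one>] by auto
    show "inv b \<in> L" if b: "b \<in> L" for b
    proof (rule L_iff)
      have bG: "b \<in> carrier G" using b by (simp add: L_def)
      then show "inv b \<in> carrier G" by simp
      fix g assume "g \<in> M"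
      then obtain g' where "g' \<in> M" "g = b \<otimes> g' \<otimes> inv b" using b by (auto simp: L_def)
      then show "inv b \<otimes> g \<otimes> inv (inv b) \<in> M" using bG by (simp add: m_assoc)
    qed
    show "b \<otimes> c \<in> L" if b: "b \<in> L" and c: "c \<in> L" for b c
    proof (rule L_iff)
      have bG: "b \<in> carrier G" "c \<in> carrier G" using b c by (simp_all add: L_def)
      then show "b \<otimes> c \<in> carrier G" by simp
      fix g assume g: "g \<in> M"
      have "b \<otimes> c \<otimes> g \<otimes> inv (b \<otimes> c) = b \<otimes> (c \<otimes> g \<otimes> inv c) \<otimes> inv b"
        using bG g by (simp add: m_assoc inv_mult_group)
      then show "b \<otimes> c \<otimes> g \<otimes> inv (b \<otimes> c) \<in> M" using L_D(1)[OF b L_D(1)[OF c g]] by simp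
    qed
  qed
  moreover have "M \<subseteq> L" using L_iff by auto
  moreover have "a \<in> L" using L_iff a a_norm by blast
  ultimately have "L = carrier G" using maximal[of L] a_M by auto
  then have "M \<lhd> G"
    using M(1) L_D by (intro normal_invI) auto
  then interpret MN: normal M G .
  interpret Q: group "G Mod M" by (rule MN.factorgroup_is_group)
  interpret q: group_hom G "G Mod M" "(#>) M"
    using MN.r_coset_hom_Mod by (simp add: group_hom_def group_hom_axioms_def is_group Q.is_group)
  have q_one: "M #> g = M \<longleftrightarrow> g \<in> M" if "g \<in> carrier G" for g
    using that coset_join2[OF _ M(1)] rcos_self[OF _ M(1)] by metis
  have "p_normal p M G"
  proof -
    obtain n where n: "order G = p ^ n" using G by (auto simp: finite_p_group_def)
    have "order (G Mod M) * card M = p ^ n" using lagrange[OF M(1)] n by (simp add: order_def FactGroup_def)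
    then have "\<exists>i. order (G Mod M) = p ^ i" using p by (metis divides_primepow_nat dvd_triv_left)
    then show ?thesis
      using finX MN.normal_axioms Q.is_group by (simp add: p_normal_def finite_p_group_def FactGroup_def)
  qed
  then have QP: "finite_p_group p (G Mod M)" by (rule p_normal_imp_finite_p_group)
  have "carrier (G Mod M) \<noteq> {\<one>\<^bsub>G Mod M\<^esub>}"
    using q_one M(3) M.subset by (auto simp: carrier_FactGroup)
  then obtain z where z: "z \<in> carrier (G Mod M)" "z \<noteq> \<one>\<^bsub>G Mod M\<^esub>" "z [^]\<^bsub>G Mod M\<^esub> p = \<one>\<^bsub>G Mod M\<^esub>"
    "\<And>g. g \<in> carrier (G Mod M) \<Longrightarrow> g \<otimes>\<^bsub>G Mod M\<^esub> z = z \<otimes>\<^bsub>G Mod M\<^esub> g"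
    using finite_p_group_central_order_p[OF p QP] by metis
  let ?Z = "generate (G Mod M) {z}"
  have subZ: "subgroup ?Z (G Mod M)" using z by (intro Q.generate_is_subgroup) simp
  have "subgroup {g \<in> carrier G. M #> g \<in> ?Z} G"
    using subgroup.one_closed[OF subZ] subgroup.m_closed[OF subZ] subgroup.m_inv_closed[OF subZ]
      q.hom_one q.hom_mult q.hom_inv
    by (intro subgroupI) (auto simp del: mult_FactGroup one_FactGroup)
  moreover have "M \<subseteq> {g \<in> carrier G. M #> g \<in> ?Z}"
    using coset_join2[OF _ M(1)] subgroup.one_closed[OF subZ] by auto
  moreover obtain b where b: "b \<in> carrier G" "z = M #> b" using z(1) by (auto simp: carrier_FactGroup)
  have "b \<in> {g \<in> carrier G. M #> g \<in> ?Z}" "b \<notin> M"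
    using b z(2) q_one by (auto intro: generate.incl)
  \<comment> \<open>The preimage of the subgroup generated by z properly contains M, so by
    maximality it is everything: the quotient by M is generated by z.\<close>
  ultimately have all: "{g \<in> carrier G. M #> g \<in> ?Z} = carrier G"
    by (intro maximal) auto
  have Z_pow: "\<exists>i::nat. x = z [^]\<^bsub>G Mod M\<^esub> i" if "x \<in> ?Z" for x
    using that Q.generate_pow_on_finite_carrier[OF _ z(1)] QP by (auto simp: finite_p_group_def)
  have coset_pow: "\<exists>i::nat. M #> g = z [^]\<^bsub>G Mod M\<^esub> i" if "g \<in> carrier G" for g
    using all that by (intro Z_pow) blast
  have "K_subgroup p G \<subseteq> M"
  proof (rule K_subgroup_least[OF M(1)])
    fix g assume g: "g \<in> carrier G"
    obtain i :: nat where i: "M #> g = z [^]\<^bsub>G Mod M\<^esub> i" using coset_pow[OF g] ..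
    have "M #> (g [^] p) = (M #> g) [^]\<^bsub>G Mod M\<^esub> p" using MN.FactGroup_pow[OF g] by simp
    also have "\<dots> = (z [^]\<^bsub>G Mod M\<^esub> p) [^]\<^bsub>G Mod M\<^esub> i"
      unfolding i using z(1) by (simp add: Q.nat_pow_pow mult.commute del: mult_FactGroup one_FactGroup)
    also have "\<dots> = \<one>\<^bsub>G Mod M\<^esub>" unfolding z(3) by (rule Q.nat_pow_one)
    finally show "g [^] p \<in> M" using q_one g by simp
  next
    fix g h assume g: "g \<in> carrier G" and h: "h \<in> carrier G"
    obtain i j :: nat where ij: "M #> g = z [^]\<^bsub>G Mod M\<^esub> i" "M #> h = z [^]\<^bsub>G Mod M\<^esub> j"
      using coset_pow[OF g] coset_pow[OF h] by metis
    have "(M #> g) \<otimes>\<^bsub>G Mod M\<^esub> (M #> h) = (M #> h) \<otimes>\<^bsub>G Mod M\<^esub> (M #> g)"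
      unfolding ij using z(1) by (simp add: Q.nat_pow_mult add.commute del: mult_FactGroup)
    then have "M #> (g \<otimes> h) = M #> (h \<otimes> g)" using q.hom_mult g h by simp
    then have "g \<otimes> h \<in> M #> (h \<otimes> g)" using rcos_self[of "g \<otimes> h" M] M(1) g h by simp
    then have "g \<otimes> h \<otimes> inv (h \<otimes> g) \<in> M" using M.rcos_module_imp[OF is_group, of "h \<otimes> g"] g h by simp
    then show "g \<otimes> h \<otimes> inv g \<otimes> inv h \<in> M" using g h by (simp add: inv_mult_group m_assoc)
  qed
  then have "A <#> K_subgroup p G \<subseteq> M"
    using M(2) unfolding set_mult_def by auto
  then show False using gen M(3) M.subset by auto
qed

section \<open>Automorphism groups\<close>

lemma carrier_AutoGroup [simp]: "carrier (AutoGroup G) = auto G"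
  and one_AutoGroup [simp]: "\<one>\<^bsub>AutoGroup G\<^esub> = (\<lambda>x\<in>carrier G. x)"
  by (simp_all add: AutoGroup_def BijGroup_def)

lemma mult_AutoGroup:
  "\<phi> \<in> auto G \<Longrightarrow> \<psi> \<in> auto G \<Longrightarrow> \<phi> \<otimes>\<^bsub>AutoGroup G\<^esub> \<psi> = compose (carrier G) \<phi> \<psi>"
  by (simp add: AutoGroup_def BijGroup_def auto_def)

lemma auto_eqI:
  "\<phi> \<in> auto G \<Longrightarrow> \<psi> \<in> auto G \<Longrightarrow> (\<And>x. x \<in> carrier G \<Longrightarrow> \<phi> x = \<psi> x) \<Longrightarrow> \<phi> = \<psi>"
  by (auto simp: auto_def Bij_def intro: extensionalityI)

lemma autoI:
  assumes "\<phi> \<in> hom G G" "\<psi> \<in> carrier G \<rightarrow> carrier G" "\<phi> \<in> extensional (carrier G)"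
    "\<And>x. x \<in> carrier G \<Longrightarrow> \<psi> (\<phi> x) = x" "\<And>x. x \<in> carrier G \<Longrightarrow> \<phi> (\<psi> x) = x"
  shows "\<phi> \<in> auto G"
proof -
  have "bij_betw \<phi> (carrier G) (carrier G)"
    by (rule bij_betw_byWitness[where f' = \<psi>]) (use assms in \<open>auto simp: hom_def Pi_iff\<close>)
  then show ?thesis using assms by (simp add: auto_def Bij_def)
qed

lemma finite_auto:
  assumes "finite (carrier G)"
  shows "finite (auto G)"
proof (rule finite_subset)
  show "auto G \<subseteq> carrier G \<rightarrow>\<^sub>E carrier G"
    by (auto simp: auto_def Bij_def hom_def PiE_def)
qed (use assms in \<open>intro finite_PiE\<close>)

context group
begin

lemma auto_closed: "\<phi> \<in> auto G \<Longrightarrow> x \<in> carrier G \<Longrightarrow> \<phi> x \<in> carrier G"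
  by (auto simp: auto_def hom_def Pi_iff)

lemma auto_group_hom: "\<phi> \<in> auto G \<Longrightarrow> group_hom G G \<phi>"
  by (simp add: auto_def group_hom_def group_hom_axioms_def is_group)

lemma auto_compose: "\<phi> \<in> auto G \<Longrightarrow> \<psi> \<in> auto G \<Longrightarrow> compose (carrier G) \<phi> \<psi> \<in> auto G"
  using group.is_monoid[OF AutoGroup] monoid.m_closed[of "AutoGroup G" \<phi> \<psi>]
  by (simp add: mult_AutoGroup)

lemma auto_inverse:
  assumes "\<phi> \<in> auto G"
  obtains \<psi> where "\<psi> \<in> auto G" "\<And>x. x \<in> carrier G \<Longrightarrow> \<psi> (\<phi> x) = x"
    "\<And>x. x \<in> carrier G \<Longrightarrow> \<phi> (\<psi> x) = x"
proof -
  interpret A: group "AutoGroup G" by (rule AutoGroup)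
  let ?\<psi> = "inv\<^bsub>AutoGroup G\<^esub> \<phi>"
  have \<psi>: "?\<psi> \<in> auto G" using A.inv_closed assms by simp
  have "compose (carrier G) ?\<psi> \<phi> = (\<lambda>x\<in>carrier G. x)" "compose (carrier G) \<phi> ?\<psi> = (\<lambda>x\<in>carrier G. x)"
    using A.l_inv[of \<phi>] A.r_inv[of \<phi>] assms \<psi> by (simp_all add: mult_AutoGroup)
  then have "?\<psi> (\<phi> x) = x" "\<phi> (?\<psi> x) = x" if "x \<in> carrier G" for x
    using that by (metis compose_eq restrict_apply')+
  then show thesis using that \<psi> by blast
qed

lemma characteristic_subgroupI:
  assumes "subgroup K G" "\<And>\<phi> k. \<phi> \<in> auto G \<Longrightarrow> k \<in> K \<Longrightarrow> \<phi> k \<in> K"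
  shows "characteristic_subgroup K G"
  unfolding characteristic_subgroup_def
proof (intro conjI ballI equalityI subsetI)
  fix \<phi> k assume \<phi>: "\<phi> \<in> auto G" and k: "k \<in> K"
  obtain \<psi> where \<psi>: "\<psi> \<in> auto G" "\<And>x. x \<in> carrier G \<Longrightarrow> \<phi> (\<psi> x) = x" using auto_inverse[OF \<phi>] by blast
  have "\<psi> k \<in> K" "\<phi> (\<psi> k) = k"
    using assms(2)[OF \<psi>(1) k] \<psi>(2)[OF subgroup.mem_carrier[OF assms(1) k]] by simp_all
  then show "k \<in> \<phi> ` K" by (metis imageI)
qed (use assms in auto)

definition inner :: "'a \<Rightarrow> 'a \<Rightarrow> 'a"
  where "inner g = (\<lambda>x\<in>carrier G. g \<otimes> x \<otimes> inv g)"

lemma inner_autos_eq: "inner_autos G = inner ` carrier G"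
  by (simp add: inner_autos_def inner_def[abs_def])

lemma inner_auto:
  assumes g: "g \<in> carrier G"
  shows "inner g \<in> auto G"
proof (rule autoI[where \<psi> = "inner (inv g)"])
  show "inner g \<in> hom G G" using g by (auto simp: inner_def hom_def m_assoc)
qed (use g in \<open>auto simp: inner_def m_assoc\<close>)

lemma inner_hom: "inner \<in> hom G (AutoGroup G)"
proof (rule homI)
  fix g h assume gh: "g \<in> carrier G" "h \<in> carrier G"
  show "inner (g \<otimes> h) = inner g \<otimes>\<^bsub>AutoGroup G\<^esub> inner h"
    unfolding mult_AutoGroup[OF inner_auto[OF gh(1)] inner_auto[OF gh(2)]]
    using gh by (auto simp: compose_def inner_def fun_eq_iff m_assoc inv_mult_group)
qed (simp add: inner_auto)

lemma inner_autos_normal: "inner_autos G \<lhd> AutoGroup G"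
proof -
  interpret A: group "AutoGroup G" by (rule AutoGroup)
  interpret i: group_hom G "AutoGroup G" inner
    using inner_hom is_group A.is_group by (simp add: group_hom_def group_hom_axioms_def)
  show ?thesis
  proof (rule A.normal_invI)
    show "subgroup (inner_autos G) (AutoGroup G)"
      unfolding inner_autos_eq by (rule i.img_is_subgroup)
    fix \<phi> \<alpha> assume \<phi>: "\<phi> \<in> carrier (AutoGroup G)" and "\<alpha> \<in> inner_autos G"
    then obtain g where g: "g \<in> carrier G" "\<alpha> = inner g" by (auto simp: inner_autos_eq)
    have \<phi>': "\<phi> \<in> auto G" using \<phi> by simp
    interpret \<phi>: group_hom G G \<phi> by (rule auto_group_hom[OF \<phi>'])
    have i: "inner (\<phi> g) \<in> carrier (AutoGroup G)"
      using inner_auto[OF \<phi>.hom_closed[OF g(1)]] by simp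
    have "\<phi> \<otimes>\<^bsub>AutoGroup G\<^esub> \<alpha> = inner (\<phi> g) \<otimes>\<^bsub>AutoGroup G\<^esub> \<phi>"
      unfolding g(2) mult_AutoGroup[OF \<phi>' inner_auto[OF g(1)]]
        mult_AutoGroup[OF inner_auto[OF \<phi>.hom_closed[OF g(1)]] \<phi>']
      using g(1) by (auto simp: compose_def inner_def fun_eq_iff)
    then have "\<phi> \<otimes>\<^bsub>AutoGroup G\<^esub> \<alpha> \<otimes>\<^bsub>AutoGroup G\<^esub> inv\<^bsub>AutoGroup G\<^esub> \<phi> = inner (\<phi> g)"
      by (simp only: A.m_assoc[OF i \<phi> A.inv_closed[OF \<phi>]] A.r_inv[OF \<phi>] A.r_one[OF i])
    then show "\<phi> \<otimes>\<^bsub>AutoGroup G\<^esub> \<alpha> \<otimes>\<^bsub>AutoGroup G\<^esub> inv\<^bsub>AutoGroup G\<^esub> \<phi> \<in> inner_autos G"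
      using g by (simp add: inner_autos_eq)
  qed
qed

lemma characteristic_normal:
  assumes "characteristic_subgroup K G"
  shows "K \<lhd> G"
proof (rule normal_invI)
  show K: "subgroup K G" using assms by (simp add: characteristic_subgroup_def)
  fix x k assume x: "x \<in> carrier G" and k: "k \<in> K"
  have "inner x k \<in> inner x ` K" using k by blast
  then have "inner x k \<in> K" using assms inner_auto[OF x] by (simp add: characteristic_subgroup_def)
  then show "x \<otimes> k \<otimes> inv x \<in> K" using subgroup.mem_carrier[OF K k] by (simp add: inner_def)
qed

lemma induced_auto_auto:
  assumes K: "characteristic_subgroup K G" and \<phi>: "\<phi> \<in> auto G"
  shows "induced_auto G K \<phi> \<in> auto (G Mod K)"
proof -
  interpret K: normal K G by (rule characteristic_normal[OF K])
  obtain \<psi> where \<psi>: "\<psi> \<in> auto G" "\<And>x. x \<in> carrier G \<Longrightarrow> \<psi> (\<phi> x) = x"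
    "\<And>x. x \<in> carrier G \<Longrightarrow> \<phi> (\<psi> x) = x" using auto_inverse[OF \<phi>] by blast
  note r = induced_auto_rcoset[OF K]
  show ?thesis
  proof (rule autoI[where \<psi> = "induced_auto G K \<psi>"])
    show "induced_auto G K \<phi> \<in> hom (G Mod K) (G Mod K)"
    proof (rule homI)
      fix A assume "A \<in> carrier (G Mod K)"
      then obtain a where a: "a \<in> carrier G" "A = K #> a" by (auto simp: carrier_FactGroup)
      then show "induced_auto G K \<phi> A \<in> carrier (G Mod K)"
        using r[OF \<phi>] auto_closed[OF \<phi>] by (simp add: carrier_FactGroup)
      fix B assume "B \<in> carrier (G Mod K)"
      then obtain b where b: "b \<in> carrier G" "B = K #> b" by (auto simp: carrier_FactGroup)
      show "induced_auto G K \<phi> (A \<otimes>\<^bsub>G Mod K\<^esub> B) = induced_auto G K \<phi> A \<otimes>\<^bsub>G Mod K\<^esub> induced_auto G K \<phi> B"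
        using a b r[OF \<phi>] auto_closed[OF \<phi>] group_hom.hom_mult[OF auto_group_hom[OF \<phi>]]
        by (simp add: K.rcos_sum)
    qed
    show "induced_auto G K \<phi> \<in> extensional (carrier (G Mod K))" by (simp add: induced_auto_def)
  qed (use r[OF \<phi>] r[OF \<psi>(1)] \<psi>(2,3) auto_closed[OF \<phi>] auto_closed[OF \<psi>(1)] in
      \<open>auto simp: carrier_FactGroup\<close>)
qed

lemma induced_auto_hom:
  assumes K: "characteristic_subgroup K G"
  shows "induced_auto G K \<in> hom (AutoGroup G) (AutoGroup (G Mod K))"
proof (rule homI)
  show "induced_auto G K \<phi> \<in> carrier (AutoGroup (G Mod K))" if "\<phi> \<in> carrier (AutoGroup G)" for \<phi>
    using induced_auto_auto[OF K] that by simp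
  fix \<phi> \<psi> assume "\<phi> \<in> carrier (AutoGroup G)" "\<psi> \<in> carrier (AutoGroup G)"
  then have \<phi>\<psi>: "\<phi> \<in> auto G" "\<psi> \<in> auto G" by simp_all
  interpret K: normal K G by (rule characteristic_normal[OF K])
  interpret Q: group "G Mod K" by (rule K.factorgroup_is_group)
  have "induced_auto G K (compose (carrier G) \<phi> \<psi>) =
    compose (carrier (G Mod K)) (induced_auto G K \<phi>) (induced_auto G K \<psi>)"
  proof (rule auto_eqI)
    show "induced_auto G K (compose (carrier G) \<phi> \<psi>) \<in> auto (G Mod K)"
      by (rule induced_auto_auto[OF K auto_compose[OF \<phi>\<psi>]])
    show "compose (carrier (G Mod K)) (induced_auto G K \<phi>) (induced_auto G K \<psi>) \<in> auto (G Mod K)"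
      by (rule Q.auto_compose) (use induced_auto_auto[OF K] \<phi>\<psi> in auto)
    fix C assume C: "C \<in> carrier (G Mod K)"
    then obtain g where g: "g \<in> carrier G" "C = K #> g" by (auto simp: carrier_FactGroup)
    show "induced_auto G K (compose (carrier G) \<phi> \<psi>) C =
        compose (carrier (G Mod K)) (induced_auto G K \<phi>) (induced_auto G K \<psi>) C"
      using C g induced_auto_rcoset[OF K] \<phi>\<psi> auto_compose[OF \<phi>\<psi>] auto_closed[OF \<phi>\<psi>(2)]
      by (simp add: compose_eq)
  qed
  then show "induced_auto G K (\<phi> \<otimes>\<^bsub>AutoGroup G\<^esub> \<psi>) =
      induced_auto G K \<phi> \<otimes>\<^bsub>AutoGroup (G Mod K)\<^esub> induced_auto G K \<psi>"
    using \<phi>\<psi> induced_auto_auto[OF K] by (simp add: mult_AutoGroup)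
qed

lemma induced_inner:
  assumes K: "characteristic_subgroup K G" and g: "g \<in> carrier G"
  shows "induced_auto G K (inner g) \<in> inner_autos (G Mod K)"
proof -
  interpret K: normal K G by (rule characteristic_normal[OF K])
  interpret Q: group "G Mod K" by (rule K.factorgroup_is_group)
  have Kg: "K #> g \<in> carrier (G Mod K)" using g by (auto simp: carrier_FactGroup)
  have "induced_auto G K (inner g) = Q.inner (K #> g)"
  proof (rule auto_eqI[OF induced_auto_auto[OF K inner_auto[OF g]] Q.inner_auto[OF Kg]])
    fix C assume C: "C \<in> carrier (G Mod K)"
    then obtain x where x: "x \<in> carrier G" "C = K #> x" by (auto simp: carrier_FactGroup)
    show "induced_auto G K (inner g) C = Q.inner (K #> g) C"
      using C g x Kg induced_auto_rcoset[OF K inner_auto[OF g]]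
      by (simp add: inner_def Q.inner_def K.rcos_sum K.inv_FactGroup K.rcos_inv)
  qed
  then show ?thesis using Kg by (simp add: Q.inner_autos_eq)
qed

section \<open>\<open>p\<close>-inner automorphism separability of finitely generated groups\<close>

text \<open>A homomorphism into the finite group G / N is determined by its values on a finite
  generating set, so there are only finitely many preimages of N under automorphisms of G. Their
  intersection is characteristic.\<close>

lemma characteristic_core:
  assumes p: "Factorial_Ring.prime p" and fg: "finitely_generated_group G" and N: "p_normal p N G"
  obtains K where "characteristic_subgroup K G" "p_normal p K G" "K \<subseteq> N"
proof -
  obtain S where S: "finite S" "S \<subseteq> carrier G" "generate G S = carrier G"
    using fg by (auto simp: finitely_generated_group_def)
  interpret N: normal N G using N by (rule p_normal_imp_normal)
  interpret Q: group "G Mod N" by (rule N.factorgroup_is_group)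
  interpret q: group_hom G "G Mod N" "(#>) N"
    using N.r_coset_hom_Mod by (simp add: group_hom_def group_hom_axioms_def is_group Q.is_group)
  have q_one: "N #> g = N \<longleftrightarrow> g \<in> N" if "g \<in> carrier G" for g
    using that coset_join2[OF _ N.subgroup_axioms] rcos_self[OF _ N.subgroup_axioms] by metis
  define D where "D \<phi> = {g \<in> carrier G. \<phi> g \<in> N}" for \<phi>
  define r where "r \<phi> = (\<lambda>s\<in>S. N #> \<phi> s)" for \<phi>
  have "r ` auto G \<subseteq> S \<rightarrow>\<^sub>E carrier (G Mod N)"
    using S auto_closed by (auto simp: r_def carrier_FactGroup)
  moreover have "finite (carrier (G Mod N))"
    using p_normal_imp_finite_p_group[OF N] by (simp add: finite_p_group_def)
  ultimately have fin: "finite (r ` auto G)"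
    using S(1) finite_subset finite_PiE by metis
  have D_eq: "D \<phi> = D \<psi>" if "\<phi> \<in> auto G" "\<psi> \<in> auto G" "r \<phi> = r \<psi>" for \<phi> \<psi>
  proof -
    have hom: "(\<lambda>g. N #> \<theta> g) \<in> hom G (G Mod N)" if "\<theta> \<in> auto G" for \<theta>
    proof -
      interpret \<theta>: group_hom G G \<theta> by (rule auto_group_hom[OF that])
      show ?thesis
        by (rule homI) (simp_all add: \<theta>.hom_mult q.hom_mult q.hom_closed del: mult_FactGroup)
    qed
    have "N #> \<phi> g = N #> \<psi> g" if g: "g \<in> carrier G" for g
    proof -
      have "N #> \<phi> s = N #> \<psi> s" if "s \<in> S" for s
        using fun_cong[OF \<open>r \<phi> = r \<psi>\<close>, of s] that by (simp add: r_def)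
      then show ?thesis
        using hom_eq_on_generate[OF Q.is_group hom hom S(2), of \<phi> \<psi> g] \<open>\<phi> \<in> auto G\<close> \<open>\<psi> \<in> auto G\<close> S(3) g
        by simp
    qed
    then have "\<phi> g \<in> N \<longleftrightarrow> \<psi> g \<in> N" if "g \<in> carrier G" for g
      using q_one[OF auto_closed[OF \<open>\<phi> \<in> auto G\<close> that]] q_one[OF auto_closed[OF \<open>\<psi> \<in> auto G\<close> that]]
        that by simp
    then show ?thesis by (auto simp: D_def)
  qed
  \<comment> \<open>One automorphism is selected for each value of r, so D takes at most as many
    values as r does.\<close>
  have "D ` auto G \<subseteq> (\<lambda>f. D (SOME \<phi>. \<phi> \<in> auto G \<and> r \<phi> = f)) ` r ` auto G"
  proof clarify
    fix \<phi> assume \<phi>: "\<phi> \<in> auto G"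
    let ?\<psi> = "SOME \<psi>. \<psi> \<in> auto G \<and> r \<psi> = r \<phi>"
    have "?\<psi> \<in> auto G \<and> r ?\<psi> = r \<phi>" by (rule someI[of _ \<phi>]) (use \<phi> in simp)
    then have "D \<phi> = D ?\<psi>" using D_eq[OF \<phi>, of ?\<psi>] by simp
    then show "D \<phi> \<in> (\<lambda>f. D (SOME \<phi>. \<phi> \<in> auto G \<and> r \<phi> = f)) ` r ` auto G" using \<phi> by blast
  qed
  then have "finite (D ` auto G)" using fin finite_surj by blast
  moreover have "p_normal p A G" if "A \<in> D ` auto G" for A
    using that p_normal_vimage[OF p is_group N] by (auto simp: D_def auto_def)
  ultimately have pK: "p_normal p (carrier G \<inter> (\<Inter>A\<in>D ` auto G. A)) G" (is "p_normal p ?K G")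
    using p is_group by (intro p_normal_INT)
  have "characteristic_subgroup ?K G"
  proof (rule characteristic_subgroupI)
    show "subgroup ?K G" using pK p_normal_imp_normal normal_imp_subgroup by blast
    fix \<phi> k assume \<phi>: "\<phi> \<in> auto G" and k: "k \<in> ?K"
    have "\<phi> k \<in> D \<psi>" if \<psi>: "\<psi> \<in> auto G" for \<psi>
    proof -
      have "k \<in> D (compose (carrier G) \<psi> \<phi>)" using k auto_compose[OF \<psi> \<phi>] by blast
      then show ?thesis using auto_closed[OF \<phi>] by (auto simp: D_def compose_eq)
    qed
    then show "\<phi> k \<in> ?K" using auto_closed[OF \<phi>] k by auto
  qed
  moreover have "?K \<subseteq> N"
  proof
    fix k assume "k \<in> ?K"
    then have "k \<in> D (\<lambda>x\<in>carrier G. x)" using id_in_auto by blast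
    then show "k \<in> N" by (auto simp: D_def)
  qed
  ultimately show thesis using that pK by blast
qed

text \<open>The inner premise is the failure of separation expressed by elements: w conjugates a to
  \<phi> a modulo N. It is available for every N of p-power index because each such N contains a
  characteristic one.\<close>

lemma p_inner_automorphism_separableI:
  assumes p: "Factorial_Ring.prime p" and fg: "finitely_generated_group G"
    and inner: "\<And>\<phi>. \<phi> \<in> auto G \<Longrightarrow>
      (\<And>N. p_normal p N G \<Longrightarrow> \<exists>w\<in>carrier G. \<forall>a\<in>carrier G. \<exists>n\<in>N. \<phi> a \<otimes> w = w \<otimes> a \<otimes> n) \<Longrightarrow>
      \<phi> \<in> inner_autos G"
  shows "p_inner_automorphism_separable p G"
  unfolding p_inner_automorphism_separable_def
proof (intro ballI, rule ccontr)
  fix \<phi> assume \<phi>: "\<phi> \<in> auto G - inner_autos G"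
    and none: "\<nexists>K. characteristic_subgroup K G \<and> finite_p_group p (G Mod K) \<and>
      induced_auto G K \<phi> \<notin> inner_autos (G Mod K)"
  have "\<exists>w\<in>carrier G. \<forall>a\<in>carrier G. \<exists>n\<in>N. \<phi> a \<otimes> w = w \<otimes> a \<otimes> n" if N: "p_normal p N G" for N
  proof -
    obtain K where K: "characteristic_subgroup K G" "p_normal p K G" "K \<subseteq> N"
      using characteristic_core[OF p fg N] by blast
    interpret K: normal K G using K(2) by (rule p_normal_imp_normal)
    interpret Q: group "G Mod K" by (rule K.factorgroup_is_group)
    have "induced_auto G K \<phi> \<in> inner_autos (G Mod K)"
      using none K p_normal_imp_finite_p_group[OF K(2)] by blast
    then obtain w where w: "w \<in> carrier G" "induced_auto G K \<phi> = Q.inner (K #> w)"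
      by (auto simp: Q.inner_autos_eq carrier_FactGroup)
    have "\<exists>n\<in>N. \<phi> a \<otimes> w = w \<otimes> a \<otimes> n" if a: "a \<in> carrier G" for a
    proof -
      have \<phi>a: "\<phi> a \<in> carrier G" using auto_closed \<phi> a by simp
      have Ka: "K #> a \<in> carrier (G Mod K)" using a by (auto simp: carrier_FactGroup)
      have "K #> \<phi> a = induced_auto G K \<phi> (K #> a)"
        using induced_auto_rcoset[OF K(1)] \<phi> a by simp
      also have "\<dots> = K #> (w \<otimes> a \<otimes> inv w)"
        unfolding w(2) using w(1) a Ka
        by (simp add: Q.inner_def K.rcos_sum K.inv_FactGroup K.rcos_inv carrier_FactGroup)
      finally have "\<phi> a \<in> K #> (w \<otimes> a \<otimes> inv w)"
        using rcos_self[OF \<phi>a K.subgroup_axioms] by simp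
      then obtain k where k: "k \<in> K" "\<phi> a = k \<otimes> (w \<otimes> a \<otimes> inv w)" by (auto simp: r_coset_def)
      have kG: "k \<in> carrier G" using k by simp
      \<comment> \<open>Normality of K moves the error term from the left end of the product to the
        right end.\<close>
      have "\<phi> a \<otimes> w = w \<otimes> a \<otimes> (inv (w \<otimes> a) \<otimes> k \<otimes> (w \<otimes> a))"
        unfolding k(2) using kG w(1) a by (simp add: m_assoc inv_mult_group)
      moreover have "inv (w \<otimes> a) \<otimes> k \<otimes> (w \<otimes> a) \<in> N"
        using K.inv_op_closed1[OF _ k(1), of "w \<otimes> a"] w(1) a K(3) by auto
      ultimately show ?thesis by blast
    qed
    then show ?thesis using w(1) by blast
  qed
  then show False using inner[of \<phi>] \<phi> by blast
qed

section \<open>The group \<open>Aut\<^sub>p\<close>\<close>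

lemma characteristic_K_subgroup: "characteristic_subgroup (K_subgroup p G) G"
  using subgroup_K_subgroup group_hom.K_subgroup_hom[OF auto_group_hom]
  by (intro characteristic_subgroupI)

lemma auto_p_iff:
  "\<phi> \<in> auto_p p G \<longleftrightarrow> \<phi> \<in> auto G \<and> (\<forall>g\<in>carrier G. \<phi> g \<in> K_subgroup p G #> g)"
proof (cases "\<phi> \<in> auto G")
  case True
  let ?K = "K_subgroup p G"
  note K = characteristic_K_subgroup[of p]
  have sub: "subgroup ?K G" by (rule subgroup_K_subgroup)
  have "induced_auto G ?K \<phi> = (\<lambda>C\<in>carrier (G Mod ?K). C) \<longleftrightarrow>
      (\<forall>C\<in>carrier (G Mod ?K). induced_auto G ?K \<phi> C = C)"
    by (auto simp: induced_auto_def fun_eq_iff)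
  also have "\<dots> \<longleftrightarrow> (\<forall>g\<in>carrier G. ?K #> \<phi> g = ?K #> g)"
    using induced_auto_rcoset[OF K True] by (auto simp: carrier_FactGroup)
  also have "\<dots> \<longleftrightarrow> (\<forall>g\<in>carrier G. \<phi> g \<in> ?K #> g)"
    using rcos_self[OF auto_closed[OF True] sub] repr_independence[OF _ _ sub] by blast
  finally show ?thesis using True by (simp add: auto_p_def kernel_def)
qed (simp add: auto_p_def kernel_def)

lemma auto_p_normal: "auto_p p G \<lhd> AutoGroup G"
proof -
  interpret K: normal "K_subgroup p G" G by (rule characteristic_normal[OF characteristic_K_subgroup])
  interpret Q: group "G Mod K_subgroup p G" by (rule K.factorgroup_is_group)
  show ?thesis
    unfolding auto_p_def
    by (rule group_hom.normal_kernel)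
      (simp add: group_hom_def group_hom_axioms_def AutoGroup Q.AutoGroup
        induced_auto_hom[OF characteristic_K_subgroup])
qed

text \<open>Conjugation by g multiplies x by the commutator of g and x.\<close>

lemma inner_autos_auto_p: "inner_autos G \<subseteq> auto_p p G"
proof
  fix \<phi> assume "\<phi> \<in> inner_autos G"
  then obtain g where g: "g \<in> carrier G" "\<phi> = inner g" by (auto simp: inner_autos_eq)
  have "inner g x \<in> K_subgroup p G #> x" if x: "x \<in> carrier G" for x
  proof -
    have "inner g x = (g \<otimes> x \<otimes> inv g \<otimes> inv x) \<otimes> x" using g x by (simp add: inner_def m_assoc)
    then show ?thesis
      using rcosI[OF commutator_in_K_subgroup[OF g(1) x] subgroup.subset[OF subgroup_K_subgroup] x]
      by simp
  qed
  then show "\<phi> \<in> auto_p p G" using g inner_auto by (simp add: auto_p_iff)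
qed

end

text \<open>Hall's theorem: the kernel of \<open>Aut P \<rightarrow> Aut (P / K\<^sub>p)\<close> acts freely on the families that
  represent all cosets of \<open>K\<^sub>p\<close>, since these generate \<open>P\<close>.\<close>

lemma finite_p_group_auto_p:
  fixes P (structure)
  assumes p: "Factorial_Ring.prime p" and P: "finite_p_group p P"
  shows "finite_p_group p ((AutoGroup P)\<lparr>carrier := auto_p p P\<rparr>)"
proof -
  interpret group P using P by (simp add: finite_p_group_def)
  have fin: "finite (carrier P)" using P by (simp add: finite_p_group_def)
  let ?K = "K_subgroup p P" and ?D = "(AutoGroup P)\<lparr>carrier := auto_p p P\<rparr>"
  interpret K: normal ?K P by (rule characteristic_normal[OF characteristic_K_subgroup])
  have D: "group ?D"
    using group.subgroup_imp_group[OF AutoGroup normal_imp_subgroup[OF auto_p_normal]] .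
  have D_auto: "\<phi> \<in> auto P" if "\<phi> \<in> auto_p p P" for \<phi> using that by (simp add: auto_p_iff)
  have "auto_p p P \<subseteq> auto P" using D_auto by blast
  then have finD: "finite (carrier ?D)"
    using finite_auto[OF fin] by (simp add: finite_subset)
  \<comment> \<open>A point of ?S picks a representative of the coset of s for every s in P. The
    number of these families is a power of \<open>card ?K\<close>, hence of p, and so is the order
    of any group that acts freely on them.\<close>
  let ?S = "\<Pi>\<^sub>E s\<in>carrier P. ?K #> s"
  have finS: "finite ?S"
    using fin finite_subset[OF r_coset_subset_G[OF K.subset] fin] by (intro finite_PiE)
  have S_carrier: "t s \<in> carrier P" if "t \<in> ?S" "s \<in> carrier P" for t s
    using PiE_mem[OF that] r_coset_subset_G[OF K.subset that(2)] by (rule rev_subsetD)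
  have "order ?D dvd card ?S"
  proof (rule free_action_order_dvd[OF D finS, where act = "\<lambda>\<phi> t. \<lambda>s\<in>carrier P. \<phi> (t s)"])
    fix \<phi> t assume \<phi>: "\<phi> \<in> carrier ?D" and t: "t \<in> ?S"
    show "(\<lambda>s\<in>carrier P. \<phi> (t s)) \<in> ?S"
    proof (rule PiE_I)
      fix s assume s: "s \<in> carrier P"
      have "t s \<in> ?K #> s" by (rule PiE_mem[OF t s])
      then have "?K #> s = ?K #> t s" by (rule repr_independence[OF _ s K.subgroup_axioms])
      moreover have "\<phi> (t s) \<in> ?K #> t s" using \<phi> S_carrier[OF t s] by (simp add: auto_p_iff)
      ultimately show "(\<lambda>s\<in>carrier P. \<phi> (t s)) s \<in> ?K #> s" using s by simp
    qed simp
    assume eq: "(\<lambda>s\<in>carrier P. \<phi> (t s)) = t"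
    have \<phi>': "\<phi> \<in> auto P" using \<phi> D_auto by simp
    interpret \<phi>: group_hom P P \<phi> by (rule auto_group_hom[OF \<phi>'])
    \<comment> \<open>An automorphism that fixes the family fixes a representative of every coset.
      Its fixed subgroup times \<open>?K\<close> is therefore P, and the nongenerator property makes
      it all of P.\<close>
    let ?A = "{x \<in> carrier P. \<phi> x = x}"
    have A: "subgroup ?A P" by (rule subgroupI) auto
    have "?A <#> ?K = carrier P"
    proof
      show "?A <#> ?K \<subseteq> carrier P" using K.subset by (auto simp: set_mult_def)
      show "carrier P \<subseteq> ?A <#> ?K"
      proof
        fix g assume g: "g \<in> carrier P"
        have "t g \<in> ?K #> g" by (rule PiE_mem[OF t g])
        then obtain k where k: "k \<in> ?K" "t g = k \<otimes> g" by (auto simp: r_coset_def)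
        have kP: "k \<in> carrier P" using k by simp
        have "t g \<in> ?A" using fun_cong[OF eq, of g] g S_carrier[OF t g] by simp
        moreover have "g = t g \<otimes> (inv g \<otimes> inv k \<otimes> g)"
          unfolding k(2) using kP g by (simp add: m_assoc)
        moreover have "inv g \<otimes> inv k \<otimes> g \<in> ?K" using K.inv_op_closed1[OF g, of "inv k"] k by simp
        ultimately show "g \<in> ?A <#> ?K" unfolding set_mult_def by blast
      qed
    qed
    then have "?A = carrier P" by (rule K_subgroup_nongenerator[OF p P A])
    then have "\<phi> x = x" if "x \<in> carrier P" for x using that by (metis (mono_tags, lifting) mem_Collect_eq)
    then show "\<phi> = \<one>\<^bsub>?D\<^esub>"
      using auto_eqI[OF \<phi>' id_in_auto] by simp
  next
    fix t assume t: "t \<in> ?S"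
    then show "(\<lambda>s\<in>carrier P. \<one>\<^bsub>?D\<^esub> (t s)) = t"
      using S_carrier[OF t] by (auto simp: fun_eq_iff PiE_iff extensional_def)
  next
    fix \<phi> \<psi> t assume "\<phi> \<in> carrier ?D" "\<psi> \<in> carrier ?D" and t: "t \<in> ?S"
    then show "(\<lambda>s\<in>carrier P. (\<phi> \<otimes>\<^bsub>?D\<^esub> \<psi>) (t s)) =
        (\<lambda>s\<in>carrier P. \<phi> ((\<lambda>s\<in>carrier P. \<psi> (t s)) s))"
      using S_carrier[OF t] D_auto by (auto simp: mult_AutoGroup compose_eq fun_eq_iff)
  qed
  moreover have "\<exists>i. card ?S = p ^ i"
  proof -
    have "finite_p_group p (P\<lparr>carrier := ?K\<rparr>)"
      by (rule finite_p_group_subgroup[OF p P K.subgroup_axioms])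
    then obtain i where "card ?K = p ^ i" by (auto simp: finite_p_group_def order_def)
    moreover have "card (?K #> s) = card ?K" if "s \<in> carrier P" for s
      using card_rcosets_equal[OF rcosetsI[OF K.subset that] K.subset] by simp
    ultimately have "card ?S = (p ^ i) ^ card (carrier P)"
      using fin by (simp add: card_PiE)
    then show ?thesis by (metis power_mult)
  qed
  ultimately have "\<exists>i. order ?D = p ^ i" using p by (metis divides_primepow_nat)
  then show ?thesis using D finD by (simp add: finite_p_group_def)
qed

section \<open>Residual properties of outer automorphism groups\<close>

lemma finite_p_group_FactGroup:
  assumes p: "Factorial_Ring.prime p" and D: "finite_p_group p D" and J: "J \<lhd> D"
  shows "finite_p_group p (D Mod J)"
proof -
  interpret J: normal J D by (rule J)
  obtain n where n: "order D = p ^ n" "finite (carrier D)" using D by (auto simp: finite_p_group_def)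
  have "card (rcosets\<^bsub>D\<^esub> J) dvd p ^ n"
    using J.lagrange[OF J.subgroup_axioms] n by (metis dvd_triv_left)
  then have "\<exists>i. card (rcosets\<^bsub>D\<^esub> J) = p ^ i" using p by (meson divides_primepow_nat)
  moreover have "finite (rcosets\<^bsub>D\<^esub> J)" using n by (simp add: RCOSETS_def)
  ultimately show ?thesis
    using J.factorgroup_is_group by (simp add: finite_p_group_def FactGroup_def order_def)
qed

context group
begin

lemma inner_autos_normal_auto_p: "inner_autos G \<lhd> (AutoGroup G)\<lparr>carrier := auto_p p G\<rparr>"
  by (rule group.normal_restrict_supergroup[OF AutoGroup normal_imp_subgroup[OF auto_p_normal]
        inner_autos_normal inner_autos_auto_p])

lemma induced_auto_p:
  assumes K: "characteristic_subgroup K G" and \<phi>: "\<phi> \<in> auto_p p G"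
  shows "induced_auto G K \<phi> \<in> auto_p p (G Mod K)"
proof -
  interpret K: normal K G by (rule characteristic_normal[OF K])
  interpret Q: group "G Mod K" by (rule K.factorgroup_is_group)
  interpret q: group_hom G "G Mod K" "(#>) K"
    using K.r_coset_hom_Mod by (simp add: group_hom_def group_hom_axioms_def is_group Q.is_group)
  have \<phi>': "\<phi> \<in> auto G" "\<And>g. g \<in> carrier G \<Longrightarrow> \<phi> g \<in> K_subgroup p G #> g"
    using \<phi> by (auto simp: auto_p_iff)
  show ?thesis
    unfolding Q.auto_p_iff
  proof (intro conjI ballI)
    show "induced_auto G K \<phi> \<in> auto (G Mod K)" by (rule induced_auto_auto[OF K \<phi>'(1)])
    fix C assume "C \<in> carrier (G Mod K)"
    then obtain g where g: "g \<in> carrier G" "C = K #> g" by (auto simp: carrier_FactGroup)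
    obtain k where k: "k \<in> K_subgroup p G" "\<phi> g = k \<otimes> g"
      using \<phi>'(2)[OF g(1)] by (auto simp: r_coset_def)
    have kG: "k \<in> carrier G" using k(1) subgroup.mem_carrier[OF subgroup_K_subgroup] by blast
    have "induced_auto G K \<phi> C = (K #> k) \<otimes>\<^bsub>G Mod K\<^esub> C"
      using induced_auto_rcoset[OF K \<phi>'(1) g(1)] k(2) g(2) q.hom_mult[OF kG g(1)] by simp
    then show "induced_auto G K \<phi> C \<in> K_subgroup p (G Mod K) #>\<^bsub>G Mod K\<^esub> C"
      using q.K_subgroup_hom[OF k(1)] unfolding r_coset_def by auto
  qed
qed

text \<open>A nontrivial class is represented by a noninner automorphism, which stays noninner on
  some quotient G / K. The class therefore survives in the corresponding group for G / K, which is a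
  finite p-group by Hall's theorem.\<close>

lemma residually_p_finite_OutpGroup:
  assumes p: "Factorial_Ring.prime p" and sep: "p_inner_automorphism_separable p G"
  shows "residually_p_finite p (OutpGroup p G)"
  unfolding residually_p_finite_def
proof
  let ?A = "(AutoGroup G)\<lparr>carrier := auto_p p G\<rparr>"
  interpret I: normal "inner_autos G" ?A by (rule inner_autos_normal_auto_p)
  interpret O: group "OutpGroup p G" unfolding OutpGroup_def by (rule I.factorgroup_is_group)
  fix C assume C: "C \<in> carrier (OutpGroup p G) - {\<one>\<^bsub>OutpGroup p G\<^esub>}"
  then obtain \<phi> where \<phi>: "\<phi> \<in> auto_p p G" "C = inner_autos G #>\<^bsub>?A\<^esub> \<phi>"
    by (auto simp: OutpGroup_def carrier_FactGroup)
  have "\<phi> \<notin> inner_autos G"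
  proof
    assume "\<phi> \<in> inner_autos G"
    then have "C = inner_autos G" using I.rcos_const[OF I.is_group] \<phi>(2) by simp
    then show False using C by (simp add: OutpGroup_def)
  qed
  moreover have "\<phi> \<in> auto G" using \<phi>(1) by (simp add: auto_p_iff)
  ultimately obtain K where K: "characteristic_subgroup K G" "finite_p_group p (G Mod K)"
    "induced_auto G K \<phi> \<notin> inner_autos (G Mod K)"
    using sep by (auto simp: p_inner_automorphism_separable_def)
  interpret P: group "G Mod K" using K(2) by (simp add: finite_p_group_def)
  let ?D = "(AutoGroup (G Mod K))\<lparr>carrier := auto_p p (G Mod K)\<rparr>" and ?J = "inner_autos (G Mod K)"
  interpret J: normal ?J ?D by (rule P.inner_autos_normal_auto_p)
  have DJ: "finite_p_group p (?D Mod ?J)"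
    by (rule finite_p_group_FactGroup[OF p finite_p_group_auto_p[OF p K(2)] J.normal_axioms])
  let ?h = "\<lambda>\<psi>. ?J #>\<^bsub>?D\<^esub> induced_auto G K \<psi>"
  have ind: "induced_auto G K \<in> hom ?A ?D"
  proof (rule homI)
    show "induced_auto G K \<psi> \<in> carrier ?D" if "\<psi> \<in> carrier ?A" for \<psi>
      using induced_auto_p[OF K(1)] that by simp
    show "induced_auto G K (\<psi> \<otimes>\<^bsub>?A\<^esub> \<theta>) = induced_auto G K \<psi> \<otimes>\<^bsub>?D\<^esub> induced_auto G K \<theta>"
      if "\<psi> \<in> carrier ?A" "\<theta> \<in> carrier ?A" for \<psi> \<theta>
      using hom_mult[OF induced_auto_hom[OF K(1)], of \<psi> \<theta>] that by (simp add: auto_p_iff)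
  qed
  have "?h \<in> hom ?A (?D Mod ?J)"
    using Group.hom_compose[OF ind J.r_coset_hom_Mod] by (simp add: o_def)
  then interpret h: group_hom ?A "?D Mod ?J" ?h
    using J.factorgroup_is_group by (simp add: group_hom_def group_hom_axioms_def I.is_group)
  have h_one: "?h \<psi> = ?J \<longleftrightarrow> induced_auto G K \<psi> \<in> ?J" if "\<psi> \<in> auto_p p G" for \<psi>
    using J.coset_join2[OF _ J.subgroup_axioms, of "induced_auto G K \<psi>"]
      J.rcos_self[OF _ J.subgroup_axioms, of "induced_auto G K \<psi>"] induced_auto_p[OF K(1) that] by auto
  have ker: "inner_autos G \<subseteq> kernel ?A (?D Mod ?J) ?h"
  proof
    fix \<psi> assume \<psi>: "\<psi> \<in> inner_autos G"
    then have "\<psi> \<in> auto_p p G" using inner_autos_auto_p by blast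
    moreover have "induced_auto G K \<psi> \<in> ?J" using \<psi> induced_inner[OF K(1)] by (auto simp: inner_autos_eq)
    ultimately show "\<psi> \<in> kernel ?A (?D Mod ?J) ?h" using h_one by (simp add: kernel_def)
  qed
  show "\<exists>N. N \<lhd> OutpGroup p G \<and> finite_p_group p (OutpGroup p G Mod N) \<and> C \<notin> N"
  proof (rule h.FactGroup_universal_kernel[OF I.normal_axioms ker])
    fix f assume f: "f \<in> hom (?A Mod inner_autos G) (?D Mod ?J)"
      "\<And>\<psi>. \<psi> \<in> carrier ?A \<Longrightarrow> f (inner_autos G #>\<^bsub>?A\<^esub> \<psi>) = ?h \<psi>"
    let ?N = "kernel (OutpGroup p G) (?D Mod ?J) f"
    have "p_normal p ?N (OutpGroup p G)"
      by (rule p_normal_kernel[OF p O.is_group DJ]) (use f(1) in \<open>simp add: OutpGroup_def\<close>)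
    moreover have "C \<notin> ?N"
      using f(2)[of \<phi>] \<phi> h_one[OF \<phi>(1)] K(3) by (auto simp: kernel_def)
    ultimately show ?thesis unfolding p_normal_def by blast
  qed
qed

text \<open>Induction on the generators: adding a generator s enlarges the group by a factor of at
  most p, because only the powers of s below p occur.\<close>

lemma finite_generate_exponent:
  assumes "comm_group G" "p > 0" "finite S" "S \<subseteq> carrier G" "\<And>g. g \<in> carrier G \<Longrightarrow> g [^] (p :: nat) = \<one>"
  shows "finite (generate G S)"
  using assms(3,4)
proof (induction S)
  case empty
  then show ?case by (simp add: generate_empty)
next
  case (insert s S)
  interpret comm_group G by fact
  have s: "s \<in> carrier G" and S: "S \<subseteq> carrier G" using insert by auto
  define T where "T = (\<lambda>(i, y). s [^] i \<otimes> y) ` ({..<p} \<times> generate G S)"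
  have T: "s [^] (i :: nat) \<otimes> y \<in> T" if y: "y \<in> generate G S" for i y
  proof -
    have "s [^] i = (s [^] p) [^] (i div p) \<otimes> s [^] (i mod p)"
      using s by (simp add: nat_pow_pow nat_pow_mult)
    also have "\<dots> = s [^] (i mod p)"
      unfolding assms(5)[OF s] using s by simp
    finally show ?thesis
      unfolding T_def using y assms(2) by (intro image_eqI[of _ _ "(i mod p, y)"]) auto
  qed
  \<comment> \<open>Writing the inverse as a nonnegative power keeps all exponents natural
    numbers.\<close>
  have inv_s: "inv s = s [^] (p - 1)"
  proof (rule inv_equality)
    have "s [^] (p - 1) \<otimes> s = s [^] Suc (p - 1)" by simp
    then show "s [^] (p - 1) \<otimes> s = \<one>" using assms(2,5) s by simp
  qed (use s in auto)
  have "generate G (insert s S) \<subseteq> T"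
  proof
    fix x assume "x \<in> generate G (insert s S)"
    from this insert.prems show "x \<in> T"
    proof (induction rule: generate_induct_left)
      case one
      show ?case using T[of \<one> 0] by (simp add: generate.one)
    next
      case (mult a x)
      then obtain i y where iy: "y \<in> generate G S" "x = s [^] (i :: nat) \<otimes> y" by (auto simp: T_def)
      have c: "y \<in> carrier G" using iy S generate_in_carrier by blast
      show ?case
      proof (cases "a = s")
        case True
        then have "a \<otimes> x = s [^] Suc i \<otimes> y" using iy c s by (simp add: m_ac)
        then show ?thesis using T iy by metis
      next
        case False
        then have a: "a \<in> S" "a \<in> carrier G" using mult S by auto
        have "a \<otimes> x = s [^] i \<otimes> (a \<otimes> y)" using iy c s a by (simp add: m_ac)
        then show ?thesis using T[of "a \<otimes> y" i] generate.eng[OF generate.incl[OF a(1)] iy(1)] by simp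
      qed
    next
      case (mult_inv a x)
      then obtain i y where iy: "y \<in> generate G S" "x = s [^] (i :: nat) \<otimes> y" by (auto simp: T_def)
      have c: "y \<in> carrier G" using iy S generate_in_carrier by blast
      show ?case
      proof (cases "a = s")
        case True
        have "s [^] (p - 1 + i) = s [^] (p - 1) \<otimes> s [^] i" by (rule nat_pow_mult[OF s, symmetric])
        then have "inv a \<otimes> x = s [^] (p - 1 + i) \<otimes> y"
          using True iy c s inv_s by (simp add: m_assoc)
        then show ?thesis using T iy by metis
      next
        case False
        then have a: "a \<in> S" "a \<in> carrier G" using mult_inv S by auto
        have "inv a \<otimes> x = s [^] i \<otimes> (inv a \<otimes> y)" using iy c s a by (simp add: m_ac)
        then show ?thesis using T[of "inv a \<otimes> y" i] generate.eng[OF generate.inv[OF a(1)] iy(1)] by simp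
      qed
    qed
  qed
  moreover have "finite T" unfolding T_def using insert by auto
  ultimately show ?case by (rule finite_subset)
qed

text \<open>Powers and commutators die in the quotient, so it is a finitely generated abelian group
  of exponent dividing p.\<close>

lemma finite_FactGroup_K_subgroup:
  assumes p: "p > 0" and fg: "finitely_generated_group G"
  shows "finite (carrier (G Mod K_subgroup p G))"
proof -
  let ?K = "K_subgroup p G"
  interpret K: normal ?K G by (rule characteristic_normal[OF characteristic_K_subgroup])
  interpret Q: group "G Mod ?K" by (rule K.factorgroup_is_group)
  interpret q: group_hom G "G Mod ?K" "(#>) ?K"
    using K.r_coset_hom_Mod by (simp add: group_hom_def group_hom_axioms_def is_group Q.is_group)
  obtain S where S: "finite S" "S \<subseteq> carrier G" "generate G S = carrier G"
    using fg by (auto simp: finitely_generated_group_def)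
  have "comm_group (G Mod ?K)"
  proof (rule Q.group_comm_groupI)
    fix A B assume "A \<in> carrier (G Mod ?K)" "B \<in> carrier (G Mod ?K)"
    then obtain a b where ab: "a \<in> carrier G" "A = ?K #> a" "b \<in> carrier G" "B = ?K #> b"
      by (auto simp: carrier_FactGroup)
    have "a \<otimes> b = (a \<otimes> b \<otimes> inv a \<otimes> inv b) \<otimes> (b \<otimes> a)" using ab by (simp add: m_assoc)
    then have "a \<otimes> b \<in> ?K #> (b \<otimes> a)"
      using rcosI[OF commutator_in_K_subgroup[OF ab(1,3)] K.subset, of "b \<otimes> a"] ab by simp
    then have "?K #> (b \<otimes> a) = ?K #> (a \<otimes> b)"
      using ab by (intro repr_independence[OF _ _ K.subgroup_axioms]) simp_all
    then show "A \<otimes>\<^bsub>G Mod ?K\<^esub> B = B \<otimes>\<^bsub>G Mod ?K\<^esub> A"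
      unfolding ab(2,4) mult_FactGroup K.rcos_sum[OF ab(1,3)] K.rcos_sum[OF ab(3,1)] by (rule HOL.sym)
  qed
  moreover have "C [^]\<^bsub>G Mod ?K\<^esub> p = \<one>\<^bsub>G Mod ?K\<^esub>" if "C \<in> carrier (G Mod ?K)" for C
  proof -
    obtain a where a: "a \<in> carrier G" "C = ?K #> a" using \<open>C \<in> _\<close> by (auto simp: carrier_FactGroup)
    have "C [^]\<^bsub>G Mod ?K\<^esub> p = ?K #> (a [^] p)" using K.FactGroup_pow[OF a(1)] a(2) by simp
    also have "\<dots> = ?K" by (rule K.rcos_const[OF is_group power_in_K_subgroup[OF a(1)]])
    finally show ?thesis by simp
  qed
  moreover have "finite ((#>) ?K ` S)" "(#>) ?K ` S \<subseteq> carrier (G Mod ?K)"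
    using S by (auto simp: carrier_FactGroup)
  ultimately have "finite (generate (G Mod ?K) ((#>) ?K ` S))"
    using p by (intro Q.finite_generate_exponent)
  also have "generate (G Mod ?K) ((#>) ?K ` S) = (#>) ?K ` generate G S"
    by (rule q.generate_img[OF S(2)])
  also have "\<dots> = carrier (G Mod ?K)" unfolding S(3) by (simp add: carrier_FactGroup)
  finally show ?thesis .
qed

text \<open>The coset of an outer automorphism modulo \<open>carrier (OutpGroup p G)\<close> depends
  only on the automorphism that a representative induces on the finite group
  \<open>G Mod K_subgroup p G\<close>, and there are only finitely many of those.\<close>

lemma virtually_residually_p_finite_OutGroup:
  assumes p: "p > 0" and fg: "finitely_generated_group G"
    and res: "residually_p_finite p (OutpGroup p G)"
  shows "virtually_residually_p_finite p (OutGroup G)"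
proof -
  let ?I = "inner_autos G" and ?A = "AutoGroup G" and ?K = "K_subgroup p G"
  interpret A: group ?A by (rule AutoGroup)
  interpret I: normal ?I ?A by (rule inner_autos_normal)
  interpret O: group "OutGroup G" unfolding OutGroup_def by (rule I.factorgroup_is_group)
  interpret q: group_hom ?A "OutGroup G" "(#>\<^bsub>?A\<^esub>) ?I"
    using I.r_coset_hom_Mod O.is_group A.is_group
    by (simp add: group_hom_def group_hom_axioms_def OutGroup_def)
  let ?H = "carrier (OutpGroup p G)"
  have H_eq: "?H = (#>\<^bsub>?A\<^esub>) ?I ` auto_p p G"
    by (simp add: OutpGroup_def carrier_FactGroup)
  have H: "subgroup ?H (OutGroup G)"
    unfolding H_eq by (rule q.subgroup_img_is_subgroup[OF normal_imp_subgroup[OF auto_p_normal]])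
  \<comment> \<open>Both groups multiply cosets as sets, so restricting the carrier of
    \<open>OutGroup G\<close> gives literally \<open>OutpGroup p G\<close>.\<close>
  have eq: "(OutGroup G)\<lparr>carrier := ?H\<rparr> = OutpGroup p G"
    by (simp add: OutGroup_def OutpGroup_def FactGroup_def RCOSETS_def fun_eq_iff set_mult_def)
  interpret K: normal ?K G by (rule characteristic_normal[OF characteristic_K_subgroup])
  interpret Q: group "G Mod ?K" by (rule K.factorgroup_is_group)
  let ?ind = "induced_auto G ?K"
  interpret ind: group_hom ?A "AutoGroup (G Mod ?K)" ?ind
    using induced_auto_hom[OF characteristic_K_subgroup] A.is_group Q.AutoGroup
    by (simp add: group_hom_def group_hom_axioms_def)
  have "?ind ` carrier ?A \<subseteq> auto (G Mod ?K)"
    using ind.hom_closed by auto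
  then have fin: "finite (?ind ` carrier ?A)"
    using finite_auto[OF finite_FactGroup_K_subgroup[OF p fg]] by (rule finite_subset)
  define F where "F \<phi> = ?H #>\<^bsub>OutGroup G\<^esub> (?I #>\<^bsub>?A\<^esub> \<phi>)" for \<phi>
  have F_eq: "F \<phi> = F \<psi>" if \<phi>: "\<phi> \<in> carrier ?A" and \<psi>: "\<psi> \<in> carrier ?A" and e: "?ind \<phi> = ?ind \<psi>" for \<phi> \<psi>
  proof -
    let ?\<theta> = "\<phi> \<otimes>\<^bsub>?A\<^esub> inv\<^bsub>?A\<^esub> \<psi>"
    have \<theta>: "?\<theta> \<in> carrier ?A" using A.m_closed[OF \<phi> A.inv_closed[OF \<psi>]] .
    have "?ind ?\<theta> = \<one>\<^bsub>AutoGroup (G Mod ?K)\<^esub>"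
      unfolding ind.hom_mult[OF \<phi> A.inv_closed[OF \<psi>]] ind.hom_inv[OF \<psi>] e
      by (rule ind.H.r_inv[OF ind.hom_closed[OF \<psi>]])
    then have "?\<theta> \<in> auto_p p G" unfolding auto_p_def kernel_def using \<theta> by blast
    then have "?I #>\<^bsub>?A\<^esub> ?\<theta> \<in> ?H" unfolding H_eq by blast
    moreover have "?\<theta> \<otimes>\<^bsub>?A\<^esub> \<psi> = \<phi>"
      using A.m_assoc[OF \<phi> A.inv_closed[OF \<psi>] \<psi>] A.l_inv[OF \<psi>] A.r_one[OF \<phi>] by simp
    then have "?I #>\<^bsub>?A\<^esub> \<phi> = (?I #>\<^bsub>?A\<^esub> ?\<theta>) \<otimes>\<^bsub>OutGroup G\<^esub> (?I #>\<^bsub>?A\<^esub> \<psi>)"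
      using q.hom_mult[OF \<theta> \<psi>] by simp
    ultimately have "?I #>\<^bsub>?A\<^esub> \<phi> \<in> ?H #>\<^bsub>OutGroup G\<^esub> (?I #>\<^bsub>?A\<^esub> \<psi>)"
      using O.rcosI[OF _ subgroup.subset[OF H] q.hom_closed[OF \<psi>]] by simp
    then show ?thesis
      unfolding F_def using O.repr_independence[OF _ q.hom_closed[OF \<psi>] H] by simp
  qed
  have "rcosets\<^bsub>OutGroup G\<^esub> ?H = F ` carrier ?A"
    by (auto simp: RCOSETS_def F_def OutGroup_def carrier_FactGroup)
  also have "\<dots> \<subseteq> (\<lambda>f. F (SOME \<phi>. \<phi> \<in> carrier ?A \<and> ?ind \<phi> = f)) ` ?ind ` carrier ?A"
  proof (rule image_subsetI)
    fix \<phi> assume \<phi>: "\<phi> \<in> carrier ?A"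
    let ?\<psi> = "SOME \<psi>. \<psi> \<in> carrier ?A \<and> ?ind \<psi> = ?ind \<phi>"
    have "?\<psi> \<in> carrier ?A \<and> ?ind ?\<psi> = ?ind \<phi>" by (rule someI[of _ \<phi>]) (use \<phi> in simp)
    then have "F \<phi> = F ?\<psi>" using F_eq[OF \<phi>, of ?\<psi>] by simp
    then show "F \<phi> \<in> (\<lambda>f. F (SOME \<phi>. \<phi> \<in> carrier ?A \<and> ?ind \<phi> = f)) ` ?ind ` carrier ?A"
      using \<phi> by blast
  qed
  finally have "finite (rcosets\<^bsub>OutGroup G\<^esub> ?H)" using fin finite_surj by blast
  then show ?thesis
    unfolding virtually_residually_p_finite_def using H res
    by (intro exI[of _ ?H] conjI) (simp_all only: eq)
qed

end

section \<open>Subgroups modulo normal subgroups, and an abstract form of graph products\<close>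

lemma set_multI: "a \<in> A \<Longrightarrow> b \<in> B \<Longrightarrow> a \<otimes>\<^bsub>G\<^esub> b \<in> A <#>\<^bsub>G\<^esub> B"
  by (auto simp: set_mult_def)

lemma (in group) subgroup_set_mult_normal:
  assumes "subgroup A G" "N \<lhd> G"
  shows "subgroup (A <#> N) G"
  using mult_norm_subgroup[OF assms(2,1)] commut_normal[OF assms] by simp

lemma (in group) set_mult_normalI:
  assumes "subgroup A G" "N \<lhd> G"
  shows "A \<subseteq> A <#> N" "N \<subseteq> A <#> N"
proof -
  interpret A: subgroup A G by fact
  interpret N: normal N G by fact
  have "a = a \<otimes> \<one>" if "a \<in> A" for a using that by simp
  then show "A \<subseteq> A <#> N" unfolding set_mult_def using N.one_closed by blast
  have "n = \<one> \<otimes> n" if "n \<in> N" for n using that by simp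
  then show "N \<subseteq> A <#> N" unfolding set_mult_def using A.one_closed by blast
qed

lemma (in group) subgroup_mult_mem_iff:
  assumes "subgroup A G" "a \<in> A" "x \<in> carrier G"
  shows "a \<otimes> x \<in> A \<longleftrightarrow> x \<in> A" "x \<otimes> a \<in> A \<longleftrightarrow> x \<in> A"
proof -
  interpret A: subgroup A G by fact
  have a: "a \<in> carrier G" "inv a \<in> A" using assms(2) A.mem_carrier by auto
  have "x \<in> A" if "a \<otimes> x \<in> A"
    using A.m_closed[OF a(2) that] a assms(3) by simp
  moreover have "x \<in> A" if "x \<otimes> a \<in> A"
    using A.m_closed[OF that a(2)] a assms(3) by (simp add: m_assoc)
  ultimately show "a \<otimes> x \<in> A \<longleftrightarrow> x \<in> A" "x \<otimes> a \<in> A \<longleftrightarrow> x \<in> A"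
    using assms(2) by (blast intro: A.m_closed)+
qed

text \<open>In \<open>twist\<close>, E is a crossed homomorphism with integer values read modulo p;
  as a function of c it is defined on W / N. It is zero on all vertex groups except
  \<open>H v\<close>, where it is the coboundary of the indicator of U, and the invariance of U
  under the link of v makes these prescriptions compatible. N' plays the role of the kernel of the
  finite p-quotient that carries both W / N and E; it contains every vertex element of N.\<close>

locale twistable_product = group W for W :: "('w, 'c) monoid_scheme" (structure) +
  fixes p :: nat and V :: "'v set" and adj :: "'v \<Rightarrow> 'v \<Rightarrow> bool" and H :: "'v \<Rightarrow> 'w set"
  assumes prime_p: "Factorial_Ring.prime p"
    and finite_V: "finite V"
    and adj_irrefl: "\<not> adj v v"
    and adj_sym: "adj u v \<Longrightarrow> adj v u"
    and no_central: "v \<in> V \<Longrightarrow> \<exists>u \<in> V. u \<noteq> v \<and> \<not> adj u v"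
    and subgroup_H: "v \<in> V \<Longrightarrow> subgroup (H v) W"
    and commute: "u \<in> V \<Longrightarrow> v \<in> V \<Longrightarrow> adj u v \<Longrightarrow> x \<in> H u \<Longrightarrow> y \<in> H v \<Longrightarrow> x \<otimes> y = y \<otimes> x"
    and generate_H: "generate W (\<Union>v\<in>V. H v) = carrier W"
    and H_nontrivial: "v \<in> V \<Longrightarrow> \<exists>x \<in> H v. x \<noteq> \<one>"
    and H_residual: "v \<in> V \<Longrightarrow> x \<in> H v \<Longrightarrow> x \<noteq> \<one> \<Longrightarrow> \<exists>N. p_normal p N W \<and> x \<notin> N"
    and retraction_exists: "A \<subseteq> V \<Longrightarrow>
      \<exists>f \<in> hom W W. (\<forall>v\<in>A. \<forall>x\<in>H v. f x = x) \<and> (\<forall>v\<in>V - A. \<forall>x\<in>H v. f x = \<one>)"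
    and twist: "\<lbrakk>v \<in> V; p_normal p N W; U \<subseteq> carrier W;
      \<And>n c. n \<in> N \<Longrightarrow> c \<in> carrier W \<Longrightarrow> n \<otimes> c \<in> U \<longleftrightarrow> c \<in> U;
      \<And>u l c. u \<in> V \<Longrightarrow> adj u v \<Longrightarrow> l \<in> H u \<Longrightarrow> c \<in> carrier W \<Longrightarrow> l \<otimes> c \<in> U \<longleftrightarrow> c \<in> U\<rbrakk> \<Longrightarrow>
      \<exists>N' E. p_normal p N' W \<and> N' \<subseteq> N \<and> (\<forall>u\<in>V. N \<inter> H u \<subseteq> N') \<and>
        (\<forall>a\<in>carrier W. \<forall>b\<in>carrier W. \<forall>c\<in>carrier W.
          [E (a \<otimes> b) c = E b c + E a (b \<otimes> c)] (mod int p)) \<and>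
        (\<forall>u\<in>V - {v}. \<forall>x\<in>H u. \<forall>c\<in>carrier W. [E x c = 0] (mod int p)) \<and>
        (\<forall>x\<in>H v. \<forall>c\<in>carrier W. [E x c = of_bool (x \<otimes> c \<in> U) - of_bool (c \<in> U)] (mod int p)) \<and>
        (\<forall>n\<in>N'. \<forall>c\<in>carrier W. [E n c = 0] (mod int p)) \<and>
        (\<forall>n\<in>N. \<forall>a\<in>carrier W. \<forall>c\<in>carrier W. E a (n \<otimes> c) = E a c)"
begin

section \<open>Parabolic subgroups and their retractions\<close>

definition parabolic :: "'v set \<Rightarrow> 'w set"
  where "parabolic A = generate W (\<Union>v\<in>A. H v)"

definition retr :: "'v set \<Rightarrow> 'w \<Rightarrow> 'w"
  where "retr A = (SOME f. f \<in> hom W W \<and> (\<forall>v\<in>A. \<forall>x\<in>H v. f x = x) \<and>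
    (\<forall>v\<in>V - A. \<forall>x\<in>H v. f x = \<one>))"

definition link :: "'v \<Rightarrow> 'v set"
  where "link v = {u \<in> V. adj u v}"

definition star :: "'v \<Rightarrow> 'v set"
  where "star v = insert v (link v)"

lemma link_subset: "link v \<subseteq> V - {v}" and star_subset: "v \<in> V \<Longrightarrow> star v \<subseteq> V"
  using adj_irrefl by (auto simp: link_def star_def)

lemma H_carrier: "v \<in> V \<Longrightarrow> x \<in> H v \<Longrightarrow> x \<in> carrier W"
  by (rule subgroup.mem_carrier[OF subgroup_H])

lemma H_subset: "A \<subseteq> V \<Longrightarrow> (\<Union>v\<in>A. H v) \<subseteq> carrier W"
  using H_carrier by blast

lemma subgroup_parabolic: "A \<subseteq> V \<Longrightarrow> subgroup (parabolic A) W"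
  unfolding parabolic_def by (intro generate_is_subgroup H_subset)

lemma parabolic_carrier: "A \<subseteq> V \<Longrightarrow> x \<in> parabolic A \<Longrightarrow> x \<in> carrier W"
  by (rule subgroup.mem_carrier[OF subgroup_parabolic])

lemma parabolic_mono: "A \<subseteq> B \<Longrightarrow> parabolic A \<subseteq> parabolic B"
  unfolding parabolic_def by (intro mono_generate) auto

lemma H_parabolic: "v \<in> A \<Longrightarrow> H v \<subseteq> parabolic A"
  unfolding parabolic_def by (auto intro: generate.incl)

lemma parabolic_V [simp]: "parabolic V = carrier W"
  by (simp add: parabolic_def generate_H)

lemma parabolic_empty [simp]: "parabolic {} = {\<one>}"
  by (simp add: parabolic_def generate_empty)

text \<open>Each vertex group contains the inverses of its elements, so the inverse case is absorbed
  by \<open>mult\<close>.\<close>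

lemma parabolic_induct [consumes 2, case_names one mult]:
  assumes "x \<in> parabolic A" "A \<subseteq> V"
    and "P \<one>"
    and "\<And>v s y. v \<in> A \<Longrightarrow> s \<in> H v \<Longrightarrow> y \<in> parabolic A \<Longrightarrow> P y \<Longrightarrow> P (s \<otimes> y)"
  shows "P x"
  using assms(1) H_subset[OF assms(2)] unfolding parabolic_def
proof (induction rule: generate_induct_left)
  case (mult_inv s y)
  then obtain v where v: "v \<in> A" "s \<in> H v" by auto
  then have "inv s \<in> H v"
    using assms(2) subgroup.m_inv_closed[OF subgroup_H[of v]] by auto
  then show ?case using assms(4) v mult_inv by (simp add: parabolic_def)
qed (use assms in \<open>auto simp: parabolic_def\<close>)

lemma retr:
  assumes "A \<subseteq> V"
  shows retr_hom: "retr A \<in> hom W W"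
    and retr_H: "v \<in> A \<Longrightarrow> x \<in> H v \<Longrightarrow> retr A x = x"
    and retr_H_trivial: "v \<in> V \<Longrightarrow> v \<notin> A \<Longrightarrow> x \<in> H v \<Longrightarrow> retr A x = \<one>"
proof -
  define P where "P f \<longleftrightarrow> f \<in> hom W W \<and> (\<forall>v\<in>A. \<forall>x\<in>H v. f x = x) \<and>
    (\<forall>v\<in>V - A. \<forall>x\<in>H v. f x = \<one>)" for f
  have "\<exists>f. P f"
    using retraction_exists[OF assms] by (auto simp: P_def)
  then have "P (retr A)"
    unfolding retr_def P_def[symmetric] by (rule someI_ex)
  then show "retr A \<in> hom W W"
    "v \<in> A \<Longrightarrow> x \<in> H v \<Longrightarrow> retr A x = x"
    "v \<in> V \<Longrightarrow> v \<notin> A \<Longrightarrow> x \<in> H v \<Longrightarrow> retr A x = \<one>" by (auto simp: P_def)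
qed

lemma retr_group_hom: "A \<subseteq> V \<Longrightarrow> group_hom W W (retr A)"
  by (simp add: group_hom_def group_hom_axioms_def retr_hom is_group)

lemma retr_carrier: "A \<subseteq> V \<Longrightarrow> x \<in> carrier W \<Longrightarrow> retr A x \<in> carrier W"
  by (rule hom_in_carrier[OF retr_hom])

lemma retr_mult:
  "A \<subseteq> V \<Longrightarrow> x \<in> carrier W \<Longrightarrow> y \<in> carrier W \<Longrightarrow> retr A (x \<otimes> y) = retr A x \<otimes> retr A y"
  by (rule hom_mult[OF retr_hom])

lemma retr_one: "A \<subseteq> V \<Longrightarrow> retr A \<one> = \<one>"
  by (rule group_hom.hom_one[OF retr_group_hom])

lemma retr_parabolic:
  assumes "A \<subseteq> V" "B \<subseteq> V" "x \<in> parabolic A"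
  shows "retr B x \<in> parabolic (A \<inter> B)"
  using assms(3,1)
proof (induction rule: parabolic_induct)
  case one
  then show ?case using assms(2) by (simp add: retr_one parabolic_def generate.one)
next
  case (mult v s y)
  interpret P: subgroup "parabolic (A \<inter> B)" W using assms by (intro subgroup_parabolic) auto
  have "retr B s \<in> parabolic (A \<inter> B)"
  proof (cases "v \<in> B")
    case True
    then show ?thesis using retr_H[of B v s] mult(1,2) assms(2) H_parabolic[of v "A \<inter> B"] by auto
  next
    case False
    then show ?thesis using retr_H_trivial[of B v s] mult(1,2) assms(1,2) by auto
  qed
  then show ?case
    using mult assms(1,2) H_carrier[of v s] parabolic_carrier[of A y] by (simp add: retr_mult subsetD)
qed

lemma retr_range: "A \<subseteq> V \<Longrightarrow> x \<in> carrier W \<Longrightarrow> retr A x \<in> parabolic A"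
  using retr_parabolic[of V A x] by (simp add: Int_absorb1)

lemma retr_id:
  assumes "A \<subseteq> B" "B \<subseteq> V" "x \<in> parabolic A"
  shows "retr B x = x"
proof -
  have "A \<subseteq> V" using assms by auto
  from assms(3) this show ?thesis
  proof (induction rule: parabolic_induct)
    case (mult v s y)
    then show ?case
      using assms(1,2) retr_H[of B v s] H_carrier[of v s] parabolic_carrier[of A y]
      by (simp add: retr_mult subsetD)
  qed (use assms(2) in \<open>simp add: retr_one\<close>)
qed

lemma retr_trivial:
  assumes "A \<subseteq> V" "B \<subseteq> V" "A \<inter> B = {}" "x \<in> parabolic A"
  shows "retr B x = \<one>"
  using retr_parabolic[OF assms(1,2,4)] assms(3) by simp

text \<open>Both sides agree on the vertex groups. As a consequence, the intersection of the
  preimages of N under all retractions is mapped into itself by each of them.\<close>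

lemma retr_retr:
  assumes "A \<subseteq> V" "B \<subseteq> V" "x \<in> carrier W"
  shows "retr B (retr A x) = retr (A \<inter> B) x"
proof -
  have "x \<in> parabolic V" "V \<subseteq> V" using assms by auto
  then show ?thesis
  proof (induction rule: parabolic_induct)
    case one
    then show ?case using assms(1,2) by (simp add: retr_one le_infI1)
  next
    case (mult v s y)
    have sub: "A \<inter> B \<subseteq> V" using assms by auto
    have "retr B (retr A s) = retr (A \<inter> B) s"
    proof (cases "v \<in> A")
      case True
      then show ?thesis
        using mult assms sub retr_H[of A v s] retr_H[of B v s] retr_H[of "A \<inter> B" v s]
          retr_H_trivial[of B v s] retr_H_trivial[of "A \<inter> B" v s]
        by (cases "v \<in> B") auto
    next
      case False
      then show ?thesis
        using mult assms sub retr_H_trivial[of A v s] retr_H_trivial[of "A \<inter> B" v s]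
        by (auto simp: retr_one)
    qed
    then show ?case
      using mult assms sub H_carrier by (simp add: retr_mult retr_carrier)
  qed
qed

section \<open>Cosets of links and twisting cocycles\<close>

text \<open>A subgroup \<open>N\<close> with this property meets \<open>H v\<close> exactly in \<open>N0 \<inter> H v\<close> and distinguishes
  elements of \<open>H v\<close> modulo \<open>N0\<close> even up to factors from the other vertex groups.\<close>

definition fine :: "'v \<Rightarrow> 'w set \<Rightarrow> 'w set \<Rightarrow> bool"
  where "fine v N0 N \<longleftrightarrow> p_normal p N W \<and> N \<subseteq> {w \<in> carrier W. retr {v} w \<in> N0} \<and> N0 \<inter> H v \<subseteq> N"

text \<open>The preimage of N0 under the retraction onto v is the largest set that
  \<open>fine\<close> allows, and it contains \<open>N0 \<inter> H v\<close> because the retraction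
  fixes \<open>H v\<close>.\<close>

lemma fine_base:
  assumes "v \<in> V" "p_normal p N0 W" "p_normal p N W" "N0 \<inter> H v \<subseteq> N"
  shows "fine v N0 (N \<inter> {w \<in> carrier W. retr {v} w \<in> N0})"
  unfolding fine_def
proof (intro conjI)
  show "p_normal p (N \<inter> {w \<in> carrier W. retr {v} w \<in> N0}) W"
    using assms retr_hom[of "{v}"] is_group prime_p by (intro p_normal_Int p_normal_vimage) auto
  show "N0 \<inter> H v \<subseteq> N \<inter> {w \<in> carrier W. retr {v} w \<in> N0}"
    using assms retr_H[of "{v}" v] H_carrier by auto
qed auto

lemma fine_INT:
  assumes "v \<in> V" "p_normal p N0 W" "finite I" "\<And>i. i \<in> I \<Longrightarrow> fine v N0 (N i)"
  obtains N' where "fine v N0 N'" "\<And>i. i \<in> I \<Longrightarrow> N' \<subseteq> N i"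
proof
  have "p_normal p (carrier W \<inter> (\<Inter>i\<in>I. N i)) W"
    using assms is_group prime_p by (intro p_normal_INT) (auto simp: fine_def)
  moreover have "N0 \<inter> H v \<subseteq> carrier W \<inter> (\<Inter>i\<in>I. N i)"
    using assms H_carrier by (auto simp: fine_def)
  ultimately show "fine v N0 ((carrier W \<inter> (\<Inter>i\<in>I. N i)) \<inter> {w \<in> carrier W. retr {v} w \<in> N0})"
    using assms by (intro fine_base)
qed auto

text \<open>The retraction onto v fixes g and kills the parabolic factor, so g is the retraction of
  an element of N.\<close>

lemma fine_not_mem:
  assumes "v \<in> V" "fine v N0 N" "A \<subseteq> V - {v}" "g \<in> H v" "g \<in> parabolic A <#> N"
  shows "g \<in> N0"
proof -
  obtain a n where an: "a \<in> parabolic A" "n \<in> N" "g = a \<otimes> n"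
    using assms(5) by (auto simp: set_mult_def)
  have "n \<in> carrier W" "retr {v} n \<in> N0"
    using assms(2) an by (auto simp: fine_def)
  moreover have "retr {v} a = \<one>" "a \<in> carrier W"
    using assms an retr_trivial[of A "{v}" a] parabolic_carrier[of A a] by auto
  moreover have "retr {v} g = g"
    using assms retr_H[of "{v}" v g] by simp
  ultimately show ?thesis
    using an assms by (auto simp: retr_mult retr_carrier)
qed

text \<open>This is \<open>twist\<close> with U = \<open>parabolic (link v) <#> N\<close>. A graph
  product is the amalgam of \<open>parabolic (V - {v})\<close> and \<open>parabolic (star v)\<close>
  over \<open>parabolic (link v)\<close>; the cosets of the latter are the edges of the tree, and U
  is the image of one edge in the finite quotient.\<close>

definition link_cocycle :: "'v \<Rightarrow> 'w set \<Rightarrow> 'w set \<Rightarrow> ('w \<Rightarrow> 'w \<Rightarrow> int) \<Rightarrow> bool"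
  where "link_cocycle v N N' E \<longleftrightarrow> p_normal p N' W \<and> N' \<subseteq> N \<and> (\<forall>u\<in>V. N \<inter> H u \<subseteq> N') \<and>
    (\<forall>a\<in>carrier W. \<forall>b\<in>carrier W. \<forall>c\<in>carrier W.
      [E (a \<otimes> b) c = E b c + E a (b \<otimes> c)] (mod int p)) \<and>
    (\<forall>a\<in>parabolic (V - {v}). \<forall>c\<in>carrier W. [E a c = 0] (mod int p)) \<and>
    (\<forall>x\<in>H v. \<forall>c\<in>carrier W. [E x c = of_bool (x \<otimes> c \<in> parabolic (link v) <#> N)
        - of_bool (c \<in> parabolic (link v) <#> N)] (mod int p)) \<and>
    (\<forall>n\<in>N'. \<forall>c\<in>carrier W. [E n c = 0] (mod int p)) \<and>
    (\<forall>n\<in>N. \<forall>a\<in>carrier W. \<forall>c\<in>carrier W. E a (n \<otimes> c) = E a c)"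

lemma link_cocycleD:
  assumes "link_cocycle v N N' E"
  shows "p_normal p N' W" "N' \<subseteq> N" "\<And>u. u \<in> V \<Longrightarrow> N \<inter> H u \<subseteq> N'"
    "\<And>a b c. a \<in> carrier W \<Longrightarrow> b \<in> carrier W \<Longrightarrow> c \<in> carrier W \<Longrightarrow>
      [E (a \<otimes> b) c = E b c + E a (b \<otimes> c)] (mod int p)"
    "\<And>a c. a \<in> parabolic (V - {v}) \<Longrightarrow> c \<in> carrier W \<Longrightarrow> [E a c = 0] (mod int p)"
    "\<And>x c. x \<in> H v \<Longrightarrow> c \<in> carrier W \<Longrightarrow>
      [E x c = of_bool (x \<otimes> c \<in> parabolic (link v) <#> N)
        - of_bool (c \<in> parabolic (link v) <#> N)] (mod int p)"
    "\<And>n c. n \<in> N' \<Longrightarrow> c \<in> carrier W \<Longrightarrow> [E n c = 0] (mod int p)"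
    "\<And>n a c. n \<in> N \<Longrightarrow> a \<in> carrier W \<Longrightarrow> c \<in> carrier W \<Longrightarrow> E a (n \<otimes> c) = E a c"
  using assms unfolding link_cocycle_def by blast+

text \<open>The subgroup \<open>parabolic (link v) <#> N\<close> contains N and the vertex groups of
  the link, so it is invariant under left multiplication by them. The cocycle identity extends the
  vanishing of E from the vertex groups to the subgroup that they generate.\<close>

lemma link_cocycle_exists:
  assumes "v \<in> V" "p_normal p N W"
  shows "\<exists>N' E. link_cocycle v N N' E"
proof -
  define U where "U = parabolic (link v) <#> N"
  have link: "link v \<subseteq> V" using link_subset by auto
  have "N \<lhd> W" using assms by (simp add: p_normal_def)
  note LN = subgroup_set_mult_normal[OF subgroup_parabolic[OF link] this, folded U_def]
    set_mult_normalI[OF subgroup_parabolic[OF link] this, folded U_def]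
  have "U \<subseteq> carrier W" using LN(1) subgroup.subset by blast
  moreover have "n \<otimes> c \<in> U \<longleftrightarrow> c \<in> U" if "n \<in> N" "c \<in> carrier W" for n c
    using subgroup_mult_mem_iff[OF LN(1)] that LN(3) by blast
  moreover have "l \<otimes> c \<in> U \<longleftrightarrow> c \<in> U"
    if "u \<in> V" "adj u v" "l \<in> H u" "c \<in> carrier W" for u l c
    using subgroup_mult_mem_iff[OF LN(1)] that LN(2) H_parabolic[of u "link v"]
    by (auto simp: link_def)
  ultimately obtain N' E where E: "p_normal p N' W" "N' \<subseteq> N" "\<forall>u\<in>V. N \<inter> H u \<subseteq> N'"
    "\<forall>a\<in>carrier W. \<forall>b\<in>carrier W. \<forall>c\<in>carrier W.
          [E (a \<otimes> b) c = E b c + E a (b \<otimes> c)] (mod int p)"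
    "\<forall>u\<in>V - {v}. \<forall>x\<in>H u. \<forall>c\<in>carrier W. [E x c = 0] (mod int p)"
    "\<forall>x\<in>H v. \<forall>c\<in>carrier W. [E x c = of_bool (x \<otimes> c \<in> U) - of_bool (c \<in> U)] (mod int p)"
    "\<forall>n\<in>N'. \<forall>c\<in>carrier W. [E n c = 0] (mod int p)"
    "\<forall>n\<in>N. \<forall>a\<in>carrier W. \<forall>c\<in>carrier W. E a (n \<otimes> c) = E a c"
    using twist[OF assms, of U] by blast
  have "[E a c = 0] (mod int p)" if "a \<in> parabolic (V - {v})" "c \<in> carrier W" for a c
  proof -
    have "V - {v} \<subseteq> V" by auto
    from that(1) this that(2) show ?thesis
    proof (induction arbitrary: c rule: parabolic_induct)
      case one
      have "\<one> \<in> N'"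
        using E(1) by (simp add: p_normal_def normal_imp_subgroup subgroup.one_closed)
      then show ?case using E(7) one by blast
    next
      case (mult u s y)
      have c: "s \<in> carrier W" "y \<in> carrier W"
        using mult H_carrier parabolic_carrier[of "V - {v}"] by auto
      then have "[E (s \<otimes> y) c = E y c + E s (y \<otimes> c)] (mod int p)"
        using E(4) mult by blast
      also have "[E y c + E s (y \<otimes> c) = 0 + 0] (mod int p)"
        using mult c E(5) by (intro cong_add) auto
      finally show ?case by simp
    qed
  qed
  then show ?thesis
    using E unfolding U_def link_cocycle_def by (intro exI[of _ N'] exI[of _ E]) blast
qed

section \<open>Alternating words\<close>

fun val :: "('w \<times> 'w) list \<Rightarrow> 'w"
  where "val [] = \<one>"
  | "val ((m, g) # ws) = m \<otimes> (g \<otimes> val ws)"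

text \<open>For N0 = \<open>{\<one>}\<close> these are the reduced words of the amalgam that begin
  outside the link and end in a vertex letter. A larger N0 demands that the letters stay nontrivial
  modulo N0. Storing syllables as pairs makes concatenations of alternating words
  alternating.\<close>

definition alternating :: "'v \<Rightarrow> 'w set \<Rightarrow> 'v set \<Rightarrow> ('w \<times> 'w) list \<Rightarrow> bool"
  where "alternating v N0 B ws \<longleftrightarrow>
    (\<forall>(m, g) \<in> set ws. m \<in> parabolic B - parabolic (link v) \<and> g \<in> H v - N0)"

lemma alternating_simps [simp]:
  "alternating v N0 B []"
  "alternating v N0 B ((m, g) # ws) \<longleftrightarrow>
    m \<in> parabolic B \<and> m \<notin> parabolic (link v) \<and> g \<in> H v \<and> g \<notin> N0 \<and> alternating v N0 B ws"
  "alternating v N0 B (ws @ ws') \<longleftrightarrow> alternating v N0 B ws \<and> alternating v N0 B ws'"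
  by (auto simp: alternating_def)

lemma val_carrier:
  "v \<in> V \<Longrightarrow> B \<subseteq> V \<Longrightarrow> alternating v N0 B ws \<Longrightarrow> val ws \<in> carrier W"
  by (induction ws rule: val.induct) (auto simp: H_carrier parabolic_carrier)

lemma val_append:
  assumes "v \<in> V" "B \<subseteq> V" "alternating v N0 B ws" "alternating v N0 B ws'"
  shows "val (ws @ ws') = val ws \<otimes> val ws'"
  using assms(3)
  by (induction ws rule: val.induct)
    (use assms in \<open>simp_all add: val_carrier[of v B N0] H_carrier[of v] parabolic_carrier[of B] m_assoc\<close>)

definition residual_parabolic :: "'v set \<Rightarrow> bool"
  where "residual_parabolic B \<longleftrightarrow> (\<forall>x \<in> parabolic B. x \<noteq> \<one> \<longrightarrow> (\<exists>N. p_normal p N W \<and> x \<notin> N))"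

text \<open>A retract is closed in the pro-p topology of a residually p-finite group: m differs from
  its retraction onto the link, so y is nontrivial and some N avoids it. If m were a product l n
  with l in the link subgroup, then y would be a conjugate of n times the inverse of its retraction,
  hence in N.\<close>

lemma link_separable:
  assumes v: "v \<in> V" and B: "B \<subseteq> V - {v}" "residual_parabolic B" and N0: "p_normal p N0 W"
    and m: "m \<in> parabolic B" "m \<notin> parabolic (link v)"
  obtains N where "fine v N0 N" "m \<notin> parabolic (link v) <#> N"
proof -
  let ?L = "link v" and ?M = "V - {v}"
  have L: "?L \<subseteq> V" "?L \<subseteq> ?M" and v_link: "v \<notin> ?L" using link_subset by auto
  have M: "?M \<subseteq> V" by auto
  interpret P: subgroup "parabolic B" W using B by (intro subgroup_parabolic) auto
  interpret PM: subgroup "parabolic ?M" W by (intro subgroup_parabolic) auto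
  have mW: "m \<in> carrier W" and mM: "m \<in> parabolic ?M"
    using m parabolic_mono[OF B(1)] by auto
  define y where "y = m \<otimes> inv (retr ?L m)"
  have "retr ?L m \<in> parabolic (B \<inter> ?L)" "parabolic (B \<inter> ?L) \<subseteq> parabolic B"
    using retr_parabolic[of B ?L m] B L m parabolic_mono[of "B \<inter> ?L" B] by auto
  then have "y \<in> parabolic B" unfolding y_def using m by auto
  moreover have "y \<noteq> \<one>"
  proof
    assume "y = \<one>"
    then have "m = retr ?L m"
      unfolding y_def using mW retr_carrier[OF L(1) mW] by (metis inv_inv inv_equality inv_closed)
    then show False using m retr_range[OF L(1) mW] by simp
  qed
  ultimately obtain N where N: "p_normal p N W" "y \<notin> N"
    using B by (auto simp: residual_parabolic_def)
  \<comment> \<open>Pulling N back along two retractions that kill \<open>H v\<close> puts all of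
    \<open>H v\<close> into ?N1, as fineness requires, while the elements of ?N1 in
    \<open>parabolic ?M\<close> still lie in N because the first retraction fixes them.\<close>
  let ?N1 = "{w \<in> carrier W. retr ?M w \<in> N} \<inter> {w \<in> carrier W. retr ?L w \<in> N}"
  have "p_normal p ?N1 W"
    using N prime_p is_group retr_hom[OF M] retr_hom[OF L(1)] by (intro p_normal_Int p_normal_vimage)
  moreover have "\<one> \<in> N" using N by (simp add: p_normal_def normal_imp_subgroup subgroup.one_closed)
  then have "N0 \<inter> H v \<subseteq> ?N1"
    using retr_H_trivial[OF M v] retr_H_trivial[OF L(1) v] H_carrier[OF v] v_link by auto
  ultimately have "fine v N0 (?N1 \<inter> {w \<in> carrier W. retr {v} w \<in> N0})"
    using v N0 by (intro fine_base)
  moreover have "m \<notin> parabolic ?L <#> (?N1 \<inter> {w \<in> carrier W. retr {v} w \<in> N0})"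
  proof
    assume "m \<in> parabolic ?L <#> (?N1 \<inter> {w \<in> carrier W. retr {v} w \<in> N0})"
    then obtain l n where ln: "l \<in> parabolic ?L" "n \<in> carrier W" "retr ?M n \<in> N" "retr ?L n \<in> N"
      "m = l \<otimes> n"
      by (auto simp: set_mult_def)
    interpret N: normal N W using N by (simp add: p_normal_def)
    have l: "l \<in> carrier W" "l \<in> parabolic ?M" "retr ?L l = l"
      using ln(1) parabolic_mono[OF L(2)] parabolic_carrier[OF L(1)] retr_id[of ?L ?L l] L by auto
    have "n = inv l \<otimes> m" using ln l by simp
    then have "n \<in> parabolic ?M" using l mM by auto
    then have "n \<in> N" using ln retr_id[of ?M ?M n] by auto
    moreover have "y = l \<otimes> (n \<otimes> inv (retr ?L n)) \<otimes> inv l"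
      unfolding y_def ln(5) using ln l L
      by (simp add: retr_mult retr_carrier inv_mult_group m_assoc)
    ultimately have "y \<in> N" using ln l N.inv_op_closed2 by simp
    then show False using N by simp
  qed
  ultimately show thesis using that by blast
qed

text \<open>The twisted quotient obtained from the link detects the last vertex letter of the word:
  by induction all shorter subwords avoid the link modulo a suitable \<open>N\<close>, so that evaluating the
  cocycle at the inverse of the last letter yields \<open>1\<close>, whereas it vanishes on \<open>parabolic (V - {v})\<close>.\<close>

lemma alternating_not_mem:
  assumes v: "v \<in> V" and B: "B \<subseteq> V - {v}" "residual_parabolic B" and N0: "p_normal p N0 W"
    and "g \<in> H v" "g \<notin> N0" "alternating v N0 B ws"
  obtains N where "fine v N0 N" "g \<otimes> val ws \<notin> parabolic (V - {v}) <#> N"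
proof -
  let ?M = "V - {v}"
  have M: "?M \<subseteq> V" and BV: "B \<subseteq> V" and L: "link v \<subseteq> V" using B link_subset by auto
  have fine_normal: "N \<lhd> W" if "fine v N0 N" for N
    using that by (simp add: fine_def p_normal_def)
  have sub_mono: "parabolic A <#> N' \<subseteq> parabolic A <#> N" if "N' \<subseteq> N" for A N N'
    using that by (intro mono_set_mult) auto
  have LM: "parabolic (link v) <#> N \<subseteq> parabolic ?M <#> N" for N
    using link_subset by (intro mono_set_mult parabolic_mono) auto
  have MN_iff: "a \<otimes> x \<in> parabolic ?M <#> N \<longleftrightarrow> x \<in> parabolic ?M <#> N"
      "x \<otimes> a \<in> parabolic ?M <#> N \<longleftrightarrow> x \<in> parabolic ?M <#> N"
    if "N \<lhd> W" "x \<in> carrier W" "a \<in> parabolic ?M" for a x N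
    using subgroup_mult_mem_iff[OF subgroup_set_mult_normal[OF subgroup_parabolic[OF M] that(1)]]
      set_mult_normalI(1)[OF subgroup_parabolic[OF M] that(1)] that by auto
  have "\<exists>N. fine v N0 N \<and> g \<otimes> val ws \<notin> parabolic ?M <#> N"
    using assms(5-7)
  proof (induction "length ws" arbitrary: ws g rule: less_induct)
    case less
    show ?case
    proof (cases ws rule: rev_cases)
      case Nil
      have "p_normal p (carrier W) W" using prime_p is_group by (rule p_normal_carrier)
      then have "fine v N0 (carrier W \<inter> {w \<in> carrier W. retr {v} w \<in> N0})" (is "fine v N0 ?N")
        using v N0 H_carrier by (intro fine_base) auto
      moreover have "g \<notin> parabolic ?M <#> ?N"
        using fine_not_mem[OF v calculation, of ?M g] less by auto
      ultimately show ?thesis using Nil less v H_carrier by auto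
    next
      case (snoc ws' mh)
      obtain m h where mh: "mh = (m, h)" by force
      have ws: "ws = ws' @ [(m, h)]" using snoc mh by simp
      have mh: "m \<in> parabolic B" "m \<notin> parabolic (link v)" "h \<in> H v" "h \<notin> N0"
        "alternating v N0 B ws'"
        using less.prems ws by auto
      have mM: "m \<in> parabolic ?M" using mh parabolic_mono[OF B(1)] by auto
      note carrier = mh(1)[THEN parabolic_carrier[OF BV]] mh(3)[THEN H_carrier[OF v]]
        less.prems(1)[THEN H_carrier[OF v]] val_carrier[OF v BV mh(5)]
      \<comment> \<open>The dummy syllable makes g a letter of the list, so that
        \<open>val ws0\<close> is g times \<open>val ws'\<close>. The pairs in S are the suffixes of
        this list that begin with a vertex letter, and the induction hypothesis applies to each of
        them.\<close>
      define ws0 where "ws0 = (\<one>, g) # ws'"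
      define S where "S = {(g', r). \<exists>a m'. ws0 = a @ (m', g') # r}"
      have "finite S"
      proof (rule finite_subset)
        show "S \<subseteq> (\<lambda>i. (snd (ws0 ! i), drop (Suc i) ws0)) ` {..<length ws0}"
        proof
          fix s assume "s \<in> S"
          then obtain g' r a m' where "s = (g', r)" "ws0 = a @ (m', g') # r"
            by (auto simp: S_def)
          then show "s \<in> (\<lambda>i. (snd (ws0 ! i), drop (Suc i) ws0)) ` {..<length ws0}"
            by (intro image_eqI[of _ _ "length a"]) auto
        qed
      qed auto
      moreover have "\<exists>N. fine v N0 N \<and> g' \<otimes> val r \<notin> parabolic ?M <#> N" if gr: "(g', r) \<in> S" for g' r
      proof -
        obtain a m' where a: "ws0 = a @ (m', g') # r" using gr by (auto simp: S_def)
        then have "length ws0 = length a + Suc (length r)" by simp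
        then have "length r < length ws" by (simp add: ws0_def ws)
        moreover have "g' \<in> H v \<and> g' \<notin> N0 \<and> alternating v N0 B r"
        proof (cases a)
          case Nil
          then show ?thesis using a less.prems mh by (simp add: ws0_def)
        next
          case (Cons b a')
          then have "ws' = a' @ (m', g') # r" using a by (simp add: ws0_def)
          then show ?thesis using mh by simp
        qed
        ultimately show ?thesis using less.hyps by blast
      qed
      then have "\<exists>N. fine v N0 N \<and> fst s \<otimes> val (snd s) \<notin> parabolic ?M <#> N" if "s \<in> S" for s
        using that by (cases s) auto
      then obtain NS where NS: "\<And>s. s \<in> S \<Longrightarrow> fine v N0 (NS s)"
        "\<And>s. s \<in> S \<Longrightarrow> fst s \<otimes> val (snd s) \<notin> parabolic ?M <#> NS s"
        by metis
      ultimately obtain N1 where N1: "fine v N0 N1" "\<And>s. s \<in> S \<Longrightarrow> N1 \<subseteq> NS s"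
        using fine_INT[OF v N0, of S NS] by blast
      obtain N2 where N2: "fine v N0 N2" "m \<notin> parabolic (link v) <#> N2"
        using link_separable[OF v B N0 mh(1,2)] by blast
      \<comment> \<open>One N that serves all shorter subwords and also keeps m away from the link
        subgroup.\<close>
      obtain N where NF: "fine v N0 N" and NB: "\<And>b. N \<subseteq> (if b then N1 else N2)"
        by (rule fine_INT[OF v N0, of UNIV "\<lambda>b. if b then N1 else N2"]) (use N1(1) N2(1) in auto)
      note N = NF NB[of True, simplified] NB[of False, simplified]
      have S_not: "g' \<otimes> val r \<notin> parabolic ?M <#> N" if "(g', r) \<in> S" for g' r
        using NS(2)[OF that] N1(2)[OF that] N(2) sub_mono[of N "NS (g', r)" ?M] by auto
      have m_not: "m \<notin> parabolic (link v) <#> N"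
        using N2(2) sub_mono[OF N(3), of "link v"] by auto
      note nN = fine_normal[OF N(1)]
      have pN: "p_normal p N W" using N by (simp add: fine_def)
      obtain N' E where "link_cocycle v N N' E"
        using link_cocycle_exists[OF v pN] by blast
      note E = link_cocycleD[OF this]
      have "fine v N0 N'"
        using N(1) E(1-3) v unfolding fine_def by blast
      moreover have "g \<otimes> val ws \<notin> parabolic ?M <#> N'"
      proof
        assume "g \<otimes> val ws \<in> parabolic ?M <#> N'"
        then obtain b n where bn: "b \<in> parabolic ?M" "n \<in> N'" "g \<otimes> val ws = b \<otimes> n"
          by (auto simp: set_mult_def)
        have n: "n \<in> carrier W" using bn(2) E(1)
          by (meson normal_imp_subgroup p_normal_imp_normal subgroup.mem_carrier)
        have ih: "inv h \<in> carrier W" "n \<otimes> inv h \<in> carrier W" "b \<in> carrier W"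
          using carrier n bn(1) parabolic_carrier[OF M] by auto
        have "[E (b \<otimes> n) (inv h) = E n (inv h) + E b (n \<otimes> inv h)] (mod int p)"
          using E(4) ih n by blast
        also have "[E n (inv h) + E b (n \<otimes> inv h) = 0 + 0] (mod int p)"
          using ih bn by (intro cong_add E(5) E(7))
        finally have zero: "[E (g \<otimes> val ws) (inv h) = 0] (mod int p)" using bn by simp
        \<comment> \<open>A vertex letter contributes a difference of two indicator values, and both
          are zero. The products in question end in m. Without m there remains either the empty
          word, where m itself avoids the link subgroup modulo N, or a shorter subword, which is
          outside \<open>parabolic ?M <#> N\<close>.\<close>
        have suffix: "[E (val r) m = 0] (mod int p)" if "\<exists>a. ws0 = a @ r" for r
          using that
        proof (induction r)
          case Nil
          have "\<one> \<in> N'" using E(1)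
            by (meson normal_imp_subgroup p_normal_imp_normal subgroup.one_closed)
          then show ?case using E(7) carrier by simp
        next
          case (Cons mg r)
          obtain m1 g1 where mg: "mg = (m1, g1)" by force
          obtain a where a: "ws0 = a @ (m1, g1) # r" using Cons.prems mg by auto
          have alt: "m1 \<in> parabolic ?M" "g1 \<in> H v" "alternating v N0 B r"
          proof -
            have "\<one> \<in> parabolic ?M" by (simp add: parabolic_def generate.one)
            then show "m1 \<in> parabolic ?M" "g1 \<in> H v" "alternating v N0 B r"
              using a mh less.prems parabolic_mono[OF B(1)] by (cases a; auto simp: ws0_def)+
          qed
          have c: "val r \<in> carrier W" "g1 \<in> carrier W" "m1 \<in> carrier W" "val r \<otimes> m \<in> carrier W"
            using val_carrier[OF v BV alt(3)] H_carrier[OF v alt(2)] parabolic_carrier[OF M alt(1)]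
              carrier by auto
          have not1: "g1 \<otimes> (val r \<otimes> m) \<notin> parabolic (link v) <#> N"
          proof
            assume "g1 \<otimes> (val r \<otimes> m) \<in> parabolic (link v) <#> N"
            then have "g1 \<otimes> val r \<otimes> m \<in> parabolic ?M <#> N"
              using LM c carrier by (auto simp: m_assoc)
            then have "g1 \<otimes> val r \<in> parabolic ?M <#> N" using MN_iff[OF nN] c mM by auto
            then show False using S_not[of g1 r] a by (auto simp: S_def)
          qed
          have not2: "val r \<otimes> m \<notin> parabolic (link v) <#> N"
          proof (cases r)
            case Nil
            then show ?thesis using m_not carrier by simp
          next
            case (Cons mg2 r2)
            obtain m2 g2 where r: "r = (m2, g2) # r2" using Cons by (cases mg2) auto
            then have alt2: "m2 \<in> parabolic ?M" "g2 \<in> H v" "alternating v N0 B r2"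
              using alt parabolic_mono[OF B(1)] by auto
            have c2: "g2 \<otimes> val r2 \<in> carrier W"
              using val_carrier[OF v BV alt2(3)] H_carrier[OF v alt2(2)] by auto
            have "ws0 = (a @ [(m1, g1)]) @ (m2, g2) # r2" using a r by simp
            then have "(g2, r2) \<in> S" unfolding S_def by blast
            then have "g2 \<otimes> val r2 \<notin> parabolic ?M <#> N" by (rule S_not)
            then have "val r \<notin> parabolic ?M <#> N"
              using MN_iff(1)[OF nN c2 alt2(1)] r by simp
            then show ?thesis using MN_iff(2)[OF nN c(1) mM] LM by auto
          qed
          have "[E (val (mg # r)) m = E (g1 \<otimes> val r) m + E m1 (g1 \<otimes> val r \<otimes> m)] (mod int p)"
            using mg E(4)[of m1 "g1 \<otimes> val r" m] c carrier by simp
          also have "[E (g1 \<otimes> val r) m + E m1 (g1 \<otimes> val r \<otimes> m) = E (g1 \<otimes> val r) m + 0] (mod int p)"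
            using c carrier alt by (intro cong_add cong_refl E(5)) auto
          also have "[E (g1 \<otimes> val r) m + 0 = E (val r) m + E g1 (val r \<otimes> m)] (mod int p)"
            using E(4)[of g1 "val r" m] c carrier by simp
          also have "[E (val r) m + E g1 (val r \<otimes> m) = 0 + 0] (mod int p)"
          proof (intro cong_add)
            show "[E (val r) m = 0] (mod int p)" using Cons.IH a by (metis append.assoc append_Cons append_Nil)
            show "[E g1 (val r \<otimes> m) = 0] (mod int p)"
              using E(6)[OF alt(2) c(4)] not1 not2 by simp
          qed
          finally show ?case by simp
        qed
        have z: "[E (g \<otimes> val ws') m = 0] (mod int p)"
          using suffix[of ws0] carrier by (simp add: ws0_def)
        have gw: "g \<otimes> val ws' \<in> carrier W" using carrier by simp
        have "val ws = val ws' \<otimes> (m \<otimes> h)"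
          using val_append[OF v BV mh(5), of "[(m, h)]"] mh ws carrier by simp
        \<comment> \<open>The last letter gives the only nonzero contribution: h moves
          \<open>inv h\<close>, which is outside the link subgroup modulo N, to
          \<open>\<one>\<close>, which is inside.\<close>
        then have eq: "g \<otimes> val ws = (g \<otimes> val ws' \<otimes> m) \<otimes> h"
          using carrier by (simp add: m_assoc)
        have "[E (g \<otimes> val ws) (inv h) = E h (inv h) + E (g \<otimes> val ws' \<otimes> m) \<one>] (mod int p)"
          using E(4)[of "g \<otimes> val ws' \<otimes> m" h "inv h"] carrier eq by simp
        also have "[E h (inv h) + E (g \<otimes> val ws' \<otimes> m) \<one> = 1 + 0] (mod int p)"
        proof (intro cong_add)
          have Lsub: "subgroup (parabolic (link v) <#> N) W"
            using subgroup_set_mult_normal[OF subgroup_parabolic[OF L] nN] .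
          have "inv h \<notin> parabolic (link v) <#> N"
          proof
            assume "inv h \<in> parabolic (link v) <#> N"
            then have "inv (inv h) \<in> parabolic (link v) <#> N"
              by (rule subgroup.m_inv_closed[OF Lsub])
            then show False
              using fine_not_mem[OF v N(1) link_subset mh(3)] mh(4) carrier by simp
          qed
          moreover have "\<one> \<in> parabolic (link v) <#> N" using subgroup.one_closed[OF Lsub] .
          ultimately show "[E h (inv h) = 1] (mod int p)"
            using E(6)[OF mh(3) ih(1)] carrier by simp
          have "[E (g \<otimes> val ws' \<otimes> m) \<one> = E m \<one> + E (g \<otimes> val ws') m] (mod int p)"
            using E(4)[OF gw, of m \<one>] carrier by simp
          also have "[E m \<one> + E (g \<otimes> val ws') m = 0 + 0] (mod int p)"
            by (intro cong_add z E(5) mM) simp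
          finally show "[E (g \<otimes> val ws' \<otimes> m) \<one> = 0] (mod int p)" by simp
        qed
        finally have "[1 = 0] (mod int p)" using zero by (metis add_0_right cong_sym cong_trans)
        then show False using prime_p by (simp add: cong_0_iff prime_gt_1_nat)
      qed
      ultimately show ?thesis by blast
    qed
  qed
  then show thesis using that by blast
qed

lemma commute_link:
  assumes v: "v \<in> V" and l: "l \<in> parabolic (link v)" and a: "a \<in> H v"
  shows "a \<otimes> l = l \<otimes> a"
proof -
  have L: "link v \<subseteq> V" using link_subset by auto
  show ?thesis
    using l L
  proof (induction rule: parabolic_induct)
    case (mult u s y)
    then have c: "s \<in> carrier W" "y \<in> carrier W" "a \<otimes> s = s \<otimes> a" "a \<in> carrier W"
      using L H_carrier[of u s] parabolic_carrier[of "link v" y] a commute[of u v s a] v H_carrier[OF v a]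
      by (auto simp: link_def)
    have "a \<otimes> (s \<otimes> y) = s \<otimes> (a \<otimes> y)" using c by (metis m_assoc)
    then show ?case using c mult by (simp add: m_assoc)
  qed (use a v H_carrier in simp)
qed

text \<open>The shape is stable under left multiplication by vertex elements. A letter of
  \<open>H v\<close> opens a new syllable if m is outside the link subgroup; otherwise it commutes
  past m and merges with g, and after a cancellation the next syllable takes over.\<close>

lemma reduced_form:
  assumes v: "v \<in> V" and B: "B \<subseteq> V - {v}" and x: "x \<in> parabolic (insert v B)"
  shows "x \<in> parabolic B \<or> (\<exists>m g ws m'. m \<in> parabolic B \<and> m' \<in> parabolic B \<and> g \<in> H v \<and> g \<noteq> \<one> \<and>
    alternating v {\<one>} B ws \<and> x = m \<otimes> (g \<otimes> val ws) \<otimes> m')"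
    (is "?R x")
proof -
  have BV: "B \<subseteq> V" "insert v B \<subseteq> V" using B v by auto
  interpret P: subgroup "parabolic B" W by (rule subgroup_parabolic[OF BV(1)])
  interpret Hv: subgroup "H v" W by (rule subgroup_H[OF v])
  have L: "link v \<subseteq> V" using link_subset by auto
  have intro: "?R y" if "y = m \<otimes> (g \<otimes> val ws) \<otimes> m'" "m \<in> parabolic B" "m' \<in> parabolic B"
    "g \<in> H v" "g \<noteq> \<one>" "alternating v {\<one>} B ws" for y m g ws m'
    using that by blast
  have mult_P: "?R (b \<otimes> y)" if b: "b \<in> parabolic B" and y: "?R y" for b y
    using y
  proof
    assume "\<exists>m g ws m'. m \<in> parabolic B \<and> m' \<in> parabolic B \<and> g \<in> H v \<and> g \<noteq> \<one> \<and>
      alternating v {\<one>} B ws \<and> y = m \<otimes> (g \<otimes> val ws) \<otimes> m'"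
    then obtain m g ws m' where *: "m \<in> parabolic B" "m' \<in> parabolic B" "g \<in> H v" "g \<noteq> \<one>"
      "alternating v {\<one>} B ws" "y = m \<otimes> (g \<otimes> val ws) \<otimes> m'" by blast
    have "b \<otimes> y = (b \<otimes> m) \<otimes> (g \<otimes> val ws) \<otimes> m'"
      using * b P.mem_carrier Hv.mem_carrier val_carrier[OF v BV(1) *(5)] by (simp add: m_assoc)
    then show ?thesis by (rule intro) (use * b P.m_closed in auto)
  qed (use b in simp)
  have mult_H: "?R (a \<otimes> y)" if a: "a \<in> H v" and y: "?R y" for a y
  proof (cases "a = \<one>")
    case True
    have "y \<in> carrier W"
      using y P.mem_carrier Hv.mem_carrier val_carrier[OF v BV(1)] by auto
    then show ?thesis using True y by simp
  next
    case False
    from y show ?thesis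
    proof
      assume y: "y \<in> parabolic B"
      then have "a \<otimes> y = \<one> \<otimes> (a \<otimes> val []) \<otimes> y" using a by simp
      then show ?thesis by (rule intro) (use y a False P.one_closed in auto)
    next
      assume "\<exists>m g ws m'. m \<in> parabolic B \<and> m' \<in> parabolic B \<and> g \<in> H v \<and> g \<noteq> \<one> \<and>
        alternating v {\<one>} B ws \<and> y = m \<otimes> (g \<otimes> val ws) \<otimes> m'"
      then obtain m g ws m' where *: "m \<in> parabolic B" "m' \<in> parabolic B" "g \<in> H v" "g \<noteq> \<one>"
        "alternating v {\<one>} B ws" "y = m \<otimes> (g \<otimes> val ws) \<otimes> m'" by blast
      note c = *(1)[THEN P.mem_carrier] *(2)[THEN P.mem_carrier] *(3)[THEN Hv.mem_carrier]
        val_carrier[OF v BV(1) *(5)] a[THEN Hv.mem_carrier]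
      show ?thesis
      proof (cases "m \<in> parabolic (link v)")
        case True
        have "a \<otimes> m = m \<otimes> a" using commute_link[OF v True a] .
        then have eq: "a \<otimes> y = m \<otimes> ((a \<otimes> g) \<otimes> val ws) \<otimes> m'"
          using c *(6) by (simp flip: m_assoc)
        show ?thesis
        proof (cases "a \<otimes> g = \<one>")
          case False
          then show ?thesis by (intro intro[OF eq]) (use * a Hv.m_closed in auto)
        next
          case one: True
          show ?thesis
          proof (cases ws)
            case Nil
            then have "a \<otimes> y = m \<otimes> m'" using eq one c by simp
            then show ?thesis using * by auto
          next
            case (Cons mg ws')
            then obtain m2 g2 where ws: "ws = (m2, g2) # ws'" by (cases mg) auto
            then have w: "m2 \<in> parabolic B" "g2 \<in> H v" "g2 \<noteq> \<one>" "alternating v {\<one>} B ws'"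
              using * by auto
            have "a \<otimes> y = (m \<otimes> m2) \<otimes> (g2 \<otimes> val ws') \<otimes> m'"
              using eq one ws c w P.mem_carrier Hv.mem_carrier val_carrier[OF v BV(1) w(4)]
              by (simp add: m_assoc)
            then show ?thesis by (rule intro) (use * w P.m_closed in auto)
          qed
        qed
      next
        case m: False
        have eq: "a \<otimes> y = \<one> \<otimes> (a \<otimes> val ((m, g) # ws)) \<otimes> m'"
          using c *(6) by (simp add: m_assoc)
        show ?thesis by (rule intro[OF eq]) (use * m a False P.one_closed in auto)
      qed
    qed
  qed
  show ?thesis
    using x BV(2)
  proof (induction rule: parabolic_induct)
    case (mult u s y)
    show ?case
    proof (cases "u = v")
      case True
      then have "s \<in> H v" using mult by simp
      then show ?thesis by (rule mult_H[OF _ mult.IH])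
    next
      case False
      then have "s \<in> parabolic B" using mult H_parabolic[of u B] by auto
      then show ?thesis by (rule mult_P[OF _ mult.IH])
    qed
  qed (use P.one_closed in blast)
qed

section \<open>Residual p-finiteness of parabolic subgroups\<close>

lemma avoid_letters:
  assumes v: "v \<in> V" and "alternating v {\<one>} B ws" "finite S" "S \<subseteq> H v - {\<one>}"
  obtains N0 where "p_normal p N0 W" "alternating v N0 B ws" "S \<inter> N0 = {}"
proof -
  have "\<exists>N. p_normal p N W \<and> (S \<union> snd ` set ws) \<inter> N = {}"
    by (rule p_normal_avoid_finite[OF prime_p is_group])
      (use assms H_residual[OF v] in \<open>auto simp: alternating_def\<close>)
  then obtain N0 where "p_normal p N0 W" "(S \<union> snd ` set ws) \<inter> N0 = {}" by blast
  moreover from this have "alternating v N0 B ws"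
    using assms(2) by (force simp: alternating_def)
  ultimately show thesis using that by blast
qed

text \<open>Vertices are added one at a time because separating letters from the link uses residual
  p-finiteness of the smaller parabolic subgroup. The outer factors of the reduced form lie in
  \<open>parabolic (V - {v})\<close>, so they do not disturb the conclusion of
  \<open>alternating_not_mem\<close>.\<close>

theorem residual_parabolic:
  assumes "B \<subseteq> V"
  shows "residual_parabolic B"
  using finite_subset[OF assms finite_V] assms
proof (induction B rule: finite_induct)
  case empty
  then show ?case by (simp add: residual_parabolic_def)
next
  case (insert v B)
  then have v: "v \<in> V" and B: "B \<subseteq> V - {v}" "residual_parabolic B" and M: "V - {v} \<subseteq> V" by auto
  show ?case
    unfolding residual_parabolic_def
  proof (intro ballI impI)
    fix x assume x: "x \<in> parabolic (insert v B)" "x \<noteq> \<one>"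
    show "\<exists>N. p_normal p N W \<and> x \<notin> N"
    proof (cases "x \<in> parabolic B")
      case True
      then show ?thesis using B x by (auto simp: residual_parabolic_def)
    next
      case False
      then obtain m g ws m' where *: "m \<in> parabolic B" "m' \<in> parabolic B" "g \<in> H v" "g \<noteq> \<one>"
        "alternating v {\<one>} B ws" "x = m \<otimes> (g \<otimes> val ws) \<otimes> m'"
        using reduced_form[OF v B(1) x(1)] by blast
      obtain N0 where N0: "p_normal p N0 W" "alternating v N0 B ws" "{g} \<inter> N0 = {}"
        by (rule avoid_letters[OF v *(5), of "{g}"]) (use * in auto)
      then have "g \<notin> N0" by simp
      from alternating_not_mem[OF v B N0(1) *(3) this N0(2)] obtain N
        where N: "fine v N0 N" "g \<otimes> val ws \<notin> parabolic (V - {v}) <#> N" by blast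
      then have pN: "p_normal p N W" by (simp add: fine_def)
      note nN = p_normal_imp_normal[OF pN]
      note sub = subgroup_set_mult_normal[OF subgroup_parabolic[OF M] nN]
        set_mult_normalI[OF subgroup_parabolic[OF M] nN]
      have mm: "m \<in> parabolic (V - {v}) <#> N" "m' \<in> parabolic (V - {v}) <#> N"
        using * sub(2) parabolic_mono[OF B(1)] by auto
      have "g \<otimes> val ws \<in> carrier W" "m \<in> carrier W"
        using val_carrier[OF v _ *(5)] H_carrier[OF v *(3)] *(1) parabolic_carrier[of B] B by auto
      then have "x \<notin> N"
        using N(2) sub(3) *(6) subgroup_mult_mem_iff(2)[OF sub(1) mm(2), of "m \<otimes> (g \<otimes> val ws)"]
          subgroup_mult_mem_iff(1)[OF sub(1) mm(1), of "g \<otimes> val ws"] by auto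
      then show ?thesis using pN by blast
    qed
  qed
qed

corollary residual: "x \<in> carrier W \<Longrightarrow> x \<noteq> \<one> \<Longrightarrow> \<exists>N. p_normal p N W \<and> x \<notin> N"
  using residual_parabolic[of V] by (auto simp: residual_parabolic_def)

section \<open>Cyclically reduced forms\<close>

lemma parabolic_star:
  assumes v: "v \<in> V" and y: "y \<in> parabolic (star v)"
  obtains l g where "l \<in> parabolic (link v)" "g \<in> H v" "y = l \<otimes> g"
proof -
  have L: "link v \<subseteq> V" using link_subset by auto
  interpret P: subgroup "parabolic (link v)" W by (rule subgroup_parabolic[OF L])
  interpret Hv: subgroup "H v" W by (rule subgroup_H[OF v])
  have "\<exists>l g. l \<in> parabolic (link v) \<and> g \<in> H v \<and> y = l \<otimes> g"
    using y star_subset[OF v]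
  proof (induction rule: parabolic_induct)
    case one
    have "\<one> = \<one> \<otimes> \<one>" by simp
    then show ?case using P.one_closed Hv.one_closed by blast
  next
    case (mult u s y)
    then obtain l g where lg: "l \<in> parabolic (link v)" "g \<in> H v" "y = l \<otimes> g" by blast
    have sW: "s \<in> carrier W" using mult star_subset[OF v] H_carrier by auto
    note c = sW P.mem_carrier[OF lg(1)] Hv.mem_carrier[OF lg(2)]
    show ?case
    proof (cases "u = v")
      case True
      then have "s \<otimes> y = l \<otimes> (s \<otimes> g)"
        using c lg commute_link[OF v lg(1), of s] mult by (simp flip: m_assoc)
      then show ?thesis using lg True mult by blast
    next
      case False
      then have "s \<in> parabolic (link v)" using mult H_parabolic[of u "link v"] by (auto simp: star_def)
      moreover have "s \<otimes> y = (s \<otimes> l) \<otimes> g" using c lg by (simp add: m_assoc)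
      ultimately show ?thesis using lg by blast
    qed
  qed
  then show thesis using that by blast
qed

lemma link_mult_H_star:
  assumes v: "v \<in> V" "l \<in> parabolic (link v)" "g \<in> H v"
  shows "l \<otimes> g \<in> parabolic (star v)"
  using assms parabolic_mono[of "link v" "star v"] H_parabolic[of v "star v"]
    subgroup.m_closed[OF subgroup_parabolic[OF star_subset[OF v(1)]]]
  by (auto simp: star_def)

text \<open>The first two alternatives are elliptic elements, fixing one of the two base vertices of
  the tree. The third describes hyperbolic elements by words that admit no cyclic
  cancellation.\<close>

definition cyclically_reduced :: "'v \<Rightarrow> 'w \<Rightarrow> bool"
  where "cyclically_reduced v x \<longleftrightarrow> x \<in> parabolic (V - {v}) \<or> x \<in> parabolic (star v) \<or>
    (\<exists>ws. ws \<noteq> [] \<and> alternating v {\<one>} (V - {v}) ws \<and> x = val ws)"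

text \<open>Induction on the length. If m is in the link subgroup, conjugation moves the last
  syllable to the front, where its vertex letter commutes past m and merges with g, so that the word
  becomes shorter.\<close>

lemma cyclic_trichotomy_word:
  assumes v: "v \<in> V" and "m \<in> parabolic (V - {v})" "g \<in> H v" "g \<noteq> \<one>"
    and "alternating v {\<one>} (V - {v}) ws"
  shows "\<exists>c\<in>carrier W. cyclically_reduced v (inv c \<otimes> (m \<otimes> (g \<otimes> val ws)) \<otimes> c)"
  using assms(2-)
proof (induction "length ws" arbitrary: m g ws rule: less_induct)
  case less
  let ?M = "V - {v}"
  have M: "?M \<subseteq> V" by auto
  interpret P: subgroup "parabolic ?M" W by (rule subgroup_parabolic[OF M])
  interpret Hv: subgroup "H v" W by (rule subgroup_H[OF v])
  let ?x = "m \<otimes> (g \<otimes> val ws)"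
  note c = P.mem_carrier[OF less.prems(1)] Hv.mem_carrier[OF less.prems(2)]
    val_carrier[OF v M less.prems(4)]
  have conj: "\<exists>c\<in>carrier W. cyclically_reduced v (inv c \<otimes> ?x \<otimes> c)"
    if "d \<in> carrier W" "e \<in> carrier W" "cyclically_reduced v (inv e \<otimes> (inv d \<otimes> ?x \<otimes> d) \<otimes> e)" for d e
  proof (rule bexI[of _ "d \<otimes> e"])
    have "inv (d \<otimes> e) \<otimes> ?x \<otimes> (d \<otimes> e) = inv e \<otimes> (inv d \<otimes> ?x \<otimes> d) \<otimes> e"
      using that c by (simp add: inv_mult_group m_assoc)
    then show "cyclically_reduced v (inv (d \<otimes> e) \<otimes> ?x \<otimes> (d \<otimes> e))" using that by simp
  qed (use that in simp)
  have here: "\<exists>c\<in>carrier W. cyclically_reduced v (inv c \<otimes> ?x \<otimes> c)" if "cyclically_reduced v ?x"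
    using that conj[of \<one> \<one>] c by simp
  show ?case
  proof (cases "m \<in> parabolic (link v)")
    case False
    have "?x = val ((m, g) # ws)" by simp
    moreover have "alternating v {\<one>} ?M ((m, g) # ws)" using less.prems False by simp
    ultimately show ?thesis unfolding cyclically_reduced_def using here cyclically_reduced_def by blast
  next
    case m: True
    show ?thesis
    proof (cases ws rule: rev_cases)
      case Nil
      then show ?thesis
        using here link_mult_H_star[OF v m less.prems(2)] c by (simp add: cyclically_reduced_def)
    next
      case (snoc ws' mh)
      obtain k h where ws: "ws = ws' @ [(k, h)]" using snoc by (cases mh) auto
      have w: "alternating v {\<one>} ?M ws'" "k \<in> parabolic ?M" "h \<in> H v" "h \<noteq> \<one>"
        "alternating v {\<one>} ?M [(k, h)]"
        using less.prems ws by auto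
      note cw = P.mem_carrier[OF w(2)] Hv.mem_carrier[OF w(3)] val_carrier[OF v M w(1)]
      have "val ws = val ws' \<otimes> (k \<otimes> h)"
        using val_append[OF v M w(1,5)] ws cw by simp
      then have x: "?x = m \<otimes> (g \<otimes> (val ws' \<otimes> (k \<otimes> h)))" by simp
      define d where "d = inv (k \<otimes> h)"
      have d: "d \<in> carrier W" "inv d = k \<otimes> h" unfolding d_def using cw by auto
      have "inv d \<otimes> ?x \<otimes> d = k \<otimes> (h \<otimes> m) \<otimes> (g \<otimes> val ws')"
        unfolding x d(2) using c cw by (simp add: d_def m_assoc r_inv)
      also have "h \<otimes> m = m \<otimes> h" using commute_link[OF v m w(3)] .
      also have "k \<otimes> (m \<otimes> h) \<otimes> (g \<otimes> val ws') = (k \<otimes> m) \<otimes> ((h \<otimes> g) \<otimes> val ws')"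
        using c cw by (simp add: m_assoc)
      finally have conj_eq: "inv d \<otimes> ?x \<otimes> d = (k \<otimes> m) \<otimes> ((h \<otimes> g) \<otimes> val ws')" .
      have IH: "\<exists>c\<in>carrier W. cyclically_reduced v (inv c \<otimes> ?x \<otimes> c)" if "inv d \<otimes> ?x \<otimes> d = m1 \<otimes> (g1 \<otimes> val ws1)" "length ws1 < length ws"
        "m1 \<in> parabolic ?M" "g1 \<in> H v" "g1 \<noteq> \<one>" "alternating v {\<one>} ?M ws1" for m1 g1 ws1
        using less.hyps[OF that(2-6)] conj[OF d(1)] unfolding that(1) by blast
      show ?thesis
      proof (cases "h \<otimes> g = \<one>")
        case False
        then show ?thesis
          by (intro IH[OF conj_eq]) (use ws w less.prems in auto)
      next
        case one: True
        show ?thesis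
        proof (cases ws')
          case Nil
          then have "inv d \<otimes> ?x \<otimes> d \<in> parabolic ?M"
            unfolding conj_eq using one w less.prems c cw by simp
          then have "cyclically_reduced v (inv \<one> \<otimes> (inv d \<otimes> ?x \<otimes> d) \<otimes> \<one>)"
            using P.mem_carrier by (simp add: cyclically_reduced_def)
          then show ?thesis using conj[OF d(1)] by blast
        next
          case (Cons mg ws2)
          then obtain m2 g2 where ws': "ws' = (m2, g2) # ws2" by (cases mg) auto
          then have w2: "m2 \<in> parabolic ?M" "g2 \<in> H v" "g2 \<noteq> \<one>" "alternating v {\<one>} ?M ws2"
            using w by auto
          have "inv d \<otimes> ?x \<otimes> d = (k \<otimes> m \<otimes> m2) \<otimes> (g2 \<otimes> val ws2)"
            unfolding conj_eq using one ws' c cw P.mem_carrier[OF w2(1)] Hv.mem_carrier[OF w2(2)]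
              val_carrier[OF v M w2(4)] by (simp add: m_assoc)
          then show ?thesis
            by (rule IH) (use ws ws' w w2 less.prems in auto)
        qed
      qed
    qed
  qed
qed

lemma cyclic_trichotomy:
  assumes v: "v \<in> V" and x: "x \<in> carrier W"
  shows "\<exists>c\<in>carrier W. cyclically_reduced v (inv c \<otimes> x \<otimes> c)"
proof -
  let ?M = "V - {v}"
  have M: "?M \<subseteq> V" by auto
  interpret P: subgroup "parabolic ?M" W by (rule subgroup_parabolic[OF M])
  have "x \<in> parabolic (insert v ?M)" using x v by (simp add: insert_absorb)
  from reduced_form[OF v _ this] consider "x \<in> parabolic ?M" |
    m g ws m' where "m \<in> parabolic ?M" "m' \<in> parabolic ?M" "g \<in> H v" "g \<noteq> \<one>"
    "alternating v {\<one>} ?M ws" "x = m \<otimes> (g \<otimes> val ws) \<otimes> m'"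
    by blast
  then show ?thesis
  proof cases
    case 1
    then show ?thesis using x by (intro bexI[of _ \<one>]) (simp_all add: cyclically_reduced_def)
  next
    case (2 m g ws m')
    have c: "m \<in> carrier W" "m' \<in> carrier W" "g \<in> carrier W" "val ws \<in> carrier W"
      using 2 P.mem_carrier H_carrier[OF v] val_carrier[OF v M 2(5)] by auto
    \<comment> \<open>Conjugation by m' collects the two outer factors on the left.\<close>
    let ?y = "(m' \<otimes> m) \<otimes> (g \<otimes> val ws)"
    have y: "?y = m' \<otimes> x \<otimes> inv m'" using 2(6) c by (simp add: m_assoc)
    obtain e where e: "e \<in> carrier W" "cyclically_reduced v (inv e \<otimes> ?y \<otimes> e)"
      using cyclic_trichotomy_word[OF v _ 2(3,4,5), of "m' \<otimes> m"] 2 by blast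
    have "inv (inv m' \<otimes> e) \<otimes> x \<otimes> (inv m' \<otimes> e) = inv e \<otimes> ?y \<otimes> e"
      unfolding y using x c e by (simp add: inv_mult_group m_assoc)
    then show ?thesis using e c by (intro bexI[of _ "inv m' \<otimes> e"]) simp_all
  qed
qed

section \<open>Fixed points in twisted quotients\<close>

text \<open>If \<open>d\<close> conjugates a vertex element into the star of \<open>v\<close> in the twisted quotient, then
  \<open>d\<close> lies in the star modulo \<open>N\<close>: the function \<open>h\<close> below is invariant under \<open>x\<close>, so its
  sum over the nontrivial \<open>p\<close>-group \<open>H v / (H v \<inter> N)\<close> vanishes modulo \<open>p\<close>, while the cocycle
  contributes \<open>0\<close> to this sum.\<close>

lemma conjugator_in_star:
  assumes v: "v \<in> V" and x: "x \<in> H v" "x \<noteq> \<one>" and N: "p_normal p N W"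
  obtains N' where "p_normal p N' W" "\<And>y d n. y \<in> parabolic (star v) \<Longrightarrow> d \<in> carrier W \<Longrightarrow>
    n \<in> N' \<Longrightarrow> y \<otimes> d = d \<otimes> x \<otimes> n \<Longrightarrow> d \<in> parabolic (star v) <#> N"
proof -
  let ?S = "parabolic (star v)"
  have L: "link v \<subseteq> V" "v \<notin> link v" using link_subset by auto
  obtain Nx where Nx: "p_normal p Nx W" "x \<notin> Nx" using H_residual[OF v x] by blast
  \<comment> \<open>Intersecting with Nx keeps x nontrivial modulo N0 and, by the retraction onto v,
    modulo N1. The final count needs an element that is nontrivial in the finite group Q.\<close>
  define N0 where "N0 = N \<inter> Nx"
  have N0: "p_normal p N0 W" unfolding N0_def by (rule p_normal_Int[OF prime_p N Nx(1)])
  define N1 where "N1 = N \<inter> {w \<in> carrier W. retr {v} w \<in> N0}"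
  have N1_sub: "N1 \<subseteq> N" by (auto simp: N1_def)
  have fine: "fine v N0 N1"
    unfolding N1_def by (rule fine_base[OF v N0 N]) (auto simp: N0_def)
  then have pN1: "p_normal p N1 W" by (simp add: fine_def)
  interpret N1: normal N1 W using pN1 by (rule p_normal_imp_normal)
  interpret Hv: subgroup "H v" W by (rule subgroup_H[OF v])
  obtain N' E where "link_cocycle v N1 N' E" using link_cocycle_exists[OF v pN1] by blast
  note E = link_cocycleD[OF this]
  define U where "U = parabolic (link v) <#> N1"
  note U = subgroup_set_mult_normal[OF subgroup_parabolic[OF L(1)] N1.normal_axioms, folded U_def]
    set_mult_normalI[OF subgroup_parabolic[OF L(1)] N1.normal_axioms, folded U_def]
  interpret U: subgroup U W by (rule U(1))
  note E6 = E(6)[folded U_def]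
  have xW: "x \<in> carrier W" using x by simp
  have H_U: "t \<in> N1" if "t \<in> H v" "t \<in> U" for t
    using fine_not_mem[OF v fine link_subset that(1)] that fine unfolding U_def fine_def by blast
  have x_N1: "x \<notin> N1"
    using fine Nx(2) retr_H[of "{v}" v x] x v by (auto simp: fine_def N0_def)
  define Q where "Q = (W Mod N1)\<lparr>carrier := (#>) N1 ` H v\<rparr>"
  interpret q: group_hom W "W Mod N1" "(#>) N1"
    using N1.r_coset_hom_Mod N1.factorgroup_is_group is_group
    by (simp add: group_hom_def group_hom_axioms_def)
  have "subgroup ((#>) N1 ` H v) (W Mod N1)"
    by (rule q.subgroup_img_is_subgroup[OF subgroup_H[OF v]])
  then have Q: "finite_p_group p Q"
    unfolding Q_def by (rule finite_p_group_subgroup[OF prime_p p_normal_imp_finite_p_group[OF pN1]])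
  have carrier_Q: "carrier Q = (#>) N1 ` H v" and mult_Q: "monoid.mult Q = monoid.mult (W Mod N1)"
    and one_Q: "\<one>\<^bsub>Q\<^esub> = N1"
    by (simp_all add: Q_def)
  have fin_Q: "finite (carrier Q)" using Q by (simp add: finite_p_group_def)
  define rep where "rep C = (SOME t. t \<in> H v \<and> C = N1 #> t)" for C
  have rep: "rep C \<in> H v" "N1 #> rep C = C" if "C \<in> carrier Q" for C
  proof -
    have "\<exists>t. t \<in> H v \<and> C = N1 #> t" using that by (auto simp: carrier_Q)
    then show "rep C \<in> H v" "N1 #> rep C = C" unfolding rep_def by (metis (mono_tags, lifting) someI_ex)+
  qed
  have repW: "rep C \<in> carrier W" if "C \<in> carrier Q" for C using rep(1)[OF that] by simp
  have coset_eq: "\<exists>n\<in>N1. a = n \<otimes> b" if "N1 #> a = N1 #> b" "a \<in> carrier W" "b \<in> carrier W" for a b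
    using rcos_self[OF that(2) N1.subgroup_axioms] that(1) by (auto simp: r_coset_def)
  have U_left: "n \<otimes> c \<in> U \<longleftrightarrow> c \<in> U" if "n \<in> N1" "c \<in> carrier W" for n c
    using subgroup_mult_mem_iff[OF U(1)] that U(3) by blast
  have U_shift: "a \<otimes> n \<otimes> c \<in> U \<longleftrightarrow> a \<otimes> c \<in> U"
    if "n \<in> N1" "a \<in> carrier W" "c \<in> carrier W" for a n c
  proof -
    have "a \<otimes> n \<otimes> c = (a \<otimes> n \<otimes> inv a) \<otimes> (a \<otimes> c)"
      using that by (simp add: m_assoc)
    then show ?thesis using U_left[OF N1.inv_op_closed2[OF that(2,1)]] that by simp
  qed
  \<comment> \<open>\<open>inS c\<close> says that c lies in the star subgroup modulo N1, since
    \<open>parabolic (star v)\<close> is the product of the link subgroup and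
    \<open>H v\<close>.\<close>
  define inS where "inS c \<longleftrightarrow> (\<exists>t\<in>H v. c \<otimes> t \<in> U)" for c
  \<comment> \<open>At most one coset contributes because \<open>H v\<close> meets U inside N1, so
    this sum is the indicator of \<open>inS\<close>.\<close>
  define K where "K c = (\<Sum>C\<in>carrier Q. of_bool (c \<otimes> rep C \<in> U) :: int)" for c
  have K: "K c = of_bool (inS c)" if c: "c \<in> carrier W" for c
  proof (cases "inS c")
    case True
    then obtain t where t: "t \<in> H v" "c \<otimes> t \<in> U" by (auto simp: inS_def)
    let ?C = "N1 #> t"
    have C: "?C \<in> carrier Q" using t by (simp add: carrier_Q)
    have "c \<otimes> rep C \<in> U \<longleftrightarrow> C = ?C" if CQ: "C \<in> carrier Q" for C
    proof
      assume "C = ?C"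
      then obtain n where n: "n \<in> N1" "rep C = n \<otimes> t"
        using coset_eq[of "rep C" t] rep[OF CQ] t by auto
      then show "c \<otimes> rep C \<in> U" using U_shift[OF n(1) c, of t] t c by (simp add: m_assoc)
    next
      assume "c \<otimes> rep C \<in> U"
      then have "inv (c \<otimes> t) \<otimes> (c \<otimes> rep C) \<in> U" using t by simp
      moreover have "inv (c \<otimes> t) \<otimes> (c \<otimes> rep C) = inv t \<otimes> rep C"
        using c t repW[OF CQ] by (simp add: inv_mult_group m_assoc)
      ultimately have "inv t \<otimes> rep C \<in> N1" using H_U[of "inv t \<otimes> rep C"] t rep[OF CQ] by simp
      then have "t \<otimes> (inv t \<otimes> rep C) \<otimes> inv t \<in> N1" using N1.inv_op_closed2 t by simp
      then have "rep C \<otimes> inv t \<in> N1" using t repW[OF CQ] by (simp add: m_assoc)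
      then have "rep C \<in> N1 #> t" using N1.rcos_module[OF is_group] t repW[OF CQ] by simp
      then show "C = N1 #> t" using repr_independence[of "rep C" N1 t] rep[OF CQ] t N1.subgroup_axioms by simp
    qed
    then have "K c = (\<Sum>C\<in>carrier Q. of_bool (C = ?C))" unfolding K_def by (intro sum.cong) auto
    then show ?thesis using C fin_Q True by (simp add: of_bool_def sum.delta)
  next
    case False
    then show ?thesis unfolding K_def using rep by (auto simp: inS_def)
  qed
  \<comment> \<open>\<open>H v\<close> commutes with the link subgroup and normalizes N1, so s can
    be moved across to the right and absorbed in t.\<close>
  have inS_left: "inS (s \<otimes> c) \<longleftrightarrow> inS c" if s: "s \<in> H v" and c: "c \<in> carrier W" for s c
  proof -
    have *: "inS (s \<otimes> c)" if s: "s \<in> H v" and inS: "inS c" and c: "c \<in> carrier W" for s c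
    proof -
      obtain t where t: "t \<in> H v" "c \<otimes> t \<in> U" using inS by (auto simp: inS_def)
      then obtain l n where ln: "l \<in> parabolic (link v)" "n \<in> N1" "c \<otimes> t = l \<otimes> n"
        by (auto simp: U_def set_mult_def)
      have cc: "l \<in> carrier W" "n \<in> carrier W" "s \<in> carrier W" "t \<in> carrier W"
        using ln parabolic_carrier[OF L(1)] s t by auto
      have "s \<otimes> c \<otimes> (t \<otimes> inv s) = s \<otimes> (c \<otimes> t) \<otimes> inv s" using c cc by (simp add: m_assoc)
      also have "\<dots> = (s \<otimes> l) \<otimes> n \<otimes> inv s" unfolding ln(3) using cc by (simp add: m_assoc)
      also have "s \<otimes> l = l \<otimes> s" by (rule commute_link[OF v ln(1) s])
      also have "l \<otimes> s \<otimes> n \<otimes> inv s = l \<otimes> (s \<otimes> n \<otimes> inv s)" using cc by (simp add: m_assoc)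
      finally have "s \<otimes> c \<otimes> (t \<otimes> inv s) \<in> U"
        using U(2,3) ln N1.inv_op_closed2[OF cc(3) ln(2)] by auto
      then show ?thesis unfolding inS_def using t s by blast
    qed
    show ?thesis
      using *[OF s _ c] *[of "inv s" "s \<otimes> c"] s c by auto
  qed
  \<comment> \<open>Summing over translates by \<open>H v\<close> replaces the link indicator by the
    star indicator. The latter is invariant under \<open>H v\<close>, so the coboundary that defines
    E on \<open>H v\<close> cancels and F vanishes modulo p on all of W.\<close>
  define F where "F w c = (\<Sum>C\<in>carrier Q. E w (c \<otimes> rep C))" for w c
  have F_mult: "[F (a \<otimes> b) c = F b c + F a (b \<otimes> c)] (mod int p)"
    if "a \<in> carrier W" "b \<in> carrier W" "c \<in> carrier W" for a b c
    unfolding F_def sum.distrib[symmetric] using that repW E(4)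
    by (intro cong_sum) (simp add: m_assoc)
  have F0: "[F w c = 0] (mod int p)" if w: "w \<in> carrier W" and c: "c \<in> carrier W" for w c
  proof -
    have "w \<in> parabolic V" "V \<subseteq> V" using w by simp_all
    from this c show ?thesis
    proof (induction arbitrary: c rule: parabolic_induct)
      case one
      have "\<one> \<in> N'" using E(1) by (meson normal_imp_subgroup p_normal_imp_normal subgroup.one_closed)
      then have "[F \<one> c = (\<Sum>C\<in>carrier Q. 0)] (mod int p)"
        unfolding F_def using E(7) one repW by (intro cong_sum) simp
      then show ?case by simp
    next
      case (mult u s y)
      then have cc: "s \<in> carrier W" "y \<in> carrier W" using H_carrier by auto
      have "[F s (y \<otimes> c) = 0] (mod int p)"
      proof (cases "u = v")
        case True
        then have s: "s \<in> H v" using mult by simp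
        have "[F s (y \<otimes> c) = (\<Sum>C\<in>carrier Q. of_bool (s \<otimes> (y \<otimes> c \<otimes> rep C) \<in> U)
            - of_bool (y \<otimes> c \<otimes> rep C \<in> U))] (mod int p)"
          unfolding F_def using E6[OF s] cc mult repW by (intro cong_sum) simp
        also have "(\<Sum>C\<in>carrier Q. of_bool (s \<otimes> (y \<otimes> c \<otimes> rep C) \<in> U)
            - of_bool (y \<otimes> c \<otimes> rep C \<in> U)) = K (s \<otimes> (y \<otimes> c)) - K (y \<otimes> c)"
          unfolding K_def sum_subtractf[symmetric] using cc mult repW
          by (intro sum.cong) (simp_all add: m_assoc)
        also have "\<dots> = 0" using K cc mult inS_left[OF s] by simp
        finally show ?thesis .
      next
        case False
        then have "s \<in> parabolic (V - {v})" using mult H_parabolic[of u "V - {v}"] by auto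
        then have "[F s (y \<otimes> c) = (\<Sum>C\<in>carrier Q. 0)] (mod int p)"
          unfolding F_def using E(5) cc mult repW by (intro cong_sum) simp
        then show ?thesis by simp
      qed
      moreover have "[F y c = 0] (mod int p)" using mult by simp
      ultimately have "[F y c + F s (y \<otimes> c) = 0 + 0] (mod int p)" by (intro cong_add)
      then show ?case using F_mult[OF cc mult.prems] by (auto intro: cong_trans)
    qed
  qed
  show thesis
  proof (rule that[OF E(1)])
    fix y d n assume y: "y \<in> ?S" and d: "d \<in> carrier W" and n: "n \<in> N'" and eq: "y \<otimes> d = d \<otimes> x \<otimes> n"
    obtain l g where lg: "l \<in> parabolic (link v)" "g \<in> H v" "y = l \<otimes> g"
      using parabolic_star[OF v y] by blast
    have lM: "l \<in> parabolic (V - {v})" using lg(1) parabolic_mono[OF link_subset] by auto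
    have nN1: "n \<in> N1" using n E(2) by auto
    have c0: "l \<in> carrier W" "g \<in> carrier W" "y \<in> carrier W" "n \<in> carrier W"
      using lg parabolic_carrier[OF L(1)] nN1 by auto
    \<comment> \<open>This is what the cocycle identity leaves when both sides of y d = d x n are
      expanded: the terms at x c and at c have the same form, so h is invariant under x.\<close>
    define h where "h c = E d c - of_bool (d \<otimes> c \<in> U) + of_bool (c \<in> U)" for c
    have h_x: "[h (x \<otimes> c) = h c] (mod int p)" if c: "c \<in> carrier W" for c
    proof -
      have "[E (y \<otimes> d) c = E d c + (E g (d \<otimes> c) + E l (g \<otimes> (d \<otimes> c)))] (mod int p)"
      proof -
        have "[E y (d \<otimes> c) = E g (d \<otimes> c) + E l (g \<otimes> (d \<otimes> c))] (mod int p)"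
          unfolding lg(3) using E(4)[OF c0(1,2)] c d by simp
        then show ?thesis
          using cong_trans[OF E(4)[OF c0(3) d c] cong_add[OF cong_refl]] by blast
      qed
      also have "[E d c + (E g (d \<otimes> c) + E l (g \<otimes> (d \<otimes> c))) =
          E d c + ((of_bool (g \<otimes> (d \<otimes> c) \<in> U) - of_bool (d \<otimes> c \<in> U)) + 0)] (mod int p)"
        using c d c0 by (intro cong_add cong_refl E6[OF lg(2)] E(5)[OF lM]) simp_all
      also have "g \<otimes> (d \<otimes> c) \<in> U \<longleftrightarrow> l \<otimes> (g \<otimes> (d \<otimes> c)) \<in> U"
        using subgroup_mult_mem_iff(1)[OF U(1), of l] U(2) lg(1) c d c0 by auto
      also have "l \<otimes> (g \<otimes> (d \<otimes> c)) = y \<otimes> d \<otimes> c"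
        unfolding lg(3) using c d c0 by (simp add: m_assoc)
      also have "y \<otimes> d \<otimes> c \<in> U \<longleftrightarrow> d \<otimes> (x \<otimes> c) \<in> U"
        unfolding eq using U_shift[OF nN1, of "d \<otimes> x" c] c d xW by (simp add: m_assoc)
      finally have 1: "[E (y \<otimes> d) c =
        E d c + ((of_bool (d \<otimes> (x \<otimes> c) \<in> U) - of_bool (d \<otimes> c \<in> U)) + 0)] (mod int p)" .
      have "[E (d \<otimes> x \<otimes> n) c = E n c + E (d \<otimes> x) (n \<otimes> c)] (mod int p)"
        using E(4) c d xW c0 by simp
      also have "E (d \<otimes> x) (n \<otimes> c) = E (d \<otimes> x) c" using E(8)[OF nN1] c d xW by simp
      also have "[E n c + E (d \<otimes> x) c = 0 + (E x c + E d (x \<otimes> c))] (mod int p)"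
        using E(7)[OF n c] E(4)[OF d xW c] by (rule cong_add)
      also have "[0 + (E x c + E d (x \<otimes> c)) =
          0 + ((of_bool (x \<otimes> c \<in> U) - of_bool (c \<in> U)) + E d (x \<otimes> c))] (mod int p)"
        by (intro cong_add cong_refl E6[OF x(1) c])
      finally have 2: "[E (d \<otimes> x \<otimes> n) c =
        0 + ((of_bool (x \<otimes> c \<in> U) - of_bool (c \<in> U)) + E d (x \<otimes> c))] (mod int p)" .
      note cong_diff[OF 2 1[unfolded eq]]
      moreover have "0 + ((of_bool (x \<otimes> c \<in> U) - of_bool (c \<in> U)) + E d (x \<otimes> c)) -
        (E d c + ((of_bool (d \<otimes> (x \<otimes> c) \<in> U) - of_bool (d \<otimes> c \<in> U)) + 0)) = h (x \<otimes> c) - h c"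
        by (simp add: h_def)
      ultimately have "[0 = h (x \<otimes> c) - h c] (mod int p)" by simp
      then show ?thesis by (simp add: cong_iff_dvd_diff dvd_diff_commute)
    qed
    have h_N: "h (m \<otimes> c) = h c" if m: "m \<in> N1" and c: "c \<in> carrier W" for m c
      unfolding h_def using E(8)[OF m d c] U_left[OF m c] U_shift[OF m d c] c d m by (simp add: m_assoc)
    have "[(\<Sum>C\<in>carrier Q. h (rep C)) = 0] (mod int p)"
    proof (rule finite_p_group_invariant_sum[OF prime_p Q])
      show xQ: "N1 #> x \<in> carrier Q" using x by (simp add: carrier_Q)
      show "N1 #> x \<noteq> \<one>\<^bsub>Q\<^esub>"
        using x_N1 xW rcos_self[OF xW N1.subgroup_axioms] by (auto simp: one_Q)
      fix C assume C: "C \<in> carrier Q"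
      interpret Q: group Q using Q by (simp add: finite_p_group_def)
      have xC: "(N1 #> x) \<otimes>\<^bsub>Q\<^esub> C \<in> carrier Q" using xQ C by simp
      have "N1 #> rep ((N1 #> x) \<otimes>\<^bsub>Q\<^esub> C) = (N1 #> x) \<otimes>\<^bsub>Q\<^esub> (N1 #> rep C)"
        using rep(2)[OF xC] rep(2)[OF C] by simp
      also have "\<dots> = N1 #> (x \<otimes> rep C)"
        using q.hom_mult[OF xW repW[OF C]] by (simp add: mult_Q)
      finally obtain m where "m \<in> N1" "rep ((N1 #> x) \<otimes>\<^bsub>Q\<^esub> C) = m \<otimes> (x \<otimes> rep C)"
        using coset_eq[of "rep ((N1 #> x) \<otimes>\<^bsub>Q\<^esub> C)" "x \<otimes> rep C"] repW[OF xC] repW[OF C] xW by auto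
      then show "[h (rep ((N1 #> x) \<otimes>\<^bsub>Q\<^esub> C)) = h (rep C)] (mod int p)"
        using h_N h_x[OF repW[OF C]] xW repW[OF C] by simp
    qed
    \<comment> \<open>The sum of h compares the star indicators of d and of \<open>\<one>\<close>.
      As F vanishes, they agree modulo p, and the indicator of \<open>\<one>\<close> is 1.\<close>
    also have "(\<Sum>C\<in>carrier Q. h (rep C)) = F d \<one> - K d + K \<one>"
      unfolding h_def F_def K_def sum_subtractf[symmetric] sum.distrib[symmetric]
      using repW by (intro sum.cong) simp_all
    finally have "[F d \<one> - K d + K \<one> = 0] (mod int p)" .
    moreover have "[F d \<one> = 0] (mod int p)" using F0 d by simp
    ultimately have "[(F d \<one> - K d + K \<one>) - F d \<one> = 0 - 0] (mod int p)"
      by (rule cong_diff)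
    then have "[K \<one> - K d = 0] (mod int p)" by simp
    moreover have "inS \<one>" unfolding inS_def using Hv.one_closed U.one_closed by (intro bexI[of _ \<one>]) simp_all
    ultimately have "inS d" using K[OF d] K[of \<one>] prime_p
      by (cases "inS d") (auto simp: cong_0_iff prime_gt_1_nat)
    then obtain t where t: "t \<in> H v" "d \<otimes> t \<in> U" by (auto simp: inS_def)
    then obtain l' n' where ln: "l' \<in> parabolic (link v)" "n' \<in> N1" "d \<otimes> t = l' \<otimes> n'"
      by (auto simp: U_def set_mult_def)
    have cc: "l' \<in> carrier W" "n' \<in> carrier W" "t \<in> carrier W"
      using ln parabolic_carrier[OF L(1)] t by auto
    have "d = (d \<otimes> t) \<otimes> inv t" using d cc by (simp add: m_assoc)
    also have "\<dots> = (l' \<otimes> inv t) \<otimes> (t \<otimes> n' \<otimes> inv t)" unfolding ln(3) using cc by (simp add: m_assoc)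
    finally have d_eq: "d = (l' \<otimes> inv t) \<otimes> (t \<otimes> n' \<otimes> inv t)" .
    have "l' \<otimes> inv t \<in> ?S" using link_mult_H_star[OF v ln(1)] t by simp
    moreover have "t \<otimes> n' \<otimes> inv t \<in> N" using N1.inv_op_closed2[OF cc(3) ln(2)] N1_sub by blast
    ultimately show "d \<in> ?S <#> N" by (subst d_eq) (rule set_multI)
  qed
qed

section \<open>Automorphisms that are inner in all finite \<open>p\<close>-quotients\<close>

definition locally_inner :: "('w \<Rightarrow> 'w) \<Rightarrow> bool"
  where "locally_inner \<phi> \<longleftrightarrow> (\<forall>a\<in>carrier W. \<phi> a \<in> carrier W) \<and>
    (\<forall>N. p_normal p N W \<longrightarrow> (\<exists>w\<in>carrier W. \<forall>a\<in>carrier W. \<exists>n\<in>N. \<phi> a \<otimes> w = w \<otimes> a \<otimes> n))"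

text \<open>No cancellation occurs where two copies of an alternating word meet, so the powers of
  its value can be detected by \<open>alternating_not_mem\<close> again.\<close>

lemma val_concat_replicate:
  assumes v: "v \<in> V" and B: "B \<subseteq> V" and ws: "alternating v N0 B ws"
  shows "alternating v N0 B (concat (replicate k ws))"
    and "val (concat (replicate k ws)) = val ws [^] k"
proof -
  have alt: "alternating v N0 B (concat (replicate k ws))" for k
    using ws by (induction k) simp_all
  then show "alternating v N0 B (concat (replicate k ws))" .
  have c: "val ws \<in> carrier W" by (rule val_carrier[OF v B ws])
  show "val (concat (replicate k ws)) = val ws [^] k"
  proof (induction k)
    case (Suc k)
    then show ?case using val_append[OF v B ws alt] c nat_pow_Suc2 by simp
  qed simp
qed

text \<open>An element of \<open>H v\<close> becomes torsion in a suitable quotient where nontrivial alternating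
  words still have infinite order.\<close>

lemma vertex_image_conjugate_star:
  assumes v: "v \<in> V" and \<phi>: "locally_inner \<phi>" and x: "x \<in> H v" "x \<noteq> \<one>"
  obtains c y where "c \<in> carrier W" "y \<in> parabolic (star v)" "\<phi> x = c \<otimes> y \<otimes> inv c"
proof -
  let ?M = "V - {v}"
  have M: "?M \<subseteq> V" "?M \<subseteq> V - {v}" by auto
  have xW: "x \<in> carrier W" using x v H_carrier by auto
  then have \<phi>x: "\<phi> x \<in> carrier W" using \<phi> by (simp add: locally_inner_def)
  obtain c where c: "c \<in> carrier W" "cyclically_reduced v (inv c \<otimes> \<phi> x \<otimes> c)"
    using cyclic_trichotomy[OF v \<phi>x] by blast
  define y where "y = inv c \<otimes> \<phi> x \<otimes> c"
  have yW: "y \<in> carrier W" unfolding y_def using c \<phi>x by simp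
  have \<phi>x_eq: "\<phi> x = c \<otimes> y \<otimes> inv c" unfolding y_def using c \<phi>x by (simp add: m_assoc)
  have implement: "\<exists>w\<in>carrier W. \<exists>n\<in>N. \<phi> x \<otimes> w = w \<otimes> x \<otimes> n" if "p_normal p N W" for N
    using \<phi> that xW unfolding locally_inner_def by blast
  \<comment> \<open>The retraction onto v would kill \<phi> x, whereas it also maps \<phi> x to a
    conjugate of x modulo N0.\<close>
  have "y \<notin> parabolic ?M"
  proof
    assume y: "y \<in> parabolic ?M"
    obtain N0 where N0: "p_normal p N0 W" "x \<notin> N0" using H_residual[OF v x] by blast
    have vV: "{v} \<subseteq> V" using v by simp
    interpret r: group_hom W W "retr {v}" by (rule retr_group_hom[OF vV])
    interpret N0: normal N0 W using N0(1) by (rule p_normal_imp_normal)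
    have "p_normal p {w \<in> carrier W. retr {v} w \<in> N0} W"
      by (rule p_normal_vimage[OF prime_p is_group N0(1) r.homh])
    then obtain w n where w: "w \<in> carrier W" "n \<in> carrier W" "retr {v} n \<in> N0" "\<phi> x \<otimes> w = w \<otimes> x \<otimes> n"
      using implement by blast
    have "retr {v} y = \<one>" using retr_trivial[of ?M "{v}" y] y v M by auto
    then have "retr {v} (\<phi> x) = \<one>" unfolding \<phi>x_eq using c yW by simp
    moreover have "retr {v} (\<phi> x) \<otimes> retr {v} w = retr {v} w \<otimes> x \<otimes> retr {v} n"
      using arg_cong[OF w(4), of "retr {v}"] w(1,2) \<phi>x xW retr_H[OF vV _ x(1)] by simp
    ultimately have "retr {v} w = retr {v} w \<otimes> (x \<otimes> retr {v} n)"
      using w(1,2) xW by (simp add: m_assoc)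
    then have "x \<otimes> retr {v} n = \<one>"
      using l_cancel[of "retr {v} w" \<one> "x \<otimes> retr {v} n"] w(1,2) xW by simp
    then have "x = inv (retr {v} n)" using w(2) xW by (intro inv_equality[symmetric]) simp_all
    then show False using w N0 by auto
  qed
  moreover have "\<not> (\<exists>ws. ws \<noteq> [] \<and> alternating v {\<one>} ?M ws \<and> y = val ws)"
  proof
    assume "\<exists>ws. ws \<noteq> [] \<and> alternating v {\<one>} ?M ws \<and> y = val ws"
    then obtain ws where ws: "ws \<noteq> []" "alternating v {\<one>} ?M ws" "y = val ws" by blast
    obtain N0 where N0: "p_normal p N0 W" "alternating v N0 ?M ws"
      using avoid_letters[OF v ws(2), of "{}"] by auto
    interpret N0: normal N0 W using N0(1) by (rule p_normal_imp_normal)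
    interpret q: group "W Mod N0" by (rule N0.factorgroup_is_group)
    have fin: "finite (carrier (W Mod N0))"
      using N0(1) by (simp add: p_normal_def finite_p_group_def)
    \<comment> \<open>The exponent is fixed by W / N0 before N is chosen. A fine N contains
      \<open>N0 \<inter> H v\<close> and hence \<open>x [^] k\<close>, but it can still be chosen to
      exclude the k-th power of the word.\<close>
    define k where "k = order (W Mod N0)"
    have "k > 0" unfolding k_def using fin q.order_gt_0_iff_finite by simp
    have "N0 #> (x [^] k) = (N0 #> x) [^]\<^bsub>W Mod N0\<^esub> k"
      using N0.FactGroup_pow[OF xW] by simp
    also have "\<dots> = \<one>\<^bsub>W Mod N0\<^esub>"
      unfolding k_def by (rule q.pow_order_eq_1) (use xW in \<open>auto simp: carrier_FactGroup\<close>)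
    finally have "x [^] k \<in> N0" using rcos_self[OF nat_pow_closed[OF xW] N0.subgroup_axioms, of k] by simp
    moreover have "x [^] k \<in> H v"
      using x subgroup_H[OF v] by (induction k) (simp_all add: subgroup.one_closed subgroup.m_closed)
    ultimately have xk: "x [^] k \<in> N0 \<inter> H v" by blast
    let ?w = "concat (replicate k ws)"
    have alt: "alternating v N0 ?M ?w" and val: "val ?w = y [^] k"
      using val_concat_replicate[OF v M(1) N0(2)] ws by simp_all
    have "?w \<noteq> []" using ws(1) \<open>k > 0\<close> by (cases k) simp_all
    then obtain m g w' where w': "?w = (m, g) # w'" by (cases ?w) auto
    then have g: "g \<in> H v" "g \<notin> N0" "alternating v N0 ?M w'" "m \<in> parabolic ?M"
      using alt by auto
    obtain N where N: "fine v N0 N" "g \<otimes> val w' \<notin> parabolic ?M <#> N"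
      using alternating_not_mem[OF v M(2) residual_parabolic[OF M(1)] N0(1) g(1-3)] by blast
    then have pN: "p_normal p N W" and xkN: "x [^] k \<in> N" using xk by (auto simp: fine_def)
    interpret N: normal N W using pN by (rule p_normal_imp_normal)
    obtain w n where w: "w \<in> carrier W" "n \<in> N" "\<phi> x \<otimes> w = w \<otimes> x \<otimes> n"
      using implement[OF pN] by blast
    have nW: "n \<in> carrier W" using w(2) by simp
    have conj_pow: "(a \<otimes> b \<otimes> inv a) [^] (i::nat) = a \<otimes> b [^] i \<otimes> inv a"
      if "a \<in> carrier W" "b \<in> carrier W" for a b i
      using that by (induction i) (simp_all add: m_assoc)
    have "\<phi> x = (\<phi> x \<otimes> w) \<otimes> inv w" using \<phi>x w(1) by (simp add: m_assoc)
    also have "\<dots> = w \<otimes> (x \<otimes> n) \<otimes> inv w" unfolding w(3) using w(1) nW xW by (simp add: m_assoc)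
    finally have "\<phi> x [^] k = w \<otimes> (x \<otimes> n) [^] k \<otimes> inv w" using w(1) nW xW conj_pow by simp
    moreover have "(x \<otimes> n) [^] k \<in> N"
    proof -
      have "N #> (x \<otimes> n) = N #> x"
      proof -
        have "x \<otimes> n \<in> N #> x"
          using N.rcos_module[OF is_group xW, of "x \<otimes> n"] N.inv_op_closed2[OF xW w(2)] xW nW by simp
        then show ?thesis using repr_independence[OF _ xW N.subgroup_axioms] by simp
      qed
      then have "N #> ((x \<otimes> n) [^] k) = N #> (x [^] k)"
        using N.FactGroup_pow[of "x \<otimes> n" k] N.FactGroup_pow[OF xW, of k] nW xW by simp
      also have "\<dots> = N" by (rule N.rcos_const[OF is_group xkN])
      finally show ?thesis using rcos_self[of "(x \<otimes> n) [^] k" N] nW xW N.subgroup_axioms by simp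
    qed
    ultimately have \<phi>xk: "\<phi> x [^] k \<in> N" using N.inv_op_closed2 w(1) by simp
    have "y [^] k = inv c \<otimes> \<phi> x [^] k \<otimes> c"
      using conj_pow[of "inv c" "\<phi> x" k] c \<phi>x by (simp add: y_def)
    then have "y [^] k \<in> N" using N.inv_op_closed1[OF c(1) \<phi>xk] by simp
    then have "m \<otimes> (g \<otimes> val w') \<in> parabolic ?M <#> N"
      using val w' set_mult_normalI(2)[OF subgroup_parabolic[OF M(1)] N.normal_axioms] by auto
    moreover have "g \<otimes> val w' \<in> carrier W" using H_carrier[OF v g(1)] val_carrier[OF v M(1) g(3)] by simp
    ultimately show False
      using N(2) subgroup_mult_mem_iff(1)[OF subgroup_set_mult_normal[OF subgroup_parabolic[OF M(1)]
          N.normal_axioms], of m "g \<otimes> val w'"] g(4)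
        set_mult_normalI(1)[OF subgroup_parabolic[OF M(1)] N.normal_axioms] by auto
  qed
  ultimately have "y \<in> parabolic (star v)"
    using c(2) by (auto simp: cyclically_reduced_def y_def)
  then show thesis using that c \<phi>x_eq by blast
qed

text \<open>The retractions onto parabolic subgroups descend to the quotient by a retraction-invariant
  \<open>N\<close>, so that translates of star cosets intersect there as they do in \<open>W\<close>, with an
  intersection representative that does not depend on \<open>N\<close>.\<close>

lemma star_cosets_intersection:
  assumes vs: "set vs \<subseteq> V" and c: "\<And>v. v \<in> V \<Longrightarrow> c v \<in> carrier W"
  shows "\<exists>w\<in>carrier W. \<forall>N u. N \<lhd> W \<longrightarrow> (\<forall>A\<subseteq>V. \<forall>n\<in>N. retr A n \<in> N) \<longrightarrow> u \<in> carrier W \<longrightarrow>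
    (\<forall>v\<in>set vs. inv (c v) \<otimes> u \<in> parabolic (star v) <#> N) \<longrightarrow>
    inv w \<otimes> u \<in> parabolic (V \<inter> (\<Inter>v\<in>set vs. star v)) <#> N"
  using vs
proof (induction vs)
  case Nil
  have "inv \<one> \<otimes> u \<in> parabolic V <#> N" if "N \<lhd> W" "u \<in> carrier W" for N u
    using set_mult_normalI(1)[OF subgroup_parabolic[of V] that(1)] that by auto
  then show ?case by (intro bexI[of _ \<one>]) auto
next
  case (Cons v vs)
  define A where "A = V \<inter> (\<Inter>v\<in>set vs. star v)"
  have A: "A \<subseteq> V" "V \<inter> (\<Inter>v\<in>set (v # vs). star v) = star v \<inter> A" by (auto simp: A_def)
  have v: "v \<in> V" "star v \<subseteq> V" using Cons star_subset by auto
  obtain w where w: "w \<in> carrier W" and IH: "\<And>N u. N \<lhd> W \<Longrightarrow> (\<forall>A\<subseteq>V. \<forall>n\<in>N. retr A n \<in> N) \<Longrightarrow>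
    u \<in> carrier W \<Longrightarrow> (\<forall>v\<in>set vs. inv (c v) \<otimes> u \<in> parabolic (star v) <#> N) \<Longrightarrow>
    inv w \<otimes> u \<in> parabolic A <#> N"
    using Cons unfolding A_def by auto
  interpret r: group_hom W W "retr A" by (rule retr_group_hom[OF A(1)])
  have cv: "c v \<in> carrier W" using c v by simp
  \<comment> \<open>Applying the retraction onto A to a n = w^-1 (c v) s k fixes a and sends s into
    the parabolic subgroup of \<open>star v \<inter> A\<close>. Modulo N, a is thus e times such an
    element, and e depends on w and c v only.\<close>
  define e where "e = retr A (inv w \<otimes> c v)"
  have e: "e \<in> carrier W" unfolding e_def using w cv by simp
  have "inv (w \<otimes> e) \<otimes> u \<in> parabolic (star v \<inter> A) <#> N"
    if N: "N \<lhd> W" "\<forall>A\<subseteq>V. \<forall>n\<in>N. retr A n \<in> N" and u: "u \<in> carrier W"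
      and star: "\<forall>v\<in>set (v # vs). inv (c v) \<otimes> u \<in> parabolic (star v) <#> N" for N u
  proof -
    interpret N: normal N W by (rule N(1))
    obtain a n where an: "a \<in> parabolic A" "n \<in> N" "inv w \<otimes> u = a \<otimes> n"
      using IH[OF N u] star by (auto simp: set_mult_def)
    obtain s k where sk: "s \<in> parabolic (star v)" "k \<in> N" "inv (c v) \<otimes> u = s \<otimes> k"
      using star by (auto simp: set_mult_def)
    have cc: "a \<in> carrier W" "n \<in> carrier W" "s \<in> carrier W" "k \<in> carrier W"
      using an sk parabolic_carrier[OF A(1)] parabolic_carrier[OF v(2)] by auto
    have "inv w \<otimes> u = (inv w \<otimes> c v) \<otimes> (inv (c v) \<otimes> u)" using w u cv by (simp add: m_assoc)
    then have "a \<otimes> n = (inv w \<otimes> c v) \<otimes> (s \<otimes> k)" unfolding an(3) sk(3) .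
    then have "retr A (a \<otimes> n) = retr A ((inv w \<otimes> c v) \<otimes> (s \<otimes> k))" by (rule arg_cong)
    then have "a \<otimes> retr A n = e \<otimes> (retr A s \<otimes> retr A k)"
      unfolding e_def using cc w cv retr_id[of A A a] an(1) A(1) by (simp add: retr_mult[OF A(1)])
    then have "a = e \<otimes> (retr A s \<otimes> retr A k) \<otimes> inv (retr A n)"
      using cc e by (metis inv_solve_right r.hom_closed m_closed)
    moreover have "inv (w \<otimes> e) \<otimes> u = inv e \<otimes> (inv w \<otimes> u)"
      using w e u by (simp add: inv_mult_group m_assoc)
    ultimately have "inv (w \<otimes> e) \<otimes> u = retr A s \<otimes> (retr A k \<otimes> inv (retr A n) \<otimes> n)"
      unfolding an(3) using cc e by (simp add: m_assoc)
    moreover have "retr A s \<in> parabolic (star v \<inter> A)" using retr_parabolic[OF v(2) A(1) sk(1)] .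
    moreover have "retr A k \<otimes> inv (retr A n) \<otimes> n \<in> N" using N(2) A(1) sk(2) an(2) by simp
    ultimately show ?thesis using set_multI by metis
  qed
  then show ?case unfolding A(2) using w e by (intro bexI[of _ "w \<otimes> e"]) auto
qed

text \<open>The point is the order of the choices: the conjugators c v are taken in W before any N,
  so the element w built from them serves all quotients, although the elements u that implement
  \<phi> depend on N.\<close>

theorem locally_inner_imp_inner:
  assumes \<phi>: "locally_inner \<phi>"
  obtains w where "w \<in> carrier W" "\<And>a. a \<in> carrier W \<Longrightarrow> \<phi> a = w \<otimes> a \<otimes> inv w"
proof -
  have "\<exists>x c y. x \<in> H v \<and> x \<noteq> \<one> \<and> c \<in> carrier W \<and> y \<in> parabolic (star v) \<and> \<phi> x = c \<otimes> y \<otimes> inv c"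
    if "v \<in> V" for v
    using H_nontrivial[OF that] vertex_image_conjugate_star[OF that \<phi>] by metis
  then obtain x c y where xcy: "\<And>v. v \<in> V \<Longrightarrow> x v \<in> H v \<and> x v \<noteq> \<one> \<and> c v \<in> carrier W \<and>
    y v \<in> parabolic (star v) \<and> \<phi> (x v) = c v \<otimes> y v \<otimes> inv (c v)"
    by metis
  obtain vs where vs: "set vs = V" using finite_V finite_list by blast
  \<comment> \<open>A vertex contained in all stars would be adjacent to every other vertex.\<close>
  have "V \<inter> (\<Inter>v\<in>set vs. star v) = {}"
  proof (intro equals0I)
    fix v assume v: "v \<in> V \<inter> (\<Inter>v\<in>set vs. star v)"
    then obtain u where u: "u \<in> V" "u \<noteq> v" "\<not> adj u v" using no_central by blast
    then have "v \<in> star u" using v vs by blast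
    then show False using u adj_sym by (auto simp: star_def link_def)
  qed
  then obtain w where w: "w \<in> carrier W" and inter: "\<And>N u. N \<lhd> W \<Longrightarrow>
    (\<forall>A\<subseteq>V. \<forall>n\<in>N. retr A n \<in> N) \<Longrightarrow> u \<in> carrier W \<Longrightarrow>
    (\<forall>v\<in>V. inv (c v) \<otimes> u \<in> parabolic (star v) <#> N) \<Longrightarrow> inv w \<otimes> u \<in> {\<one>} <#> N"
    using star_cosets_intersection[of vs c] vs xcy by auto
  have key: "\<exists>n\<in>N. \<phi> a \<otimes> w = w \<otimes> a \<otimes> n" if N: "p_normal p N W" and a: "a \<in> carrier W" for N a
  proof -
    \<comment> \<open>By \<open>retr_retr\<close> this intersection is stable under every
      retraction, and the case A = V shows that it is contained in N.\<close>
    define N1 where "N1 = carrier W \<inter> (\<Inter>A\<in>Pow V. {w \<in> carrier W. retr A w \<in> N})"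
    have pN1: "p_normal p N1 W"
      unfolding N1_def using finite_V
      by (intro p_normal_INT p_normal_vimage[OF _ _ N] prime_p is_group retr_hom) auto
    have N1N: "N1 \<subseteq> N"
    proof
      fix n assume "n \<in> N1"
      then have "n \<in> carrier W" "retr V n \<in> N" by (auto simp: N1_def)
      then show "n \<in> N" using retr_id[of V V n] by simp
    qed
    have N1_retr: "\<forall>A\<subseteq>V. \<forall>n\<in>N1. retr A n \<in> N1"
    proof (intro allI impI ballI)
      fix A n assume A: "A \<subseteq> V" and n: "n \<in> N1"
      have "retr B (retr A n) \<in> N" if "B \<subseteq> V" for B
        using retr_retr[OF A that, of n] n A by (auto simp: N1_def)
      then show "retr A n \<in> N1" using n A retr_carrier by (auto simp: N1_def)
    qed
    have "\<exists>N'. p_normal p N' W \<and> (\<forall>y d n. y \<in> parabolic (star v) \<longrightarrow> d \<in> carrier W \<longrightarrow>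
        n \<in> N' \<longrightarrow> y \<otimes> d = d \<otimes> x v \<otimes> n \<longrightarrow> d \<in> parabolic (star v) <#> N1)" if v: "v \<in> V" for v
      by (rule conjugator_in_star[OF v _ _ pN1, of "x v"]) (use xcy[OF v] in blast)+
    then obtain N' where N': "\<And>v. v \<in> V \<Longrightarrow> p_normal p (N' v) W"
      "\<And>v y d n. v \<in> V \<Longrightarrow> y \<in> parabolic (star v) \<Longrightarrow> d \<in> carrier W \<Longrightarrow>
        n \<in> N' v \<Longrightarrow> y \<otimes> d = d \<otimes> x v \<otimes> n \<Longrightarrow> d \<in> parabolic (star v) <#> N1"
      by metis
    \<comment> \<open>A single element u that implements \<phi> modulo N2 can be used for all
      vertices at once.\<close>
    define N2 where "N2 = N \<inter> (carrier W \<inter> (\<Inter>v\<in>V. N' v))"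
    have "p_normal p N2 W"
      unfolding N2_def by (intro p_normal_Int p_normal_INT prime_p is_group finite_V N N')
    then obtain u where u: "u \<in> carrier W" "\<And>a. a \<in> carrier W \<Longrightarrow> \<exists>n\<in>N2. \<phi> a \<otimes> u = u \<otimes> a \<otimes> n"
      using \<phi> unfolding locally_inner_def by blast
    have "inv (c v) \<otimes> u \<in> parabolic (star v) <#> N1" if v: "v \<in> V" for v
    proof -
      note k = xcy[OF v]
      have kW: "x v \<in> carrier W" "y v \<in> carrier W" "c v \<in> carrier W"
        using k v H_carrier parabolic_carrier[OF star_subset[OF v]] by auto
      obtain n where n: "n \<in> N2" "\<phi> (x v) \<otimes> u = u \<otimes> x v \<otimes> n" using u(2)[OF kW(1)] by blast
      have nW: "n \<in> carrier W" "n \<in> N' v" using n v by (auto simp: N2_def)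
      have "y v \<otimes> (inv (c v) \<otimes> u) = inv (c v) \<otimes> (\<phi> (x v) \<otimes> u)"
        using k kW u by (simp add: m_assoc)
      also have "\<dots> = (inv (c v) \<otimes> u) \<otimes> x v \<otimes> n"
        unfolding n(2) using kW u nW by (simp add: m_assoc)
      finally show ?thesis using N'(2)[OF v, of "y v" _ n] k kW u nW by simp
    qed
    then have "inv w \<otimes> u \<in> {\<one>} <#> N1"
      using inter[OF p_normal_imp_normal[OF pN1] N1_retr u(1)] by blast
    then have "inv w \<otimes> u \<in> N"
      using N1N p_normal_imp_normal[OF pN1] normal_imp_subgroup subgroup.mem_carrier
      by (fastforce simp: set_mult_def)
    interpret N: normal N W using N by (rule p_normal_imp_normal)
    define k where "k = inv w \<otimes> u"
    have k: "k \<in> N" "u = w \<otimes> k" unfolding k_def using \<open>inv w \<otimes> u \<in> N\<close> w u by simp_all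
    obtain n where n: "n \<in> N" "\<phi> a \<otimes> u = u \<otimes> a \<otimes> n" using u(2)[OF a] by (auto simp: N2_def)
    have \<phi>a: "\<phi> a \<in> carrier W" using \<phi> a by (simp add: locally_inner_def)
    have kn: "k \<in> carrier W" "n \<in> carrier W" using k n by auto
    have "\<phi> a \<otimes> w = (\<phi> a \<otimes> u) \<otimes> inv k" using k(2) kn w \<phi>a by (simp add: m_assoc)
    also have "\<dots> = w \<otimes> a \<otimes> ((inv a \<otimes> k \<otimes> a) \<otimes> n \<otimes> inv k)"
      unfolding n(2) unfolding k(2) using kn w a by (simp add: m_assoc)
    finally show ?thesis using N.inv_op_closed1[OF a k(1)] n(1) k(1) by blast
  qed
  have "\<phi> a = w \<otimes> a \<otimes> inv w" if a: "a \<in> carrier W" for a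
  proof (rule ccontr)
    assume neq: "\<phi> a \<noteq> w \<otimes> a \<otimes> inv w"
    have \<phi>a: "\<phi> a \<in> carrier W" using \<phi> a by (simp add: locally_inner_def)
    \<comment> \<open>The equation determines the error z, so z belongs to every normal subgroup of
      p-power index, and residual p-finiteness makes it trivial.\<close>
    define z where "z = inv (w \<otimes> a) \<otimes> (\<phi> a \<otimes> w)"
    have z: "z \<in> carrier W" "\<phi> a \<otimes> w = w \<otimes> a \<otimes> z" unfolding z_def using w a \<phi>a by simp_all
    have "z \<noteq> \<one>"
    proof
      assume "z = \<one>"
      then have "\<phi> a \<otimes> w = w \<otimes> a" using z w a by simp
      then show False using neq w a \<phi>a by (metis inv_solve_right m_closed)
    qed
    then obtain N where N: "p_normal p N W" "z \<notin> N" using residual z by blast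
    obtain n where n: "n \<in> N" "\<phi> a \<otimes> w = w \<otimes> a \<otimes> n" using key[OF N(1) a] by blast
    have "n \<in> carrier W" using n N
      by (meson normal_imp_subgroup p_normal_imp_normal subgroup.mem_carrier)
    then have "n = z" using n z w a by (metis l_cancel m_closed)
    then show False using n N by simp
  qed
  then show thesis using that w by blast
qed

end

section \<open>The universal property of graph products\<close>

definition graph_incl ::
    "'v set \<Rightarrow> 'v set set \<Rightarrow> ('v \<Rightarrow> ('a, 'b) monoid_scheme) \<Rightarrow> 'v \<Rightarrow> 'a \<Rightarrow> ('v \<times> 'a) list set set"
  where "graph_incl V E G v x =
    normal_closure (free_product V G) (commutation_relators V E G) #>\<^bsub>free_product V G\<^esub> fp_incl V G v x"

context
  fixes I :: "'i set" and G :: "'i \<Rightarrow> ('a, 'b) monoid_scheme"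
  assumes groups: "\<And>i. i \<in> I \<Longrightarrow> group (G i)"
begin

text \<open>Words are evaluated letter by letter; the relations \<open>unit\<close> and
  \<open>merge\<close> are respected because each h i is a homomorphism.\<close>

lemma free_product_extend:
  fixes K (structure)
  assumes K: "group K" and h: "\<And>i. i \<in> I \<Longrightarrow> h i \<in> hom (G i) K"
  shows "\<exists>f \<in> hom (free_product I G) K. \<forall>i\<in>I. \<forall>x\<in>carrier (G i). f (fp_incl I G i x) = h i x"
proof -
  interpret K: group K by (rule K)
  define ev where "ev w = foldr (\<lambda>(i, x) y. h i x \<otimes> y) w \<one>" for w
  have ev_simps [simp]: "ev [] = \<one>" "ev ((i, x) # w) = h i x \<otimes> ev w" for i x w
    by (simp_all add: ev_def)
  have hK [simp]: "h i x \<in> carrier K" if "i \<in> I" "x \<in> carrier (G i)" for i x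
    using hom_in_carrier[OF h] that by blast
  have evK: "ev w \<in> carrier K" if "w \<in> fp_words I G" for w
    using that by (induction w) auto
  have ev_append: "ev (u @ w) = ev u \<otimes> ev w" if "u \<in> fp_words I G" "w \<in> fp_words I G" for u w
    using that by (induction u) (auto simp: K.m_assoc evK)
  have ev_rel: "ev u = ev w" if "(u, w) \<in> fp_rel I G" for u w
    using that
  proof (induction rule: fp_rel.induct)
    case (unit us vs i)
    then interpret Gi: group "G i" using groups by blast
    have "h i \<one>\<^bsub>G i\<^esub> = \<one>" using hom_one[OF h[OF unit(3)] Gi.is_group K] .
    then show ?case using unit by (simp add: ev_append evK)
  next
    case (merge us vs i x y)
    then interpret Gi: group "G i" using groups by blast
    show ?case using merge hom_mult[OF h[OF merge(3)] merge(4,5)]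
      by (simp add: ev_append evK K.m_assoc)
  qed simp_all
  define f where "f A = ev (SOME w. w \<in> A)" for A
  have f: "f (fp_rel I G `` {w}) = ev w" if "w \<in> fp_words I G" for w
  proof -
    have "w \<in> fp_rel I G `` {w}" using fp_rel.refl[OF that] by simp
    then have "(SOME u. u \<in> fp_rel I G `` {w}) \<in> fp_rel I G `` {w}" by (rule someI)
    then show ?thesis unfolding f_def using ev_rel by fastforce
  qed
  show ?thesis
  proof (intro bexI ballI)
    show "f \<in> hom (free_product I G) K"
    proof (rule homI)
      fix A assume "A \<in> carrier (free_product I G)"
      then obtain u where u: "u \<in> fp_words I G" "A = fp_rel I G `` {u}"
        by (auto simp: free_product_def elim: quotientE)
      then show "f A \<in> carrier K" by (simp add: f evK)
      fix B assume "B \<in> carrier (free_product I G)"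
      then obtain w where w: "w \<in> fp_words I G" "B = fp_rel I G `` {w}"
        by (auto simp: free_product_def elim: quotientE)
      then show "f (A \<otimes>\<^bsub>free_product I G\<^esub> B) = f A \<otimes> f B"
        using u by (simp add: free_product_mult[OF groups] f ev_append)
    qed
    show "f (fp_incl I G i x) = h i x" if "i \<in> I" "x \<in> carrier (G i)" for i x
      using that by (simp add: fp_incl_def f)
  qed
qed

lemma fp_incl_closed: "i \<in> I \<Longrightarrow> x \<in> carrier (G i) \<Longrightarrow> fp_incl I G i x \<in> carrier (free_product I G)"
  by (rule hom_in_carrier[OF fp_incl_hom[of I G, OF groups]])

lemma free_product_generated:
  "generate (free_product I G) (\<Union>i\<in>I. fp_incl I G i ` carrier (G i)) = carrier (free_product I G)"
proof
  interpret F: group "free_product I G" by (rule group_free_product[OF groups])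
  let ?S = "\<Union>i\<in>I. fp_incl I G i ` carrier (G i)"
  show "generate (free_product I G) ?S \<subseteq> carrier (free_product I G)"
    using fp_incl_closed by (intro F.generate_incl) auto
  have "fp_rel I G `` {w} \<in> generate (free_product I G) ?S" if "w \<in> fp_words I G" for w
    using that
  proof (induction w)
    case Nil
    then show ?case
      using generate.one[of "free_product I G" ?S] by (simp add: free_product_def)
  next
    case (Cons a w)
    obtain i x where a: "a = (i, x)" by force
    then have ix: "i \<in> I" "x \<in> carrier (G i)" "w \<in> fp_words I G" using Cons by auto
    have "fp_rel I G `` {a # w} = fp_incl I G i x \<otimes>\<^bsub>free_product I G\<^esub> fp_rel I G `` {w}"
      using free_product_mult[of I G "[(i, x)]" w, OF groups] ix a by (simp add: fp_incl_def)
    moreover have "fp_incl I G i x \<in> generate (free_product I G) ?S"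
      using ix by (intro generate.incl) auto
    ultimately show ?case using Cons ix by (simp add: generate.eng)
  qed
  then show "carrier (free_product I G) \<subseteq> generate (free_product I G) ?S"
    by (auto simp: free_product_def elim!: quotientE)
qed

end

context
  fixes V :: "'v set" and E :: "'v set set" and G :: "'v \<Rightarrow> ('a, 'b) monoid_scheme"
  assumes groups: "\<And>v. v \<in> V \<Longrightarrow> group (G v)"
begin

lemma vertex_closed: "v \<in> V \<Longrightarrow> x \<in> carrier (G v) \<Longrightarrow> fp_incl V G v x \<in> carrier (free_product V G)"
  by (rule fp_incl_closed[of V G, OF groups])

lemma commutation_relators_closed:
  "commutation_relators V E G \<subseteq> carrier (free_product V G)"
proof -
  interpret F: group "free_product V G" by (rule group_free_product[OF groups])
  show ?thesis
    using vertex_closed unfolding commutation_relators_def by auto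
qed

lemma commutation_closure_normal:
  "normal_closure (free_product V G) (commutation_relators V E G) \<lhd> free_product V G"
  by (rule group.normal_closure_normal[OF group_free_product[OF groups] commutation_relators_closed])

lemma graph_incl_hom:
  assumes "v \<in> V"
  shows "graph_incl V E G v \<in> hom (G v) (graph_product V E G)"
proof -
  interpret N: normal "normal_closure (free_product V G) (commutation_relators V E G)" "free_product V G"
    by (rule commutation_closure_normal)
  show ?thesis
    unfolding graph_product_def graph_incl_def[abs_def]
    using hom_compose[OF fp_incl_hom[OF groups assms] N.r_coset_hom_Mod] by (simp add: o_def)
qed

lemma graph_product_generated:
  "generate (graph_product V E G) (\<Union>v\<in>V. graph_incl V E G v ` carrier (G v)) =
    carrier (graph_product V E G)"
proof -
  let ?NC = "normal_closure (free_product V G) (commutation_relators V E G)"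
  interpret N: normal ?NC "free_product V G" by (rule commutation_closure_normal)
  interpret q: group_hom "free_product V G" "graph_product V E G" "(#>\<^bsub>free_product V G\<^esub>) ?NC"
    unfolding graph_product_def
    using N.r_coset_hom_Mod N.factorgroup_is_group N.is_group
    by (simp add: group_hom_def group_hom_axioms_def)
  let ?S = "\<Union>v\<in>V. fp_incl V G v ` carrier (G v)"
  have "carrier (graph_product V E G) = (#>\<^bsub>free_product V G\<^esub>) ?NC ` carrier (free_product V G)"
    by (simp add: graph_product_def carrier_FactGroup)
  also have "\<dots> = (#>\<^bsub>free_product V G\<^esub>) ?NC ` generate (free_product V G) ?S"
    by (simp only: free_product_generated[of V G, OF groups])
  also have "\<dots> = generate (graph_product V E G) ((#>\<^bsub>free_product V G\<^esub>) ?NC ` ?S)"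
    by (rule q.generate_img[symmetric]) (use vertex_closed in auto)
  also have "(#>\<^bsub>free_product V G\<^esub>) ?NC ` ?S = (\<Union>v\<in>V. graph_incl V E G v ` carrier (G v))"
    by (auto simp: graph_incl_def)
  finally show ?thesis ..
qed

text \<open>Commuting images of adjacent vertex groups kill the commutation relators, so the normal
  closure lies in the kernel of the map on the free product.\<close>

lemma graph_product_extend:
  fixes K (structure)
  assumes K: "group K" and h: "\<And>v. v \<in> V \<Longrightarrow> h v \<in> hom (G v) K"
    and comm: "\<And>u v x y. u \<in> V \<Longrightarrow> v \<in> V \<Longrightarrow> {u, v} \<in> E \<Longrightarrow> x \<in> carrier (G u) \<Longrightarrow>
      y \<in> carrier (G v) \<Longrightarrow> h u x \<otimes> h v y = h v y \<otimes> h u x"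
  shows "\<exists>f \<in> hom (graph_product V E G) K. \<forall>v\<in>V. \<forall>x\<in>carrier (G v). f (graph_incl V E G v x) = h v x"
proof -
  let ?NC = "normal_closure (free_product V G) (commutation_relators V E G)"
  interpret K: group K by (rule K)
  obtain f where f: "f \<in> hom (free_product V G) K"
    "\<And>v x. v \<in> V \<Longrightarrow> x \<in> carrier (G v) \<Longrightarrow> f (fp_incl V G v x) = h v x"
    using free_product_extend[of V G K h, OF groups K h] by auto
  interpret f: group_hom "free_product V G" K f
    using f group_free_product[OF groups] K by (simp add: group_hom_def group_hom_axioms_def)
  have rel: "f r = \<one>" if r: "r \<in> commutation_relators V E G" for r
  proof -
    obtain u v x y where *: "u \<in> V" "v \<in> V" "{u, v} \<in> E" "x \<in> carrier (G u)" "y \<in> carrier (G v)"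
      "r = fp_incl V G u x \<otimes>\<^bsub>free_product V G\<^esub> fp_incl V G v y \<otimes>\<^bsub>free_product V G\<^esub>
        inv\<^bsub>free_product V G\<^esub> fp_incl V G u x \<otimes>\<^bsub>free_product V G\<^esub>
        inv\<^bsub>free_product V G\<^esub> fp_incl V G v y"
      using r unfolding commutation_relators_def by blast
    have c: "fp_incl V G u x \<in> carrier (free_product V G)" "fp_incl V G v y \<in> carrier (free_product V G)"
      using vertex_closed * by auto
    have hc: "h u x \<in> carrier K" "h v y \<in> carrier K" using hom_in_carrier[OF h] * by blast+
    have "f r = h u x \<otimes> h v y \<otimes> inv h u x \<otimes> inv h v y"
      using c f(2) * by simp
    also have "\<dots> = \<one>" unfolding comm[OF *(1-5)] using hc by (simp add: K.m_assoc)
    finally show ?thesis .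
  qed
  have NC: "?NC \<subseteq> kernel (free_product V G) K f"
    unfolding normal_closure_def
  proof (rule f.generate_subgroup_incl[OF _ f.subgroup_kernel], safe)
    fix g s assume g: "g \<in> carrier (free_product V G)" and s: "s \<in> commutation_relators V E G"
    have "s \<in> carrier (free_product V G)" using s commutation_relators_closed by (rule rev_subsetD)
    then show "g \<otimes>\<^bsub>free_product V G\<^esub> s \<otimes>\<^bsub>free_product V G\<^esub> inv\<^bsub>free_product V G\<^esub> g
        \<in> kernel (free_product V G) K f"
      using rel[OF s] g by (simp add: kernel_def)
  qed
  show ?thesis
  proof (rule f.FactGroup_universal_kernel[OF commutation_closure_normal NC])
    fix f' assume f': "f' \<in> hom (free_product V G Mod ?NC) K"
      "\<And>x. x \<in> carrier (free_product V G) \<Longrightarrow> f' (?NC #>\<^bsub>free_product V G\<^esub> x) = f x"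
    show ?thesis
    proof (intro bexI ballI)
      fix v x assume "v \<in> V" "x \<in> carrier (G v)"
      then show "f' (graph_incl V E G v x) = h v x"
        unfolding graph_incl_def using f'(2)[OF vertex_closed] f(2) by simp
    qed (simp add: graph_product_def f'(1))
  qed
qed

lemma graph_incl_commute:
  assumes uv: "u \<in> V" "v \<in> V" "{u, v} \<in> E" and x: "x \<in> carrier (G u)" and y: "y \<in> carrier (G v)"
  shows "graph_incl V E G u x \<otimes>\<^bsub>graph_product V E G\<^esub> graph_incl V E G v y =
    graph_incl V E G v y \<otimes>\<^bsub>graph_product V E G\<^esub> graph_incl V E G u x"
proof -
  let ?F = "free_product V G"
  let ?NC = "normal_closure ?F (commutation_relators V E G)"
  interpret N: normal ?NC ?F by (rule commutation_closure_normal)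
  let ?a = "fp_incl V G u x" and ?b = "fp_incl V G v y"
  have c: "?a \<in> carrier ?F" "?b \<in> carrier ?F" using vertex_closed uv x y by auto
  let ?r = "?a \<otimes>\<^bsub>?F\<^esub> ?b \<otimes>\<^bsub>?F\<^esub> inv\<^bsub>?F\<^esub> ?a \<otimes>\<^bsub>?F\<^esub> inv\<^bsub>?F\<^esub> ?b"
  have "?r \<in> commutation_relators V E G"
    unfolding commutation_relators_def using uv x y by blast
  then have "\<one>\<^bsub>?F\<^esub> \<otimes>\<^bsub>?F\<^esub> ?r \<otimes>\<^bsub>?F\<^esub> inv\<^bsub>?F\<^esub> \<one>\<^bsub>?F\<^esub> \<in> ?NC"
    unfolding normal_closure_def using N.one_closed
    by (intro generate.incl CollectI exI[of _ "\<one>\<^bsub>?F\<^esub>"] exI[of _ ?r]) simp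
  then have "?r \<in> ?NC" using c by simp
  then have "?r \<otimes>\<^bsub>?F\<^esub> (?b \<otimes>\<^bsub>?F\<^esub> ?a) \<in> ?NC #>\<^bsub>?F\<^esub> (?b \<otimes>\<^bsub>?F\<^esub> ?a)"
    using c by (intro N.rcosI N.subset) simp_all
  moreover have "?r \<otimes>\<^bsub>?F\<^esub> (?b \<otimes>\<^bsub>?F\<^esub> ?a) = ?a \<otimes>\<^bsub>?F\<^esub> ?b" using c by (simp add: N.m_assoc)
  ultimately have "?a \<otimes>\<^bsub>?F\<^esub> ?b \<in> ?NC #>\<^bsub>?F\<^esub> (?b \<otimes>\<^bsub>?F\<^esub> ?a)" by (rule subst[rotated])
  then have "?NC #>\<^bsub>?F\<^esub> (?b \<otimes>\<^bsub>?F\<^esub> ?a) = ?NC #>\<^bsub>?F\<^esub> (?a \<otimes>\<^bsub>?F\<^esub> ?b)"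
    by (rule N.repr_independence) (simp_all add: c N.subgroup_axioms)
  then show ?thesis
    using c by (simp add: graph_incl_def graph_product_def N.rcos_sum)
qed

end

section \<open>Regular wreath products with a cyclic group of order \<open>p\<close>\<close>

text \<open>The arguments are arranged so that the second component of a homomorphism into this
  group satisfies the cocycle identity of \<open>twist\<close>. Residues are stored as integers from
  0 to p - 1 and functions are extensional, so that equality of elements is equality on Q and the
  carrier is finite for finite Q.\<close>

definition p_wreath :: "nat \<Rightarrow> ('q, 'x) monoid_scheme \<Rightarrow> ('q \<times> ('q \<Rightarrow> int)) monoid"
  where "p_wreath p Q =
    \<lparr>carrier = carrier Q \<times> (carrier Q \<rightarrow>\<^sub>E {0..<int p}),
     monoid.mult = (\<lambda>(a, f) (b, g). (a \<otimes>\<^bsub>Q\<^esub> b, \<lambda>c\<in>carrier Q. (f (b \<otimes>\<^bsub>Q\<^esub> c) + g c) mod int p)),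
     one = (\<one>\<^bsub>Q\<^esub>, \<lambda>c\<in>carrier Q. 0)\<rparr>"

lemma p_wreath_mult:
  "(a, f) \<otimes>\<^bsub>p_wreath p Q\<^esub> (b, g) = (a \<otimes>\<^bsub>Q\<^esub> b, \<lambda>c\<in>carrier Q. (f (b \<otimes>\<^bsub>Q\<^esub> c) + g c) mod int p)"
  by (simp add: p_wreath_def)

lemma group_p_wreath:
  fixes Q (structure)
  assumes "group Q" "p > 0"
  shows "group (p_wreath p Q)"
proof (rule groupI)
  interpret Q: group Q by fact
  fix x assume "x \<in> carrier (p_wreath p Q)"
  then obtain a f where x: "x = (a, f)" "a \<in> carrier Q" "f \<in> carrier Q \<rightarrow>\<^sub>E {0..<int p}"
    unfolding p_wreath_def by (cases x) simp
  show "\<one>\<^bsub>p_wreath p Q\<^esub> \<otimes>\<^bsub>p_wreath p Q\<^esub> x = x"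
    using x by (auto simp: p_wreath_def fun_eq_iff PiE_iff extensional_def)
  let ?y = "(inv a, \<lambda>c\<in>carrier Q. (- f (inv a \<otimes> c)) mod int p)"
  have "?y \<in> carrier (p_wreath p Q)" using x assms by (auto simp: p_wreath_def)
  moreover have "?y \<otimes>\<^bsub>p_wreath p Q\<^esub> x = \<one>\<^bsub>p_wreath p Q\<^esub>"
    using x assms by (auto simp: p_wreath_def fun_eq_iff mod_add_left_eq)
  ultimately show "\<exists>y\<in>carrier (p_wreath p Q). y \<otimes>\<^bsub>p_wreath p Q\<^esub> x = \<one>\<^bsub>p_wreath p Q\<^esub>" by blast
  fix y assume "y \<in> carrier (p_wreath p Q)"
  then obtain b g where y: "y = (b, g)" "b \<in> carrier Q" "g \<in> carrier Q \<rightarrow>\<^sub>E {0..<int p}"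
    unfolding p_wreath_def by (cases y) simp
  show "x \<otimes>\<^bsub>p_wreath p Q\<^esub> y \<in> carrier (p_wreath p Q)"
    using x y assms by (auto simp: p_wreath_def)
  fix z assume "z \<in> carrier (p_wreath p Q)"
  then obtain d h where z: "z = (d, h)" "d \<in> carrier Q" "h \<in> carrier Q \<rightarrow>\<^sub>E {0..<int p}"
    unfolding p_wreath_def by (cases z) simp
  show "x \<otimes>\<^bsub>p_wreath p Q\<^esub> y \<otimes>\<^bsub>p_wreath p Q\<^esub> z = x \<otimes>\<^bsub>p_wreath p Q\<^esub> (y \<otimes>\<^bsub>p_wreath p Q\<^esub> z)"
    using x y z by (auto simp: p_wreath_mult fun_eq_iff Q.m_assoc mod_simps add.assoc)
qed (use assms in \<open>auto simp: p_wreath_def group.is_monoid\<close>)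

lemma finite_p_group_p_wreath:
  assumes "finite_p_group p Q" "p > 0"
  shows "finite_p_group p (p_wreath p Q)"
proof -
  obtain n where n: "order Q = p ^ n" "finite (carrier Q)" "group Q"
    using assms by (auto simp: finite_p_group_def)
  have "order (p_wreath p Q) = p ^ n * p ^ card (carrier Q)"
    using n by (simp add: order_def p_wreath_def card_cartesian_product card_PiE)
  then have "order (p_wreath p Q) = p ^ (n + card (carrier Q))"
    by (simp add: power_add)
  moreover have "finite (carrier (p_wreath p Q))"
    using n by (simp add: p_wreath_def finite_PiE)
  ultimately show ?thesis
    unfolding finite_p_group_def using group_p_wreath[OF n(3) assms(2)] by blast
qed

section \<open>Graph products admit retractions and twists\<close>

context
  fixes p :: nat and V :: "'v set" and E :: "'v set set" and G :: "'v \<Rightarrow> ('a, 'b) monoid_scheme"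
  assumes prime: "Factorial_Ring.prime p"
    and graph: "simplicial_graph V E"
    and groups: "\<And>v. v \<in> V \<Longrightarrow> group (G v)"
begin

private abbreviation (input) W where "W \<equiv> graph_product V E G"
private abbreviation (input) \<iota> where "\<iota> \<equiv> graph_incl V E G"

lemma edge_neq: "{u, v} \<in> E \<Longrightarrow> u \<noteq> v"
  using graph by (auto simp: simplicial_graph_def)

lemma group_W: "group W"
  by (rule group_graph_product[OF groups])

lemma graph_incl_closed: "v \<in> V \<Longrightarrow> x \<in> carrier (G v) \<Longrightarrow> \<iota> v x \<in> carrier W"
  by (rule hom_in_carrier[OF graph_incl_hom[of V G, OF groups]])

lemma graph_product_retraction:
  assumes "A \<subseteq> V"
  shows "\<exists>f \<in> hom W W. (\<forall>v\<in>A. \<forall>x\<in>\<iota> v ` carrier (G v). f x = x) \<and>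
    (\<forall>v\<in>V - A. \<forall>x\<in>\<iota> v ` carrier (G v). f x = \<one>\<^bsub>W\<^esub>)"
proof -
  interpret W: group W by (rule group_W)
  define h where "h v x = (if v \<in> A then \<iota> v x else \<one>\<^bsub>W\<^esub>)" for v x
  have "h v \<in> hom (G v) W" if "v \<in> V" for v
  proof (cases "v \<in> A")
    case True
    then have "h v = \<iota> v" by (simp add: h_def fun_eq_iff)
    then show ?thesis using graph_incl_hom[of V G, OF groups that] by simp
  qed (simp add: h_def hom_def)
  moreover have "h u x \<otimes>\<^bsub>W\<^esub> h v y = h v y \<otimes>\<^bsub>W\<^esub> h u x"
    if "u \<in> V" "v \<in> V" "{u, v} \<in> E" "x \<in> carrier (G u)" "y \<in> carrier (G v)" for u v x y
    using that graph_incl_commute[of V G u v E x y, OF groups] graph_incl_closed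
    by (simp add: h_def)
  ultimately obtain f where f: "f \<in> hom W W" "\<forall>v\<in>V. \<forall>x\<in>carrier (G v). f (\<iota> v x) = h v x"
    using graph_product_extend[of V G W h E, OF groups group_W] by blast
  then show ?thesis using assms by (intro bexI[of _ f]) (auto simp: h_def)
qed

text \<open>This map shows that \<open>G v\<close> embeds in the graph product, and pulling back
  along it turns finite p-quotients of \<open>G v\<close> into finite p-quotients of the graph
  product.\<close>

lemma graph_product_vertex_retraction:
  assumes v: "v \<in> V"
  shows "\<exists>f \<in> hom W (G v). \<forall>x\<in>carrier (G v). f (\<iota> v x) = x"
proof -
  interpret Gv: group "G v" by (rule groups[OF v])
  define h where "h u x = (if u = v then x else \<one>\<^bsub>G v\<^esub>)" for u x
  have "h u \<in> hom (G u) (G v)" if "u \<in> V" for u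
    by (cases "u = v") (auto simp: h_def hom_def)
  moreover have "h u x \<otimes>\<^bsub>G v\<^esub> h w y = h w y \<otimes>\<^bsub>G v\<^esub> h u x"
    if "u \<in> V" "w \<in> V" "{u, w} \<in> E" "x \<in> carrier (G u)" "y \<in> carrier (G w)" for u w x y
    using that edge_neq[OF that(3)] by (auto simp: h_def)
  ultimately obtain f where f: "f \<in> hom W (G v)" "\<forall>u\<in>V. \<forall>x\<in>carrier (G u). f (\<iota> u x) = h u x"
    using graph_product_extend[of V G "G v" h E, OF groups Gv.is_group] by blast
  then show ?thesis using v by (intro bexI[of _ f]) (auto simp: h_def)
qed

text \<open>The cocycle is read off from a homomorphism to the wreath product of \<open>W / N\<close> with a cyclic
  group of order \<open>p\<close> that conjugates the copy of \<open>G v\<close> by the indicator function of \<open>U\<close>.\<close>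

lemma graph_product_twist:
  assumes v: "v \<in> V" and N: "p_normal p N W" and U: "U \<subseteq> carrier W"
    and U_N: "\<And>n c. n \<in> N \<Longrightarrow> c \<in> carrier W \<Longrightarrow> n \<otimes>\<^bsub>W\<^esub> c \<in> U \<longleftrightarrow> c \<in> U"
    and U_link: "\<And>u l c. u \<in> V \<Longrightarrow> {u, v} \<in> E \<Longrightarrow> l \<in> \<iota> u ` carrier (G u) \<Longrightarrow> c \<in> carrier W \<Longrightarrow>
      l \<otimes>\<^bsub>W\<^esub> c \<in> U \<longleftrightarrow> c \<in> U"
  shows "\<exists>N' e. p_normal p N' W \<and> N' \<subseteq> N \<and> (\<forall>u\<in>V. N \<inter> \<iota> u ` carrier (G u) \<subseteq> N') \<and>
    (\<forall>a\<in>carrier W. \<forall>b\<in>carrier W. \<forall>c\<in>carrier W.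
      [e (a \<otimes>\<^bsub>W\<^esub> b) c = e b c + e a (b \<otimes>\<^bsub>W\<^esub> c)] (mod int p)) \<and>
    (\<forall>u\<in>V - {v}. \<forall>x\<in>\<iota> u ` carrier (G u). \<forall>c\<in>carrier W. [e x c = 0] (mod int p)) \<and>
    (\<forall>x\<in>\<iota> v ` carrier (G v). \<forall>c\<in>carrier W.
      [e x c = of_bool (x \<otimes>\<^bsub>W\<^esub> c \<in> U) - of_bool (c \<in> U)] (mod int p)) \<and>
    (\<forall>n\<in>N'. \<forall>c\<in>carrier W. [e n c = 0] (mod int p)) \<and>
    (\<forall>n\<in>N. \<forall>a\<in>carrier W. \<forall>c\<in>carrier W. e a (n \<otimes>\<^bsub>W\<^esub> c) = e a c)"
proof -
  have p0: "p > 0" using prime by (rule prime_gt_0_nat)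
  interpret W: group W by (rule group_W)
  interpret N: normal N W using N by (rule p_normal_imp_normal)
  let ?Q = "W Mod N"
  interpret Q: group ?Q by (rule N.factorgroup_is_group)
  define q where "q c = N #>\<^bsub>W\<^esub> c" for c
  interpret q: group_hom W ?Q q
    unfolding q_def[abs_def] using N.r_coset_hom_Mod
    by (simp add: group_hom_def group_hom_axioms_def W.is_group Q.is_group)
  note mult_FactGroup [simp del] one_FactGroup [simp del]
  have carrier_Q: "carrier ?Q = q ` carrier W" by (simp add: carrier_FactGroup q_def)
  let ?K = "p_wreath p ?Q"
  have K: "group ?K" "finite_p_group p ?K"
    using group_p_wreath[OF Q.is_group p0] finite_p_group_p_wreath[OF p_normal_imp_finite_p_group[OF N] p0]
    by simp_all
  define U' where "U' = q ` U"
  have U': "q c \<in> U' \<longleftrightarrow> c \<in> U" if c: "c \<in> carrier W" for c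
  proof
    assume "q c \<in> U'"
    then obtain d where d: "d \<in> U" "q c = q d" by (auto simp: U'_def)
    then have "d \<in> carrier W" using U by auto
    then have "c \<in> N #>\<^bsub>W\<^esub> d" using d(2) W.rcos_self[OF c N.subgroup_axioms] by (simp add: q_def)
    then obtain n where "n \<in> N" "c = n \<otimes>\<^bsub>W\<^esub> d" by (auto simp: r_coset_def)
    then show "c \<in> U" using U_N d(1) \<open>d \<in> carrier W\<close> by simp
  qed (simp add: U'_def)
  \<comment> \<open>In the wreath product, conjugating the pair of q x and the zero function by the
    indicator of U' gives the second component \<open>ind x\<close>. As a coboundary it makes h
    multiplicative on \<open>G v\<close>.\<close>
  define ind where "ind x = (\<lambda>C\<in>carrier ?Q.
    (of_bool (q x \<otimes>\<^bsub>?Q\<^esub> C \<in> U') - of_bool (C \<in> U') :: int) mod int p)" for x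
  define h where "h u x = (q (\<iota> u x), if u = v then ind (\<iota> u x) else (\<lambda>C\<in>carrier ?Q. 0))" for u x
  have \<iota>_mult: "\<iota> u (x \<otimes>\<^bsub>G u\<^esub> y) = \<iota> u x \<otimes>\<^bsub>W\<^esub> \<iota> u y"
    if "u \<in> V" "x \<in> carrier (G u)" "y \<in> carrier (G u)" for u x y
    using hom_mult[OF graph_incl_hom[of V G, OF groups that(1)] that(2,3)] .
  have h_hom: "h u \<in> hom (G u) ?K" if u: "u \<in> V" for u
  proof (rule homI)
    fix x assume x: "x \<in> carrier (G u)"
    note xW = graph_incl_closed[OF u x]
    show "h u x \<in> carrier ?K" using xW p0 by (auto simp: h_def p_wreath_def ind_def)
    fix y assume y: "y \<in> carrier (G u)"
    note yW = graph_incl_closed[OF u y]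
    show "h u (x \<otimes>\<^bsub>G u\<^esub> y) = h u x \<otimes>\<^bsub>?K\<^esub> h u y"
    proof (cases "u = v")
      case True
      have "ind (\<iota> u x \<otimes>\<^bsub>W\<^esub> \<iota> u y) C = (ind (\<iota> u x) (q (\<iota> u y) \<otimes>\<^bsub>?Q\<^esub> C) + ind (\<iota> u y) C) mod int p"
        if "C \<in> carrier ?Q" for C
        using that xW yW by (simp add: ind_def mod_simps Q.m_assoc)
      moreover have "ind z C = undefined" if "C \<notin> carrier ?Q" for z C
        using that by (simp add: ind_def)
      ultimately show ?thesis
        using True u x y xW yW by (auto simp: h_def p_wreath_mult \<iota>_mult fun_eq_iff)
    next
      case False
      then show ?thesis using u x y xW yW by (auto simp: h_def p_wreath_mult \<iota>_mult fun_eq_iff)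
    qed
  qed
  \<comment> \<open>This is the compatibility needed at an edge between u and v: z and l commute and
    U is invariant under l, so shifting the argument by l leaves the coboundary unchanged.\<close>
  have link_ind: "ind z (q l \<otimes>\<^bsub>?Q\<^esub> C) = ind z C"
    if l: "l \<in> carrier W" "\<And>c. c \<in> carrier W \<Longrightarrow> l \<otimes>\<^bsub>W\<^esub> c \<in> U \<longleftrightarrow> c \<in> U"
      and z: "z \<in> carrier W" "z \<otimes>\<^bsub>W\<^esub> l = l \<otimes>\<^bsub>W\<^esub> z" and C: "C \<in> carrier ?Q" for l z C
  proof -
    obtain c where c: "c \<in> carrier W" "C = q c" using C by (auto simp: carrier_Q)
    have "z \<otimes>\<^bsub>W\<^esub> (l \<otimes>\<^bsub>W\<^esub> c) = l \<otimes>\<^bsub>W\<^esub> (z \<otimes>\<^bsub>W\<^esub> c)"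
      using l z c by (metis W.m_assoc)
    then have "z \<otimes>\<^bsub>W\<^esub> (l \<otimes>\<^bsub>W\<^esub> c) \<in> U \<longleftrightarrow> z \<otimes>\<^bsub>W\<^esub> c \<in> U" using l z c by simp
    then show ?thesis
      using c l z U'[of "z \<otimes>\<^bsub>W\<^esub> (l \<otimes>\<^bsub>W\<^esub> c)"] U'[of "z \<otimes>\<^bsub>W\<^esub> c"] U'[of "l \<otimes>\<^bsub>W\<^esub> c"] U'[of c]
      by (simp add: ind_def)
  qed
  have h_v: "h u x \<otimes>\<^bsub>?K\<^esub> h v y = h v y \<otimes>\<^bsub>?K\<^esub> h u x"
    if uv: "u \<in> V" "{u, v} \<in> E" and x: "x \<in> carrier (G u)" and y: "y \<in> carrier (G v)" for u x y
  proof -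
    note xW = graph_incl_closed[OF uv(1) x] and yW = graph_incl_closed[OF v y]
    have comm: "\<iota> u x \<otimes>\<^bsub>W\<^esub> \<iota> v y = \<iota> v y \<otimes>\<^bsub>W\<^esub> \<iota> u x"
      by (rule graph_incl_commute[of V G u v E x y, OF groups uv(1) v uv(2) x y])
    then have "q (\<iota> u x) \<otimes>\<^bsub>?Q\<^esub> q (\<iota> v y) = q (\<iota> v y) \<otimes>\<^bsub>?Q\<^esub> q (\<iota> u x)"
      using q.hom_mult[OF xW yW] q.hom_mult[OF yW xW] by simp
    moreover have "ind (\<iota> v y) (q (\<iota> u x) \<otimes>\<^bsub>?Q\<^esub> C) = ind (\<iota> v y) C" if "C \<in> carrier ?Q" for C
      by (rule link_ind[OF xW _ yW comm[symmetric] that]) (use U_link uv x in blast)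
    moreover have "ind z C mod int p = ind z C" if "C \<in> carrier ?Q" for z C
      using that by (simp add: ind_def)
    ultimately show ?thesis
      using edge_neq[OF uv(2)] xW yW by (auto simp: h_def p_wreath_mult fun_eq_iff ind_def)
  qed
  have h_comm: "h u x \<otimes>\<^bsub>?K\<^esub> h w y = h w y \<otimes>\<^bsub>?K\<^esub> h u x"
    if uw: "u \<in> V" "w \<in> V" "{u, w} \<in> E" and x: "x \<in> carrier (G u)" and y: "y \<in> carrier (G w)" for u w x y
  proof -
    consider "w = v" | "u = v" | "u \<noteq> v" "w \<noteq> v" by blast
    then show ?thesis
    proof cases
      case 1
      then show ?thesis using h_v[of u x y] uw x y by simp
    next
      case 2
      then show ?thesis using h_v[of w y x] uw x y by (simp add: insert_commute)
    next
      case 3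
      note xW = graph_incl_closed[OF uw(1) x] and yW = graph_incl_closed[OF uw(2) y]
      have "\<iota> u x \<otimes>\<^bsub>W\<^esub> \<iota> w y = \<iota> w y \<otimes>\<^bsub>W\<^esub> \<iota> u x"
        by (rule graph_incl_commute[of V G u w E x y, OF groups uw x y])
      then have "q (\<iota> u x) \<otimes>\<^bsub>?Q\<^esub> q (\<iota> w y) = q (\<iota> w y) \<otimes>\<^bsub>?Q\<^esub> q (\<iota> u x)"
        using q.hom_mult[OF xW yW] q.hom_mult[OF yW xW] by simp
      then show ?thesis using 3 xW yW by (simp add: h_def p_wreath_mult fun_eq_iff)
    qed
  qed
  obtain F where F: "F \<in> hom W ?K" "\<And>u x. u \<in> V \<Longrightarrow> x \<in> carrier (G u) \<Longrightarrow> F (\<iota> u x) = h u x"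
    using graph_product_extend[of V G ?K h E, OF groups K(1) h_hom h_comm] by auto
  interpret F: group_hom W ?K F
    using F(1) K(1) W.is_group by (simp add: group_hom_def group_hom_axioms_def)
  have fst_hom: "fst \<in> hom ?K ?Q" by (auto simp: hom_def p_wreath_def)
  have fst_F: "fst (F a) = q a" if "a \<in> carrier W" for a
  proof -
    have "(fst \<circ> F) a = q a"
    proof (rule W.hom_eq_on_generate[OF Q.is_group hom_compose[OF F(1) fst_hom] q.homh])
      show "(\<Union>u\<in>V. \<iota> u ` carrier (G u)) \<subseteq> carrier W" using graph_incl_closed by auto
      show "a \<in> generate W (\<Union>u\<in>V. \<iota> u ` carrier (G u))"
        using that by (simp only: graph_product_generated[of V G, OF groups])
    qed (auto simp: F(2) h_def)
    then show ?thesis by simp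
  qed
  \<comment> \<open>Since the first component of F is q, the multiplication rule of the wreath
    product is the cocycle identity for e. Evaluating at q c makes e a function on W / N in its
    second argument.\<close>
  define e where "e a c = snd (F a) (q c)" for a c
  let ?N' = "kernel W ?K F"
  have pN': "p_normal p ?N' W" by (rule p_normal_kernel[OF prime W.is_group K(2) F(1)])
  have sub: "?N' \<subseteq> N"
  proof
    fix n assume n: "n \<in> ?N'"
    then have nW: "n \<in> carrier W" and "F n = \<one>\<^bsub>?K\<^esub>" by (auto simp: kernel_def)
    then have "q n = N" using fst_F[OF nW] by (simp add: p_wreath_def one_FactGroup)
    then show "n \<in> N" using W.rcos_self[OF nW N.subgroup_axioms] by (simp add: q_def)
  qed
  \<comment> \<open>A vertex element of N has trivial first component, and then the two indicator
    values in \<open>ind\<close> coincide.\<close>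
  have meets: "N \<inter> \<iota> u ` carrier (G u) \<subseteq> ?N'" if u: "u \<in> V" for u
  proof
    fix n assume "n \<in> N \<inter> \<iota> u ` carrier (G u)"
    then obtain x where x: "x \<in> carrier (G u)" "n = \<iota> u x" "n \<in> N" by auto
    have qn: "q n = \<one>\<^bsub>?Q\<^esub>" using N.rcos_const[OF W.is_group x(3)] by (simp add: q_def one_FactGroup)
    have "F n = (q n, if u = v then ind n else (\<lambda>C\<in>carrier ?Q. 0))"
      using F(2)[OF u x(1)] x(2) by (simp add: h_def)
    also have "ind n = (\<lambda>C\<in>carrier ?Q. 0)"
      unfolding ind_def qn by (rule restrict_ext) simp
    finally have "F n = \<one>\<^bsub>?K\<^esub>" using qn by (simp add: p_wreath_def del: restrict_apply)
    then show "n \<in> ?N'" using graph_incl_closed[OF u x(1)] x(2) by (simp add: kernel_def)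
  qed
  have cocycle: "[e (a \<otimes>\<^bsub>W\<^esub> b) c = e b c + e a (b \<otimes>\<^bsub>W\<^esub> c)] (mod int p)"
    if abc: "a \<in> carrier W" "b \<in> carrier W" "c \<in> carrier W" for a b c
  proof -
    have "F (a \<otimes>\<^bsub>W\<^esub> b) = (q a, snd (F a)) \<otimes>\<^bsub>?K\<^esub> (q b, snd (F b))"
      using abc fst_F by (metis F.hom_mult prod.collapse)
    then have "snd (F (a \<otimes>\<^bsub>W\<^esub> b)) (q c) = (snd (F a) (q b \<otimes>\<^bsub>?Q\<^esub> q c) + snd (F b) (q c)) mod int p"
      using abc by (simp add: p_wreath_mult)
    then show ?thesis
      using abc by (simp add: e_def cong_def add.commute)
  qed
  have vanish: "[e x c = 0] (mod int p)"
    if "u \<in> V - {v}" "x \<in> \<iota> u ` carrier (G u)" "c \<in> carrier W" for u x c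
    using that F(2) by (auto simp: e_def h_def)
  have indicator: "[e x c = of_bool (x \<otimes>\<^bsub>W\<^esub> c \<in> U) - of_bool (c \<in> U)] (mod int p)"
    if x: "x \<in> \<iota> v ` carrier (G v)" and c: "c \<in> carrier W" for x c
  proof -
    obtain g where g: "g \<in> carrier (G v)" "x = \<iota> v g" using x by auto
    have xW: "x \<in> carrier W" using graph_incl_closed[OF v g(1)] g by simp
    have "e x c = (of_bool (q x \<otimes>\<^bsub>?Q\<^esub> q c \<in> U') - of_bool (q c \<in> U')) mod int p"
      using F(2)[OF v g(1)] g(2) c by (simp add: e_def h_def ind_def)
    also have "q x \<otimes>\<^bsub>?Q\<^esub> q c = q (x \<otimes>\<^bsub>W\<^esub> c)" using xW c by (simp)
    also have "(of_bool (q (x \<otimes>\<^bsub>W\<^esub> c) \<in> U') - of_bool (q c \<in> U') :: int) =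
        of_bool (x \<otimes>\<^bsub>W\<^esub> c \<in> U) - of_bool (c \<in> U)"
      using U'[of "x \<otimes>\<^bsub>W\<^esub> c"] U'[OF c] xW c by (simp del: q.hom_mult)
    finally show ?thesis by (simp add: cong_def)
  qed
  have kern: "[e n c = 0] (mod int p)" if "n \<in> ?N'" "c \<in> carrier W" for n c
    using that by (simp add: e_def kernel_def p_wreath_def)
  have invar: "e a (n \<otimes>\<^bsub>W\<^esub> c) = e a c" if n: "n \<in> N" "c \<in> carrier W" for n a c
  proof -
    have "n \<otimes>\<^bsub>W\<^esub> c \<in> N #>\<^bsub>W\<^esub> c" using n by (auto simp: r_coset_def)
    then have "q (n \<otimes>\<^bsub>W\<^esub> c) = q c"
      using W.repr_independence[OF _ n(2) N.subgroup_axioms] by (simp add: q_def)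
    then show ?thesis by (simp add: e_def)
  qed
  show ?thesis
    by (intro exI[of _ ?N'] exI[of _ e] conjI ballI;
      (rule pN' sub meets cocycle vanish indicator kern invar; assumption))
qed

lemma twistable_graph_product:
  assumes "finite V" "\<not> (\<exists>v. central_vertex V E v)"
    and "\<And>v. v \<in> V \<Longrightarrow> carrier (G v) \<noteq> {\<one>\<^bsub>G v\<^esub>}"
    and "\<And>v. v \<in> V \<Longrightarrow> residually_p_finite p (G v)"
  shows "twistable_product W p V (\<lambda>u v. {u, v} \<in> E) (\<lambda>v. \<iota> v ` carrier (G v))"
proof -
  interpret W: group W by (rule group_W)
  have separate: "\<iota> v x \<noteq> \<one>\<^bsub>W\<^esub>" "\<exists>N. p_normal p N W \<and> \<iota> v x \<notin> N"
    if v: "v \<in> V" and x: "x \<in> carrier (G v)" "x \<noteq> \<one>\<^bsub>G v\<^esub>" for v x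
  proof -
    obtain f where f: "f \<in> hom W (G v)" "\<forall>x\<in>carrier (G v). f (\<iota> v x) = x"
      using graph_product_vertex_retraction[OF v] by blast
    show "\<iota> v x \<noteq> \<one>\<^bsub>W\<^esub>" using f x hom_one[OF f(1) group_W groups[OF v]] by auto
    obtain N where N: "p_normal p N (G v)" "x \<notin> N"
      using assms(4)[OF v] x unfolding residually_p_finite_def p_normal_def by blast
    have "p_normal p {w \<in> carrier W. f w \<in> N} W"
      by (rule p_normal_vimage[OF prime group_W N(1) f(1)])
    then show "\<exists>N. p_normal p N W \<and> \<iota> v x \<notin> N" using f(2) N(2) x by force
  qed
  show ?thesis
  proof (intro twistable_product.intro twistable_product_axioms.intro group_W)
    show "Factorial_Ring.prime p" by (rule prime)
    show "finite V" by fact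
    show "{v, v} \<notin> E" for v using edge_neq by blast
    show "{v, u} \<in> E" if "{u, v} \<in> E" for u v using that by (simp add: insert_commute)
    show "\<exists>u\<in>V. u \<noteq> v \<and> {u, v} \<notin> E" if "v \<in> V" for v
      using assms(2) that by (auto simp: central_vertex_def)
    show "subgroup (\<iota> v ` carrier (G v)) W" if "v \<in> V" for v
      using graph_incl_hom[of V G, OF groups that] groups[OF that] group_W
      by (intro group_hom.img_is_subgroup) (simp add: group_hom_def group_hom_axioms_def)
    show "x \<otimes>\<^bsub>W\<^esub> y = y \<otimes>\<^bsub>W\<^esub> x" if "u \<in> V" "v \<in> V" "{u, v} \<in> E" "x \<in> \<iota> u ` carrier (G u)"
      "y \<in> \<iota> v ` carrier (G v)" for u v x y
      using that graph_incl_commute[of V G u v E, OF groups] by auto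
    show "generate W (\<Union>v\<in>V. \<iota> v ` carrier (G v)) = carrier W"
      by (rule graph_product_generated[of V G, OF groups])
    show "\<exists>x\<in>\<iota> v ` carrier (G v). x \<noteq> \<one>\<^bsub>W\<^esub>" if v: "v \<in> V" for v
    proof -
      interpret Gv: group "G v" by (rule groups[OF v])
      obtain x where "x \<in> carrier (G v)" "x \<noteq> \<one>\<^bsub>G v\<^esub>" using assms(3)[OF v] Gv.one_closed by blast
      then show ?thesis using separate(1)[OF v] by blast
    qed
    show "\<exists>N. p_normal p N W \<and> x \<notin> N" if v: "v \<in> V" and x: "x \<in> \<iota> v ` carrier (G v)" "x \<noteq> \<one>\<^bsub>W\<^esub>" for v x
    proof -
      obtain g where g: "g \<in> carrier (G v)" "x = \<iota> v g" using x by auto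
      have "g \<noteq> \<one>\<^bsub>G v\<^esub>"
        using x(2) g(2) hom_one[OF graph_incl_hom[of V G, OF groups v] groups[OF v] group_W] by auto
      then show ?thesis using separate(2)[OF v g(1)] g by simp
    qed
  next
    fix A :: "'v set" assume "A \<subseteq> V"
    then show "\<exists>f\<in>hom W W. (\<forall>v\<in>A. \<forall>x\<in>\<iota> v ` carrier (G v). f x = x) \<and>
        (\<forall>v\<in>V - A. \<forall>x\<in>\<iota> v ` carrier (G v). f x = \<one>\<^bsub>W\<^esub>)"
      by (rule graph_product_retraction)
  qed (rule graph_product_twist)
qed

end

section \<open>Finite generation of graph products and the conclusion\<close>

lemma finitely_generated_graph_product:
  assumes "finite V" and groups: "\<And>v. v \<in> V \<Longrightarrow> group (G v)"
    and "\<And>v. v \<in> V \<Longrightarrow> finitely_generated_group (G v)"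
  shows "finitely_generated_group (graph_product V E G)"
proof -
  let ?W = "graph_product V E G" and ?\<iota> = "graph_incl V E G"
  interpret W: group ?W by (rule group_graph_product[OF groups])
  have "\<forall>v\<in>V. \<exists>S. finite S \<and> S \<subseteq> carrier (G v) \<and> generate (G v) S = carrier (G v)"
    using assms(3) by (simp add: finitely_generated_group_def)
  from bchoice[OF this] obtain S where S: "\<And>v. v \<in> V \<Longrightarrow>
      finite (S v) \<and> S v \<subseteq> carrier (G v) \<and> generate (G v) (S v) = carrier (G v)"
    by blast
  let ?T = "\<Union>v\<in>V. ?\<iota> v ` S v"
  have closed: "?\<iota> v x \<in> carrier ?W" if "v \<in> V" "x \<in> carrier (G v)" for v x
    using hom_in_carrier[OF graph_incl_hom[of V G, OF groups that(1)] that(2)] .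
  have T: "?T \<subseteq> carrier ?W"
  proof (rule UN_least, rule image_subsetI)
    fix v x assume "v \<in> V" "x \<in> S v"
    then show "?\<iota> v x \<in> carrier ?W" using S[of v] closed by blast
  qed
  have vertex: "?\<iota> v ` carrier (G v) \<subseteq> generate ?W ?T" if v: "v \<in> V" for v
  proof -
    interpret i: group_hom "G v" ?W "?\<iota> v"
      using graph_incl_hom[of V G, OF groups v] groups[OF v] W.is_group
      by (simp add: group_hom_def group_hom_axioms_def)
    have "?\<iota> v ` carrier (G v) = generate ?W (?\<iota> v ` S v)"
      using i.generate_img[of "S v"] S[OF v] by simp
    also have "\<dots> \<subseteq> generate ?W ?T" by (rule W.mono_generate) (use v in blast)
    finally show ?thesis .
  qed
  have "generate ?W (\<Union>v\<in>V. ?\<iota> v ` carrier (G v)) \<subseteq> generate ?W ?T"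
    by (rule W.generate_subgroup_incl[OF UN_least W.generate_is_subgroup[OF T]]) (rule vertex)
  then have "carrier ?W \<subseteq> generate ?W ?T"
    by (simp only: graph_product_generated[of V G, OF groups])
  then have "generate ?W ?T = carrier ?W" using W.generate_incl[OF T] by (rule equalityI[rotated])
  moreover have "finite ?T" using assms(1) S by simp
  ultimately show ?thesis unfolding finitely_generated_group_def using T by blast
qed

theorem theorem1p6:
  fixes p :: nat
    and V :: "'v set" and E :: "'v set set"
    and G :: "'v \<Rightarrow> ('a, 'b) monoid_scheme"
  assumes "Factorial_Ring.prime p"
    and "finite V"
    and "simplicial_graph V E"
    and "\<not> (\<exists>v. central_vertex V E v)"
    and "\<And>v. v \<in> V \<Longrightarrow> group (G v)"
    and "\<And>v. v \<in> V \<Longrightarrow> carrier (G v) \<noteq> {\<one>\<^bsub>G v\<^esub>}"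
    and "\<And>v. v \<in> V \<Longrightarrow> finitely_generated_group (G v)"
    and "\<And>v. v \<in> V \<Longrightarrow> residually_p_finite p (G v)"
  shows "p_inner_automorphism_separable p (graph_product V E G)
    \<and> residually_p_finite p (OutpGroup p (graph_product V E G))
    \<and> virtually_residually_p_finite p (OutGroup (graph_product V E G))"
proof -
  let ?W = "graph_product V E G"
  interpret W: twistable_product ?W p V "\<lambda>u v. {u, v} \<in> E" "\<lambda>v. graph_incl V E G v ` carrier (G v)"
    by (rule twistable_graph_product[OF assms(1,3,5,2,4,6,8)])
  have fg: "finitely_generated_group ?W"
    by (rule finitely_generated_graph_product[OF assms(2,5,7)])
  have sep: "p_inner_automorphism_separable p ?W"
  proof (rule W.p_inner_automorphism_separableI[OF assms(1) fg])
    fix \<phi> assume \<phi>: "\<phi> \<in> auto ?W" and "\<And>N. p_normal p N ?W \<Longrightarrow>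
      \<exists>w\<in>carrier ?W. \<forall>a\<in>carrier ?W. \<exists>n\<in>N. \<phi> a \<otimes>\<^bsub>?W\<^esub> w = w \<otimes>\<^bsub>?W\<^esub> a \<otimes>\<^bsub>?W\<^esub> n"
    then have "W.locally_inner \<phi>"
      unfolding W.locally_inner_def using W.auto_closed[OF \<phi>] by blast
    then obtain w where w: "w \<in> carrier ?W"
      "\<And>a. a \<in> carrier ?W \<Longrightarrow> \<phi> a = w \<otimes>\<^bsub>?W\<^esub> a \<otimes>\<^bsub>?W\<^esub> inv\<^bsub>?W\<^esub> w"
      using W.locally_inner_imp_inner by metis
    have "\<phi> = W.inner w"
      using w(2) by (intro auto_eqI[OF \<phi> W.inner_auto[OF w(1)]]) (simp add: W.inner_def)
    then show "\<phi> \<in> inner_autos ?W" using w(1) by (simp add: W.inner_autos_eq)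
  qed
  have res: "residually_p_finite p (OutpGroup p ?W)"
    by (rule W.residually_p_finite_OutpGroup[OF assms(1) sep])
  show ?thesis
    using sep res W.virtually_residually_p_finite_OutGroup[OF prime_gt_0_nat[OF assms(1)] fg res]
    by simp
qed

end
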